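(* Let $(\Omega,\mathcal F,\mathbb P)$ be a probability space and $L^0=L^0(\Omega,\mathcal F,\mathbb P)$. Let $(E,\|\cdot\|)$ be a complete $L^0$-normed module which is stable with uniqueness, and let $K\subset E^*$ be $L^0$-convex and relatively stable. Then the following statements are equivalent: 1. $K$ is weak-$*$ closed (i.e. closed for $\sigma(E^*,E)$); 2. $K\cap\{z\in E^* : \|z\|^*\le\varepsilon\}$ is weak-$*$ closed for each $\varepsilon\in L^0_{++}$.
   Context: $L^0$ is the ring of equivalence classes (modulo a.s. equality) of real-valued $\mathcal F$-measurable random variables, ordered by almost sure dominance: $\eta\ge\xi$ means $\mathbb P(\eta\ge\xi)=1$, and $\eta>\xi$ means $\mathbb P(\eta>\xi)=1$. $L^0_+=\{\eta\in L^0:\eta\ge0\}$, $L^0_{++}=\{\eta\in L^0:\eta>0\}$. $L^0$ carries the topology with base $\{\eta+B_\varepsilon : \eta\in L^0,\varepsilon\in L^0_{++}\}$, where $B_\varepsilon=\{\xi\in L^0:|\xi|\le\varepsilon\}$. An $L^0$-seminorm on an $L^0$-module $E$ is a map $\|\cdot\|:E\to L^0_+$ with $\|\eta x\|=|\eta|\|x\|$ and $\|x+y\|\le\|x\|+\|y\|$ for all $\eta\in L^0$, $x,y\in E$; it is an $L^0$-norm if moreover $\|x\|=0$ implies $x=0$. A family $\mathscr P$ of $L^0$-seminorms induces the topology on $E$ (translation invariant) with neighborhood base of $0$ given by the sets $\{x\in E:\|x\|_F\le\varepsilon\}$, $\varepsilon\in L^0_{++}$, $F\subset\mathscr P$ finite,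 where $\|x\|_F=\operatorname{ess\,sup}\{\|x\|:\|\cdot\|\in F\}$. An $L^0$-normed module is an $L^0$-module with an $L^0$-norm, endowed with the induced topology. It is complete if every Cauchy net $\{x_\gamma\}_{\gamma\in\Gamma}$ in $E$ converges in $E$, where Cauchy means: for each $\varepsilon\in L^0_{++}$ there is $\gamma_\varepsilon$ with $\|x_\alpha-x_\beta\|\le\varepsilon$ for all $\alpha,\beta\ge\gamma_\varepsilon$. $E^*$ is the $L^0$-module of all $L^0$-linear continuous maps $z:E\to L^0$, with dual norm $\|z\|^*=\operatorname{ess\,sup}\{|z(x)|:x\in E,\ \|x\|\le1\}$. The weak-$*$ topology $\sigma(E^*,E)$ on $E^*$ is the one induced by the $L^0$-seminorms $z\mapsto|z(x)|$, $x\in E$. A set $K$ in an $L^0$-module is $L^0$-convex if $\eta x+(1-\eta)y\in K$ for all $x,y\in K$ and $\eta\in L^0$ with $0\le\eta\le1$. Let $\mathcal A$ be the measure algebra of $\mathcal F$ (events modulo null sets). $\Pi(\Omega)$ is the set of countable families $\{A_k\}_{k\in\mathbb N}\subset\mathcal A$ that are pairwise disjoint with supremum $\Omega$ (some $A_k$ may be null). Given a sequence $\{x_k\}$ in an $L^0$-module $G$ and $\{A_k\}\in\Pi(\Omega)$, an element $x\in G$ is a concatenation of $\{x_k\}$ along $\{A_k\}$ if $1_{A_k}x=1_{A_k}x_k$ for all $k$. The module $G$ is stable with uniqueness if for each sequence in $G$ and each partition in $\Pi(\Omega)$ there exists a unique concatenation in $G$. A subset $K\subset G$ is relatively stable if every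 concatenation $x\in G$ of a sequence in $K$ along a partition in $\Pi(\Omega)$ belongs to $K$ (existence of concatenations is not required). *)

theory Defs
  imports "HOL-Algebra.Module" "HOL-Probability.Probability_Measure"
begin

section \<open>The ring of random variables modulo almost sure equality\<close>

type_synonym 'w L0 = "('w \<Rightarrow> real) set"

definition L0_class :: "'w measure \<Rightarrow> ('w \<Rightarrow> real) \<Rightarrow> 'w L0" where
  "L0_class M f = {g \<in> borel_measurable M. AE w in M. g w = f w}"

definition L0_rv :: "'w L0 \<Rightarrow> 'w \<Rightarrow> real" where
  "L0_rv \<eta> = (SOME f. f \<in> \<eta>)"

definition L0 :: "'w measure \<Rightarrow> 'w L0 ring" where
  "L0 M = \<lparr>carrier = L0_class M ` borel_measurable M,
     monoid.mult = (\<lambda>\<eta> \<xi>. L0_class M (\<lambda>w. L0_rv \<eta> w * L0_rv \<xi> w)),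
     one = L0_class M (\<lambda>_. 1),
     zero = L0_class M (\<lambda>_. 0),
     add = (\<lambda>\<eta> \<xi>. L0_class M (\<lambda>w. L0_rv \<eta> w + L0_rv \<xi> w))\<rparr>"

definition L0_abs :: "'w measure \<Rightarrow> 'w L0 \<Rightarrow> 'w L0" where
  "L0_abs M \<eta> = L0_class M (\<lambda>w. \<bar>L0_rv \<eta> w\<bar>)"

definition L0_ind :: "'w measure \<Rightarrow> 'w set \<Rightarrow> 'w L0" where
  "L0_ind M A = L0_class M (indicator A)"

definition L0_le :: "'w measure \<Rightarrow> 'w L0 \<Rightarrow> 'w L0 \<Rightarrow> bool" where
  "L0_le M \<eta> \<xi> \<longleftrightarrow> (AE w in M. L0_rv \<eta> w \<le> L0_rv \<xi> w)"

text \<open>Strict inequality means strict almost everywhere; it is not ``at most and different''.\<close>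

definition L0_less :: "'w measure \<Rightarrow> 'w L0 \<Rightarrow> 'w L0 \<Rightarrow> bool" where
  "L0_less M \<eta> \<xi> \<longleftrightarrow> (AE w in M. L0_rv \<eta> w < L0_rv \<xi> w)"

definition L0_nonneg :: "'w measure \<Rightarrow> 'w L0 set" where
  "L0_nonneg M = {\<eta> \<in> carrier (L0 M). L0_le M \<zero>\<^bsub>L0 M\<^esub> \<eta>}"

definition L0_pos :: "'w measure \<Rightarrow> 'w L0 set" where
  "L0_pos M = {\<eta> \<in> carrier (L0 M). L0_less M \<zero>\<^bsub>L0 M\<^esub> \<eta>}"

definition L0_is_lub :: "'w measure \<Rightarrow> 'w L0 set \<Rightarrow> 'w L0 \<Rightarrow> bool" where
  "L0_is_lub M S \<eta> \<longleftrightarrow> \<eta> \<in> carrier (L0 M) \<and> (\<forall>\<xi>\<in>S. L0_le M \<xi> \<eta>) \<and>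
     (\<forall>\<zeta>\<in>carrier (L0 M). (\<forall>\<xi>\<in>S. L0_le M \<xi> \<zeta>) \<longrightarrow> L0_le M \<eta> \<zeta>)"

text \<open>The essential supremum of a family of random variables is its least upper bound for
  almost sure dominance.  It is only used for families that are nonempty and bounded above.\<close>

definition L0_esssup :: "'w measure \<Rightarrow> 'w L0 set \<Rightarrow> 'w L0" where
  "L0_esssup M S = (THE \<eta>. L0_is_lub M S \<eta>)"

text \<open>The balls \<open>{\<xi>. \<bar>\<xi>\<bar> \<le> \<epsilon>}\<close> are a base of neighbourhoods of \<open>0\<close>; they need not be open.\<close>

definition L0_topology :: "'w measure \<Rightarrow> 'w L0 topology" where
  "L0_topology M = topology (\<lambda>U. U \<subseteq> carrier (L0 M) \<and>
     (\<forall>\<eta>\<in>U. \<exists>\<epsilon>\<in>L0_pos M.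
        (\<lambda>\<xi>. \<eta> \<oplus>\<^bsub>L0 M\<^esub> \<xi>) ` {\<xi> \<in> carrier (L0 M). L0_le M (L0_abs M \<xi>) \<epsilon>} \<subseteq> U))"


section \<open>Seminorms, induced topologies, completeness\<close>

definition L0_seminorm ::
  "'w measure \<Rightarrow> ('w L0, 'e, 'm) module_scheme \<Rightarrow> ('e \<Rightarrow> 'w L0) \<Rightarrow> bool" where
  "L0_seminorm M E p \<longleftrightarrow> p \<in> carrier E \<rightarrow> L0_nonneg M \<and>
     (\<forall>\<eta>\<in>carrier (L0 M). \<forall>x\<in>carrier E. p (\<eta> \<odot>\<^bsub>E\<^esub> x) = L0_abs M \<eta> \<otimes>\<^bsub>L0 M\<^esub> p x) \<and>
     (\<forall>x\<in>carrier E. \<forall>y\<in>carrier E. L0_le M (p (x \<oplus>\<^bsub>E\<^esub> y)) (p x \<oplus>\<^bsub>L0 M\<^esub> p y))"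

definition L0_norm ::
  "'w measure \<Rightarrow> ('w L0, 'e, 'm) module_scheme \<Rightarrow> ('e \<Rightarrow> 'w L0) \<Rightarrow> bool" where
  "L0_norm M E p \<longleftrightarrow> L0_seminorm M E p \<and>
     (\<forall>x\<in>carrier E. p x = \<zero>\<^bsub>L0 M\<^esub> \<longrightarrow> x = \<zero>\<^bsub>E\<^esub>)"

definition L0_normed_module ::
  "'w measure \<Rightarrow> ('w L0, 'e, 'm) module_scheme \<Rightarrow> ('e \<Rightarrow> 'w L0) \<Rightarrow> bool" where
  "L0_normed_module M E nrm \<longleftrightarrow> Module.module (L0 M) E \<and> L0_norm M E nrm"

text \<open>Seminorms take values in \<open>L0_nonneg\<close>, so inserting \<open>0\<close> matters only for empty \<open>F\<close>, where
  it gives the supremum in \<open>L0_nonneg\<close>.\<close>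

definition L0_max_seminorm ::
  "'w measure \<Rightarrow> ('e \<Rightarrow> 'w L0) set \<Rightarrow> 'e \<Rightarrow> 'w L0" where
  "L0_max_seminorm M F x = L0_esssup M (insert \<zero>\<^bsub>L0 M\<^esub> ((\<lambda>p. p x) ` F))"

definition L0_seminorm_topology ::
  "'w measure \<Rightarrow> ('w L0, 'e, 'm) module_scheme \<Rightarrow> ('e \<Rightarrow> 'w L0) set \<Rightarrow> 'e topology" where
  "L0_seminorm_topology M E P = topology (\<lambda>U. U \<subseteq> carrier E \<and>
     (\<forall>x\<in>U. \<exists>F \<epsilon>. finite F \<and> F \<subseteq> P \<and> \<epsilon> \<in> L0_pos M \<and>
        (\<lambda>y. x \<oplus>\<^bsub>E\<^esub> y) ` {y \<in> carrier E. L0_le M (L0_max_seminorm M F y) \<epsilon>} \<subseteq> U))"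

definition directed_set :: "'i set \<Rightarrow> ('i \<Rightarrow> 'i \<Rightarrow> bool) \<Rightarrow> bool" where
  "directed_set D leq \<longleftrightarrow> D \<noteq> {} \<and> (\<forall>a\<in>D. leq a a) \<and>
     (\<forall>a\<in>D. \<forall>b\<in>D. \<forall>c\<in>D. leq a b \<longrightarrow> leq b c \<longrightarrow> leq a c) \<and>
     (\<forall>a\<in>D. \<forall>b\<in>D. \<exists>c\<in>D. leq a c \<and> leq b c)"

definition L0_Cauchy_net ::
  "'w measure \<Rightarrow> ('w L0, 'e, 'm) module_scheme \<Rightarrow> ('e \<Rightarrow> 'w L0) \<Rightarrow>
   'i set \<Rightarrow> ('i \<Rightarrow> 'i \<Rightarrow> bool) \<Rightarrow> ('i \<Rightarrow> 'e) \<Rightarrow> bool" where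
  "L0_Cauchy_net M E nrm D leq x \<longleftrightarrow> x \<in> D \<rightarrow> carrier E \<and>
     (\<forall>\<epsilon>\<in>L0_pos M. \<exists>\<gamma>\<in>D. \<forall>\<alpha>\<in>D. \<forall>\<beta>\<in>D. leq \<gamma> \<alpha> \<longrightarrow> leq \<gamma> \<beta> \<longrightarrow>
        L0_le M (nrm (x \<alpha> \<ominus>\<^bsub>E\<^esub> x \<beta>)) \<epsilon>)"

definition net_converges ::
  "'e topology \<Rightarrow> 'i set \<Rightarrow> ('i \<Rightarrow> 'i \<Rightarrow> bool) \<Rightarrow> ('i \<Rightarrow> 'e) \<Rightarrow> 'e \<Rightarrow> bool" where
  "net_converges T D leq x l \<longleftrightarrow> l \<in> topspace T \<and>
     (\<forall>U. openin T U \<and> l \<in> U \<longrightarrow> (\<exists>\<gamma>\<in>D. \<forall>\<alpha>\<in>D. leq \<gamma> \<alpha> \<longrightarrow> x \<alpha> \<in> U))"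

text \<open>A formula cannot quantify over the type of the index set.  Nets indexed by sets of
  elements of type \<open>'w L0\<close> suffice: lemma \<open>L0_complete_any_index\<close> below derives the convergence
  of Cauchy nets with indices of arbitrary type.\<close>

definition L0_complete ::
  "'w measure \<Rightarrow> ('w L0, 'e, 'm) module_scheme \<Rightarrow> ('e \<Rightarrow> 'w L0) \<Rightarrow> bool" where
  "L0_complete M E nrm \<longleftrightarrow> (\<forall>(D :: 'w L0 set) leq x.
     directed_set D leq \<and> L0_Cauchy_net M E nrm D leq x \<longrightarrow>
     (\<exists>l\<in>carrier E. net_converges (L0_seminorm_topology M E {nrm}) D leq x l))"


section \<open>The dual module and its weak-star topology\<close>

definition L0_linear ::
  "'w measure \<Rightarrow> ('w L0, 'e, 'm) module_scheme \<Rightarrow> ('e \<Rightarrow> 'w L0) \<Rightarrow> bool" where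
  "L0_linear M E z \<longleftrightarrow> z \<in> carrier E \<rightarrow> carrier (L0 M) \<and>
     (\<forall>x\<in>carrier E. \<forall>y\<in>carrier E. z (x \<oplus>\<^bsub>E\<^esub> y) = z x \<oplus>\<^bsub>L0 M\<^esub> z y) \<and>
     (\<forall>\<eta>\<in>carrier (L0 M). \<forall>x\<in>carrier E. z (\<eta> \<odot>\<^bsub>E\<^esub> x) = \<eta> \<otimes>\<^bsub>L0 M\<^esub> z x)"

text \<open>Functionals are extensional functions, so that equality of functionals is equality on
  \<open>carrier E\<close>.  The ring fields \<open>mult\<close> and \<open>one\<close> of the record play no role in a module.\<close>

definition L0_dual ::
  "'w measure \<Rightarrow> ('w L0, 'e, 'm) module_scheme \<Rightarrow> ('e \<Rightarrow> 'w L0) \<Rightarrow> ('w L0, 'e \<Rightarrow> 'w L0) module" where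
  "L0_dual M E nrm =
    \<lparr>carrier = {z \<in> extensional (carrier E). L0_linear M E z \<and>
       continuous_map (L0_seminorm_topology M E {nrm}) (L0_topology M) z},
     monoid.mult = undefined, one = undefined,
     zero = (\<lambda>x\<in>carrier E. \<zero>\<^bsub>L0 M\<^esub>),
     add = (\<lambda>z z'. \<lambda>x\<in>carrier E. z x \<oplus>\<^bsub>L0 M\<^esub> z' x),
     module.smult = (\<lambda>\<eta> z. \<lambda>x\<in>carrier E. \<eta> \<otimes>\<^bsub>L0 M\<^esub> z x)\<rparr>"

definition L0_dual_norm ::
  "'w measure \<Rightarrow> ('w L0, 'e, 'm) module_scheme \<Rightarrow> ('e \<Rightarrow> 'w L0) \<Rightarrow> ('e \<Rightarrow> 'w L0) \<Rightarrow> 'w L0" where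
  "L0_dual_norm M E nrm z =
     L0_esssup M {L0_abs M (z x) |x. x \<in> carrier E \<and> L0_le M (nrm x) \<one>\<^bsub>L0 M\<^esub>}"

definition L0_weak_star ::
  "'w measure \<Rightarrow> ('w L0, 'e, 'm) module_scheme \<Rightarrow> ('e \<Rightarrow> 'w L0) \<Rightarrow> ('e \<Rightarrow> 'w L0) topology" where
  "L0_weak_star M E nrm =
     L0_seminorm_topology M (L0_dual M E nrm) ((\<lambda>x z. L0_abs M (z x)) ` carrier E)"


section \<open>Convexity and stability\<close>

definition L0_convex :: "'w measure \<Rightarrow> ('w L0, 'e, 'm) module_scheme \<Rightarrow> 'e set \<Rightarrow> bool" where
  "L0_convex M G K \<longleftrightarrow> (\<forall>x\<in>K. \<forall>y\<in>K. \<forall>\<eta>\<in>carrier (L0 M).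
     L0_le M \<zero>\<^bsub>L0 M\<^esub> \<eta> \<and> L0_le M \<eta> \<one>\<^bsub>L0 M\<^esub> \<longrightarrow>
     \<eta> \<odot>\<^bsub>G\<^esub> x \<oplus>\<^bsub>G\<^esub> (\<one>\<^bsub>L0 M\<^esub> \<ominus>\<^bsub>L0 M\<^esub> \<eta>) \<odot>\<^bsub>G\<^esub> y \<in> K)"

text \<open>Elements of the measure algebra are represented by events; disjointness and covering
  are therefore required only up to null sets.\<close>

definition ae_partition :: "'w measure \<Rightarrow> (nat \<Rightarrow> 'w set) \<Rightarrow> bool" where
  "ae_partition M A \<longleftrightarrow> (\<forall>k. A k \<in> sets M) \<and>
     (\<forall>i j. i \<noteq> j \<longrightarrow> A i \<inter> A j \<in> null_sets M) \<and> space M - (\<Union>k. A k) \<in> null_sets M"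

definition is_concatenation ::
  "'w measure \<Rightarrow> ('w L0, 'g, 'm) module_scheme \<Rightarrow> (nat \<Rightarrow> 'w set) \<Rightarrow> (nat \<Rightarrow> 'g) \<Rightarrow> 'g \<Rightarrow> bool" where
  "is_concatenation M G A xs x \<longleftrightarrow> x \<in> carrier G \<and>
     (\<forall>k. L0_ind M (A k) \<odot>\<^bsub>G\<^esub> x = L0_ind M (A k) \<odot>\<^bsub>G\<^esub> xs k)"

definition stable_with_uniqueness :: "'w measure \<Rightarrow> ('w L0, 'g, 'm) module_scheme \<Rightarrow> bool" where
  "stable_with_uniqueness M G \<longleftrightarrow> (\<forall>A xs. ae_partition M A \<and> range xs \<subseteq> carrier G \<longrightarrow>
     (\<exists>!x. is_concatenation M G A xs x))"

definition relatively_stable ::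
  "'w measure \<Rightarrow> ('w L0, 'g, 'm) module_scheme \<Rightarrow> 'g set \<Rightarrow> bool" where
  "relatively_stable M G K \<longleftrightarrow> K \<subseteq> carrier G \<and>
     (\<forall>A xs x. ae_partition M A \<and> range xs \<subseteq> K \<and> is_concatenation M G A xs x \<longrightarrow> x \<in> K)"


section \<open>Calculating with representatives\<close>

lemma L0_class_eqI:
  assumes "AE w in M. f w = g w"
  shows "L0_class M f = L0_class M g"
proof -
  have "(AE w in M. h w = f w) \<longleftrightarrow> (AE w in M. h w = g w)" for h
    by (rule eventually_cong[OF assms]) simp
  then show ?thesis by (simp add: L0_class_def)
qed

lemma L0_class_carrier [intro, simp]:
  "f \<in> borel_measurable M \<Longrightarrow> L0_class M f \<in> carrier (L0 M)"
  by (simp add: L0_def)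

lemma L0_rv_class_mem: "f \<in> borel_measurable M \<Longrightarrow> L0_rv (L0_class M f) \<in> L0_class M f"
  unfolding L0_rv_def by (rule someI[of _ f]) (simp add: L0_class_def)

lemma L0_rv_class: "f \<in> borel_measurable M \<Longrightarrow> AE w in M. L0_rv (L0_class M f) w = f w"
  using L0_rv_class_mem[of f M] by (simp add: L0_class_def)

lemma L0_rv_measurable [measurable]: "\<eta> \<in> carrier (L0 M) \<Longrightarrow> L0_rv \<eta> \<in> borel_measurable M"
  using L0_rv_class_mem[of _ M] by (auto simp: L0_def L0_class_def)

lemma L0_class_rv: "\<eta> \<in> carrier (L0 M) \<Longrightarrow> L0_class M (L0_rv \<eta>) = \<eta>"
  by (auto simp: L0_def intro!: L0_class_eqI L0_rv_class)

lemma L0_eqI: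
  assumes "\<eta> \<in> carrier (L0 M)" "\<xi> \<in> carrier (L0 M)" "AE w in M. L0_rv \<eta> w = L0_rv \<xi> w"
  shows "\<eta> = \<xi>"
  using L0_class_eqI[OF assms(3)] assms(1,2) by (simp add: L0_class_rv)

lemma L0_rv_add:
  assumes "\<eta> \<in> carrier (L0 M)" "\<xi> \<in> carrier (L0 M)"
  shows "AE w in M. L0_rv (\<eta> \<oplus>\<^bsub>L0 M\<^esub> \<xi>) w = L0_rv \<eta> w + L0_rv \<xi> w"
proof -
  note [measurable] = assms[THEN L0_rv_measurable]
  show ?thesis by (simp add: L0_def L0_rv_class)
qed

lemma L0_rv_mult:
  assumes "\<eta> \<in> carrier (L0 M)" "\<xi> \<in> carrier (L0 M)"
  shows "AE w in M. L0_rv (\<eta> \<otimes>\<^bsub>L0 M\<^esub> \<xi>) w = L0_rv \<eta> w * L0_rv \<xi> w"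
proof -
  note [measurable] = assms[THEN L0_rv_measurable]
  show ?thesis by (simp add: L0_def L0_rv_class)
qed

lemma L0_rv_zero: "AE w in M. L0_rv \<zero>\<^bsub>L0 M\<^esub> w = 0"
  by (simp add: L0_def L0_rv_class)

lemma L0_rv_one: "AE w in M. L0_rv \<one>\<^bsub>L0 M\<^esub> w = 1"
  by (simp add: L0_def L0_rv_class)

lemma L0_add_closed:
  assumes "\<eta> \<in> carrier (L0 M)" "\<xi> \<in> carrier (L0 M)"
  shows "\<eta> \<oplus>\<^bsub>L0 M\<^esub> \<xi> \<in> carrier (L0 M)"
proof -
  note [measurable] = assms[THEN L0_rv_measurable]
  show ?thesis by (simp add: L0_def)
qed

lemma L0_mult_closed:
  assumes "\<eta> \<in> carrier (L0 M)" "\<xi> \<in> carrier (L0 M)"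
  shows "\<eta> \<otimes>\<^bsub>L0 M\<^esub> \<xi> \<in> carrier (L0 M)"
proof -
  note [measurable] = assms[THEN L0_rv_measurable]
  show ?thesis by (simp add: L0_def)
qed

lemma L0_zero_closed: "\<zero>\<^bsub>L0 M\<^esub> \<in> carrier (L0 M)"
  by (simp add: L0_def)

lemma L0_one_closed: "\<one>\<^bsub>L0 M\<^esub> \<in> carrier (L0 M)"
  by (simp add: L0_def)

lemmas L0_closed = L0_add_closed L0_mult_closed L0_zero_closed L0_one_closed

lemma L0_abs_closed:
  assumes "\<eta> \<in> carrier (L0 M)"
  shows "L0_abs M \<eta> \<in> carrier (L0 M)"
proof -
  note [measurable] = assms[THEN L0_rv_measurable]
  show ?thesis by (simp add: L0_abs_def)
qed

lemma L0_rv_abs: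
  assumes "\<eta> \<in> carrier (L0 M)"
  shows "AE w in M. L0_rv (L0_abs M \<eta>) w = \<bar>L0_rv \<eta> w\<bar>"
proof -
  note [measurable] = assms[THEN L0_rv_measurable]
  show ?thesis by (simp add: L0_abs_def L0_rv_class)
qed

lemma L0_add_assoc:
  assumes x: "x \<in> carrier (L0 M)" and y: "y \<in> carrier (L0 M)" and z: "z \<in> carrier (L0 M)"
  shows "x \<oplus>\<^bsub>L0 M\<^esub> y \<oplus>\<^bsub>L0 M\<^esub> z = x \<oplus>\<^bsub>L0 M\<^esub> (y \<oplus>\<^bsub>L0 M\<^esub> z)"
  apply (rule L0_eqI[of _ M])
    apply (intro L0_closed x y z)+
  using L0_rv_add[OF L0_add_closed[OF x y] z] L0_rv_add[OF x y]
    L0_rv_add[OF x L0_add_closed[OF y z]] L0_rv_add[OF y z]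
  by eventually_elim simp

lemma L0_mult_assoc:
  assumes x: "x \<in> carrier (L0 M)" and y: "y \<in> carrier (L0 M)" and z: "z \<in> carrier (L0 M)"
  shows "x \<otimes>\<^bsub>L0 M\<^esub> y \<otimes>\<^bsub>L0 M\<^esub> z = x \<otimes>\<^bsub>L0 M\<^esub> (y \<otimes>\<^bsub>L0 M\<^esub> z)"
  apply (rule L0_eqI[of _ M])
    apply (intro L0_closed x y z)+
  using L0_rv_mult[OF L0_mult_closed[OF x y] z] L0_rv_mult[OF x y]
    L0_rv_mult[OF x L0_mult_closed[OF y z]] L0_rv_mult[OF y z]
  by eventually_elim simp

lemma L0_distrib:
  assumes x: "x \<in> carrier (L0 M)" and y: "y \<in> carrier (L0 M)" and z: "z \<in> carrier (L0 M)"
  shows "(x \<oplus>\<^bsub>L0 M\<^esub> y) \<otimes>\<^bsub>L0 M\<^esub> z = x \<otimes>\<^bsub>L0 M\<^esub> z \<oplus>\<^bsub>L0 M\<^esub> y \<otimes>\<^bsub>L0 M\<^esub> z"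
  apply (rule L0_eqI[of _ M])
    apply (intro L0_closed x y z)+
  using L0_rv_mult[OF L0_add_closed[OF x y] z] L0_rv_add[OF x y] L0_rv_mult[OF x z]
    L0_rv_mult[OF y z] L0_rv_add[OF L0_mult_closed[OF x z] L0_mult_closed[OF y z]]
  by eventually_elim (simp add: algebra_simps)

lemma L0_zero_add:
  assumes x: "x \<in> carrier (L0 M)"
  shows "\<zero>\<^bsub>L0 M\<^esub> \<oplus>\<^bsub>L0 M\<^esub> x = x"
  apply (rule L0_eqI[of _ M, OF L0_add_closed[OF L0_zero_closed x] x])
  using L0_rv_add[OF L0_zero_closed x] L0_rv_zero by eventually_elim simp

lemma L0_one_mult:
  assumes x: "x \<in> carrier (L0 M)"
  shows "\<one>\<^bsub>L0 M\<^esub> \<otimes>\<^bsub>L0 M\<^esub> x = x"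
  apply (rule L0_eqI[of _ M, OF L0_mult_closed[OF L0_one_closed x] x])
  using L0_rv_mult[OF L0_one_closed x] L0_rv_one by eventually_elim simp

lemma L0_ex_minus:
  assumes x: "x \<in> carrier (L0 M)"
  shows "\<exists>y\<in>carrier (L0 M). y \<oplus>\<^bsub>L0 M\<^esub> x = \<zero>\<^bsub>L0 M\<^esub>"
proof
  have m: "(\<lambda>w. - L0_rv x w) \<in> borel_measurable M"
    using L0_rv_measurable[OF x] by measurable
  show c: "L0_class M (\<lambda>w. - L0_rv x w) \<in> carrier (L0 M)" using m by simp
  show "L0_class M (\<lambda>w. - L0_rv x w) \<oplus>\<^bsub>L0 M\<^esub> x = \<zero>\<^bsub>L0 M\<^esub>"
    apply (rule L0_eqI[of _ M, OF L0_add_closed[OF c x] L0_zero_closed])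
    using L0_rv_add[OF c x] L0_rv_zero L0_rv_class[OF m]
    by eventually_elim simp
qed

lemma L0_cring: "cring (L0 M)"
proof (rule cringI)
  show "abelian_group (L0 M)"
    by (rule abelian_groupI)
      (simp_all add: L0_closed L0_add_assoc L0_zero_add L0_ex_minus, simp add: L0_def add.commute)
  show "comm_monoid (L0 M)"
    by (rule comm_monoidI)
      (simp_all add: L0_closed L0_mult_assoc L0_one_mult, simp add: L0_def mult.commute)
qed (rule L0_distrib)

interpretation L0: cring "L0 M" for M :: "'w measure"
  by (rule L0_cring)

lemma L0_le_refl: "L0_le M \<eta> \<eta>"
  by (simp add: L0_le_def)

lemma L0_le_trans: "L0_le M \<eta> \<xi> \<Longrightarrow> L0_le M \<xi> \<zeta> \<Longrightarrow> L0_le M \<eta> \<zeta>"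
  unfolding L0_le_def by (erule (1) eventually_elim2) simp

lemma L0_le_antisym:
  "\<eta> \<in> carrier (L0 M) \<Longrightarrow> \<xi> \<in> carrier (L0 M) \<Longrightarrow> L0_le M \<eta> \<xi> \<Longrightarrow> L0_le M \<xi> \<eta> \<Longrightarrow> \<eta> = \<xi>"
  unfolding L0_le_def by (rule L0_eqI[of _ M], assumption, assumption, erule (1) eventually_elim2) simp

lemma L0_posD: "\<epsilon> \<in> L0_pos M \<Longrightarrow> \<epsilon> \<in> carrier (L0 M)"
  by (simp add: L0_pos_def)

lemma L0_pos_iff: "\<epsilon> \<in> L0_pos M \<longleftrightarrow> \<epsilon> \<in> carrier (L0 M) \<and> (AE w in M. 0 < L0_rv \<epsilon> w)"
proof -
  have "(AE w in M. L0_rv \<zero>\<^bsub>L0 M\<^esub> w < L0_rv \<epsilon> w) \<longleftrightarrow> (AE w in M. 0 < L0_rv \<epsilon> w)"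
    by (rule eventually_cong[OF L0_rv_zero[of M]]) simp
  then show ?thesis by (simp add: L0_pos_def L0_less_def)
qed

lemma L0_one_pos: "\<one>\<^bsub>L0 M\<^esub> \<in> L0_pos M"
  unfolding L0_pos_iff using L0_rv_one[of M] by (auto simp: L0_closed elim: eventually_mono)

lemma L0_pos_min:
  assumes "\<epsilon> \<in> L0_pos M" "\<delta> \<in> L0_pos M"
  shows "\<exists>\<theta>\<in>L0_pos M. L0_le M \<theta> \<epsilon> \<and> L0_le M \<theta> \<delta>"
proof -
  note [measurable] = assms[THEN L0_posD, THEN L0_rv_measurable]
  have m: "(\<lambda>w. min (L0_rv \<epsilon> w) (L0_rv \<delta> w)) \<in> borel_measurable M" by measurable
  let ?t = "L0_class M (\<lambda>w. min (L0_rv \<epsilon> w) (L0_rv \<delta> w))"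
  have "AE w in M. 0 < L0_rv ?t w"
    using L0_rv_class[OF m] assms[unfolded L0_pos_iff, THEN conjunct2]
    by eventually_elim simp
  moreover have "L0_le M ?t \<epsilon>" "L0_le M ?t \<delta>"
    using L0_rv_class[OF m] unfolding L0_le_def by (auto elim: eventually_mono)
  ultimately show ?thesis
    using m by (intro bexI[of _ ?t]) (auto simp: L0_pos_iff)
qed

lemma L0_pos_half:
  assumes "\<epsilon> \<in> L0_pos M"
  shows "\<exists>\<theta>\<in>L0_pos M. \<theta> \<oplus>\<^bsub>L0 M\<^esub> \<theta> = \<epsilon>"
proof -
  note [measurable] = assms[THEN L0_posD, THEN L0_rv_measurable]
  have m: "(\<lambda>w. L0_rv \<epsilon> w / 2) \<in> borel_measurable M" by measurable
  let ?t = "L0_class M (\<lambda>w. L0_rv \<epsilon> w / 2)"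
  have c: "?t \<in> carrier (L0 M)" using m by blast
  have "AE w in M. 0 < L0_rv ?t w"
    using L0_rv_class[OF m] assms[unfolded L0_pos_iff, THEN conjunct2]
    by eventually_elim simp
  moreover have "?t \<oplus>\<^bsub>L0 M\<^esub> ?t = \<epsilon>"
    apply (rule L0_eqI[of _ M])
      apply (intro L0_closed c L0_posD assms)+
    using L0_rv_class[OF m] L0_rv_add[OF c c] by eventually_elim simp
  ultimately show ?thesis
    using c by (intro bexI[of _ ?t]) (auto simp: L0_pos_iff)
qed

lemma L0_add_mono:
  assumes "a \<in> carrier (L0 M)" "b \<in> carrier (L0 M)" "c \<in> carrier (L0 M)" "d \<in> carrier (L0 M)"
    "L0_le M a c" "L0_le M b d"
  shows "L0_le M (a \<oplus>\<^bsub>L0 M\<^esub> b) (c \<oplus>\<^bsub>L0 M\<^esub> d)"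
  using L0_rv_add[OF assms(1,2)] L0_rv_add[OF assms(3,4)] assms(5,6)
  unfolding L0_le_def by eventually_elim simp

lemma L0_le_pos: "\<epsilon> \<in> L0_pos M \<Longrightarrow> L0_le M \<zero>\<^bsub>L0 M\<^esub> \<epsilon>"
  unfolding L0_pos_def L0_less_def L0_le_def by (auto intro: eventually_mono[OF _ less_imp_le])


section \<open>Essential suprema of finite families and the topologies\<close>

lemma L0_is_lub_unique: "L0_is_lub M S \<eta> \<Longrightarrow> L0_is_lub M S \<xi> \<Longrightarrow> \<eta> = \<xi>"
  using L0_le_antisym[of \<eta> M \<xi>] unfolding L0_is_lub_def by simp

lemma L0_esssup_eq: "L0_is_lub M S \<eta> \<Longrightarrow> L0_esssup M S = \<eta>"
  unfolding L0_esssup_def by (rule the_equality) (assumption, rule L0_is_lub_unique)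

lemma L0_finite_lub:
  assumes "finite S" "S \<noteq> {}" "S \<subseteq> carrier (L0 M)"
  shows "\<exists>\<eta>. L0_is_lub M S \<eta>"
  using assms
proof (induction S rule: finite_ne_induct)
  case (singleton x)
  then show ?case by (auto simp: L0_is_lub_def L0_le_refl)
next
  case (insert x S)
  then obtain \<eta> where lub: "L0_is_lub M S \<eta>" by auto
  then have \<eta>: "\<eta> \<in> carrier (L0 M)" by (simp add: L0_is_lub_def)
  have x: "x \<in> carrier (L0 M)" using insert by simp
  note [measurable] = \<eta>[THEN L0_rv_measurable] x[THEN L0_rv_measurable]
  have m: "(\<lambda>w. max (L0_rv x w) (L0_rv \<eta> w)) \<in> borel_measurable M" by measurable
  let ?t = "L0_class M (\<lambda>w. max (L0_rv x w) (L0_rv \<eta> w))"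
  have 1: "L0_le M x ?t" "L0_le M \<eta> ?t"
    using L0_rv_class[OF m] unfolding L0_le_def by (auto elim: eventually_mono)
  have 2: "L0_le M ?t z" if "L0_le M x z" "L0_le M \<eta> z" for z
    using L0_rv_class[OF m] that unfolding L0_le_def by eventually_elim simp
  have "L0_is_lub M (insert x S) ?t"
    using lub 1 2 m unfolding L0_is_lub_def by (auto intro: L0_le_trans)
  then show ?case by blast
qed

lemma L0_max_seminorm_le_iff:
  assumes "finite F" "\<And>p. p \<in> F \<Longrightarrow> p x \<in> carrier (L0 M)" "\<epsilon> \<in> L0_pos M"
  shows "L0_le M (L0_max_seminorm M F x) \<epsilon> \<longleftrightarrow> (\<forall>p\<in>F. L0_le M (p x) \<epsilon>)"
proof -
  let ?S = "insert \<zero>\<^bsub>L0 M\<^esub> ((\<lambda>p. p x) ` F)"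
  obtain \<eta> where \<eta>: "L0_is_lub M ?S \<eta>"
    using L0_finite_lub[of ?S M] assms by auto
  then have "L0_max_seminorm M F x = \<eta>"
    unfolding L0_max_seminorm_def by (rule L0_esssup_eq)
  with \<eta> show ?thesis
    using assms(3) L0_le_pos[OF assms(3)] L0_posD[OF assms(3)]
    unfolding L0_is_lub_def by (auto intro: L0_le_trans)
qed

lemma openin_L0_topology:
  "openin (L0_topology M) U \<longleftrightarrow> U \<subseteq> carrier (L0 M) \<and>
     (\<forall>\<eta>\<in>U. \<exists>\<epsilon>\<in>L0_pos M. \<forall>\<xi>\<in>carrier (L0 M). L0_le M (L0_abs M \<xi>) \<epsilon> \<longrightarrow> \<eta> \<oplus>\<^bsub>L0 M\<^esub> \<xi> \<in> U)"
proof -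
  let ?P = "\<lambda>U. U \<subseteq> carrier (L0 M) \<and>
     (\<forall>\<eta>\<in>U. \<exists>\<epsilon>\<in>L0_pos M. \<forall>\<xi>\<in>carrier (L0 M). L0_le M (L0_abs M \<xi>) \<epsilon> \<longrightarrow> \<eta> \<oplus>\<^bsub>L0 M\<^esub> \<xi> \<in> U)"
  have "istopology ?P"
    unfolding istopology_def
  proof (intro conjI allI impI)
    fix S T assume S: "?P S" and T: "?P T"
    show "S \<inter> T \<subseteq> carrier (L0 M)" using S by blast
    show "\<forall>\<eta>\<in>S \<inter> T. \<exists>\<epsilon>\<in>L0_pos M. \<forall>\<xi>\<in>carrier (L0 M).
        L0_le M (L0_abs M \<xi>) \<epsilon> \<longrightarrow> \<eta> \<oplus>\<^bsub>L0 M\<^esub> \<xi> \<in> S \<inter> T"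
    proof
      fix \<eta> assume \<eta>: "\<eta> \<in> S \<inter> T"
      obtain a where a: "a \<in> L0_pos M"
        "\<forall>\<xi>\<in>carrier (L0 M). L0_le M (L0_abs M \<xi>) a \<longrightarrow> \<eta> \<oplus>\<^bsub>L0 M\<^esub> \<xi> \<in> S"
        using conjunct2[OF S, rule_format, OF IntD1[OF \<eta>]] by blast
      obtain b where b: "b \<in> L0_pos M"
        "\<forall>\<xi>\<in>carrier (L0 M). L0_le M (L0_abs M \<xi>) b \<longrightarrow> \<eta> \<oplus>\<^bsub>L0 M\<^esub> \<xi> \<in> T"
        using conjunct2[OF T, rule_format, OF IntD2[OF \<eta>]] by blast
      note ab = a b
      from a(1) b(1) obtain c where "c \<in> L0_pos M" "L0_le M c a" "L0_le M c b"
        using L0_pos_min by blast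
      with ab show "\<exists>\<epsilon>\<in>L0_pos M. \<forall>\<xi>\<in>carrier (L0 M).
        L0_le M (L0_abs M \<xi>) \<epsilon> \<longrightarrow> \<eta> \<oplus>\<^bsub>L0 M\<^esub> \<xi> \<in> S \<inter> T"
        by (intro bexI[of _ c]) (auto intro: L0_le_trans)
    qed
  next
    fix \<K> assume "\<forall>S\<in>\<K>. ?P S"
    then show "\<Union>\<K> \<subseteq> carrier (L0 M)"
      "\<forall>\<eta>\<in>\<Union>\<K>. \<exists>\<epsilon>\<in>L0_pos M. \<forall>\<xi>\<in>carrier (L0 M).
        L0_le M (L0_abs M \<xi>) \<epsilon> \<longrightarrow> \<eta> \<oplus>\<^bsub>L0 M\<^esub> \<xi> \<in> \<Union>\<K>"
      by (blast, fast)
  qed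
  moreover have "L0_topology M = topology ?P"
    unfolding L0_topology_def by (rule arg_cong[where f = topology]) (simp add: image_subset_iff Ball_def imp_conjL)
  ultimately show ?thesis
    by (simp add: topology_inverse')
qed

lemma openin_L0_seminorm_topology:
  assumes P: "\<And>p x. p \<in> P \<Longrightarrow> x \<in> carrier E \<Longrightarrow> p x \<in> carrier (L0 M)"
  shows "openin (L0_seminorm_topology M E P) U \<longleftrightarrow> U \<subseteq> carrier E \<and>
     (\<forall>x\<in>U. \<exists>F \<epsilon>. finite F \<and> F \<subseteq> P \<and> \<epsilon> \<in> L0_pos M \<and>
        (\<forall>y\<in>carrier E. (\<forall>p\<in>F. L0_le M (p y) \<epsilon>) \<longrightarrow> x \<oplus>\<^bsub>E\<^esub> y \<in> U))"
proof -
  let ?Q = "\<lambda>U x F \<epsilon>. finite F \<and> F \<subseteq> P \<and> \<epsilon> \<in> L0_pos M \<and>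
        (\<forall>y\<in>carrier E. (\<forall>p\<in>F. L0_le M (p y) \<epsilon>) \<longrightarrow> x \<oplus>\<^bsub>E\<^esub> y \<in> U)"
  let ?P = "\<lambda>U. U \<subseteq> carrier E \<and> (\<forall>x\<in>U. \<exists>F \<epsilon>. ?Q U x F \<epsilon>)"
  have "istopology ?P"
    unfolding istopology_def
  proof (intro conjI allI impI)
    fix S T assume S: "?P S" and T: "?P T"
    show "S \<inter> T \<subseteq> carrier E" using S by blast
    show "\<forall>x\<in>S \<inter> T. \<exists>F \<epsilon>. ?Q (S \<inter> T) x F \<epsilon>"
    proof
      fix x assume x: "x \<in> S \<inter> T"
      obtain F a where F: "?Q S x F a"
        using conjunct2[OF S, rule_format, OF IntD1[OF x]] by blast
      obtain G b where G: "?Q T x G b"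
        using conjunct2[OF T, rule_format, OF IntD2[OF x]] by blast
      note FG = F G
      from F G obtain c where c: "c \<in> L0_pos M" "L0_le M c a" "L0_le M c b"
        using L0_pos_min by blast
      have "?Q (S \<inter> T) x (F \<union> G) c"
      proof (intro conjI ballI impI)
        fix y assume y: "y \<in> carrier E" and leq: "\<forall>p\<in>F \<union> G. L0_le M (p y) c"
        have "\<forall>p\<in>F. L0_le M (p y) a" "\<forall>p\<in>G. L0_le M (p y) b"
          using leq c by (auto intro: L0_le_trans)
        then show "x \<oplus>\<^bsub>E\<^esub> y \<in> S \<inter> T" using FG y by simp
      qed (use FG c in auto)
      then show "\<exists>F \<epsilon>. ?Q (S \<inter> T) x F \<epsilon>" by blast
    qed
  next
    fix \<K> assume K: "\<forall>S\<in>\<K>. ?P S"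
    then show "\<Union>\<K> \<subseteq> carrier E" by blast
    show "\<forall>x\<in>\<Union>\<K>. \<exists>F \<epsilon>. ?Q (\<Union>\<K>) x F \<epsilon>"
    proof
      fix x assume "x \<in> \<Union>\<K>"
      then obtain S where S: "S \<in> \<K>" "x \<in> S" by blast
      obtain F \<epsilon> where F: "?Q S x F \<epsilon>"
        using conjunct2[OF K[rule_format, OF S(1)], rule_format, OF S(2)] by blast
      have "?Q (\<Union>\<K>) x F \<epsilon>"
        using F UnionI[OF S(1)] by simp
      then show "\<exists>F \<epsilon>. ?Q (\<Union>\<K>) x F \<epsilon>" by (intro exI)
    qed
  qed
  moreover have "L0_seminorm_topology M E P = topology ?P"
  proof -
    have eq: "(\<lambda>y. x \<oplus>\<^bsub>E\<^esub> y) ` {y \<in> carrier E. L0_le M (L0_max_seminorm M F y) \<epsilon>} \<subseteq> U \<longleftrightarrow>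
      (\<forall>y\<in>carrier E. (\<forall>p\<in>F. L0_le M (p y) \<epsilon>) \<longrightarrow> x \<oplus>\<^bsub>E\<^esub> y \<in> U)"
      if "finite F" "F \<subseteq> P" "\<epsilon> \<in> L0_pos M" for x F \<epsilon> U
    proof -
      have "L0_le M (L0_max_seminorm M F y) \<epsilon> \<longleftrightarrow> (\<forall>p\<in>F. L0_le M (p y) \<epsilon>)"
        if "y \<in> carrier E" for y
        using that \<open>finite F\<close> \<open>F \<subseteq> P\<close> \<open>\<epsilon> \<in> L0_pos M\<close> P
        by (intro L0_max_seminorm_le_iff) auto
      then show ?thesis by (auto simp: image_subset_iff)
    qed
    have "(finite F \<and> F \<subseteq> P \<and> \<epsilon> \<in> L0_pos M \<and>
        (\<lambda>y. x \<oplus>\<^bsub>E\<^esub> y) ` {y \<in> carrier E. L0_le M (L0_max_seminorm M F y) \<epsilon>} \<subseteq> U) \<longleftrightarrow>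
      ?Q U x F \<epsilon>" for x F \<epsilon> U
      by (intro conj_cong refl eq)
    then show ?thesis
      unfolding L0_seminorm_topology_def by (simp only:)
  qed
  ultimately show ?thesis
    by (simp add: topology_inverse')
qed


section \<open>Completeness does not depend on the index type\<close>

context
  fixes M :: "'w measure" and E :: "('w L0, 'e, 'm) module_scheme" and nrm :: "'e \<Rightarrow> 'w L0"
  assumes nm: "L0_normed_module M E nrm"
begin

interpretation Module.module "L0 M" E
  using nm by (simp add: L0_normed_module_def)

lemma nrm_closed: "x \<in> carrier E \<Longrightarrow> nrm x \<in> carrier (L0 M)"
  using nm by (auto simp: L0_normed_module_def L0_norm_def L0_seminorm_def L0_nonneg_def)

lemma nrm_smult: "\<eta> \<in> carrier (L0 M) \<Longrightarrow> x \<in> carrier E \<Longrightarrow>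
    nrm (\<eta> \<odot>\<^bsub>E\<^esub> x) = L0_abs M \<eta> \<otimes>\<^bsub>L0 M\<^esub> nrm x"
  using nm by (simp add: L0_normed_module_def L0_norm_def L0_seminorm_def)

lemma nrm_triangle: "x \<in> carrier E \<Longrightarrow> y \<in> carrier E \<Longrightarrow>
    L0_le M (nrm (x \<oplus>\<^bsub>E\<^esub> y)) (nrm x \<oplus>\<^bsub>L0 M\<^esub> nrm y)"
  using nm by (simp add: L0_normed_module_def L0_norm_def L0_seminorm_def)

lemma nrm_zero: "nrm \<zero>\<^bsub>E\<^esub> = \<zero>\<^bsub>L0 M\<^esub>"
proof -
  have "L0_abs M \<zero>\<^bsub>L0 M\<^esub> = \<zero>\<^bsub>L0 M\<^esub>"
    apply (rule L0_eqI[of _ M])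
      apply (intro L0_closed L0_abs_closed)+
    using L0_rv_abs[OF L0_zero_closed] L0_rv_zero by eventually_elim simp
  then show ?thesis
    using nrm_smult[OF L0_zero_closed M.zero_closed] nrm_closed by simp
qed

lemma nrm_minus: "x \<in> carrier E \<Longrightarrow> nrm (\<ominus>\<^bsub>E\<^esub> x) = nrm x"
proof -
  assume x: "x \<in> carrier E"
  have c: "\<ominus>\<^bsub>L0 M\<^esub> \<one>\<^bsub>L0 M\<^esub> \<in> carrier (L0 M)" by simp
  have "AE w in M. L0_rv (\<ominus>\<^bsub>L0 M\<^esub> \<one>\<^bsub>L0 M\<^esub> \<oplus>\<^bsub>L0 M\<^esub> \<one>\<^bsub>L0 M\<^esub>) w = 0"
    using L0_rv_zero[of M] by (simp add: L0.l_neg)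
  then have neg: "AE w in M. L0_rv (\<ominus>\<^bsub>L0 M\<^esub> \<one>\<^bsub>L0 M\<^esub>) w = -1"
    using L0_rv_add[OF c L0_one_closed] L0_rv_one by eventually_elim simp
  have "L0_abs M (\<ominus>\<^bsub>L0 M\<^esub> \<one>\<^bsub>L0 M\<^esub>) = \<one>\<^bsub>L0 M\<^esub>"
    apply (rule L0_eqI[of _ M, OF L0_abs_closed[OF c] L0_one_closed])
    using neg L0_rv_abs[OF c] L0_rv_one by eventually_elim simp
  moreover have "(\<ominus>\<^bsub>L0 M\<^esub> \<one>\<^bsub>L0 M\<^esub>) \<odot>\<^bsub>E\<^esub> x = \<ominus>\<^bsub>E\<^esub> x"
    using x by (simp add: smult_l_minus)
  ultimately show ?thesis
    using nrm_smult[OF c x] nrm_closed[OF x] by simp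
qed

lemma nrm_minus_sym: "x \<in> carrier E \<Longrightarrow> y \<in> carrier E \<Longrightarrow> nrm (x \<ominus>\<^bsub>E\<^esub> y) = nrm (y \<ominus>\<^bsub>E\<^esub> x)"
  using nrm_minus[of "y \<ominus>\<^bsub>E\<^esub> x"]
  by (simp add: M.minus_eq M.minus_add M.a_comm)

lemma nrm_dist_triangle:
  assumes "x \<in> carrier E" "y \<in> carrier E" "z \<in> carrier E"
    "L0_le M (nrm (x \<ominus>\<^bsub>E\<^esub> y)) a" "L0_le M (nrm (y \<ominus>\<^bsub>E\<^esub> z)) b"
    "a \<in> carrier (L0 M)" "b \<in> carrier (L0 M)"
  shows "L0_le M (nrm (x \<ominus>\<^bsub>E\<^esub> z)) (a \<oplus>\<^bsub>L0 M\<^esub> b)"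
proof -
  have "(x \<ominus>\<^bsub>E\<^esub> y) \<oplus>\<^bsub>E\<^esub> (y \<ominus>\<^bsub>E\<^esub> z) = x \<ominus>\<^bsub>E\<^esub> z"
    using assms(1-3) by (simp add: M.minus_eq M.a_assoc M.r_neg1)
  then have "L0_le M (nrm (x \<ominus>\<^bsub>E\<^esub> z)) (nrm (x \<ominus>\<^bsub>E\<^esub> y) \<oplus>\<^bsub>L0 M\<^esub> nrm (y \<ominus>\<^bsub>E\<^esub> z))"
    using nrm_triangle[of "x \<ominus>\<^bsub>E\<^esub> y" "y \<ominus>\<^bsub>E\<^esub> z"] assms(1-3) by simp
  then show ?thesis
    by (rule L0_le_trans) (intro L0_add_mono nrm_closed assms M.minus_closed)
qed

lemma openin_norm_topology:
  "openin (L0_seminorm_topology M E {nrm}) U \<longleftrightarrow> U \<subseteq> carrier E \<and>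
     (\<forall>x\<in>U. \<exists>\<epsilon>\<in>L0_pos M. \<forall>y\<in>carrier E. L0_le M (nrm y) \<epsilon> \<longrightarrow> x \<oplus>\<^bsub>E\<^esub> y \<in> U)"
proof -
  have "(\<exists>F \<epsilon>. finite F \<and> F \<subseteq> {nrm} \<and> \<epsilon> \<in> L0_pos M \<and>
        (\<forall>y\<in>carrier E. (\<forall>p\<in>F. L0_le M (p y) \<epsilon>) \<longrightarrow> x \<oplus>\<^bsub>E\<^esub> y \<in> U)) \<longleftrightarrow>
     (\<exists>\<epsilon>\<in>L0_pos M. \<forall>y\<in>carrier E. L0_le M (nrm y) \<epsilon> \<longrightarrow> x \<oplus>\<^bsub>E\<^esub> y \<in> U)" (is "?L \<longleftrightarrow> ?R") for x
  proof
    assume ?L then show ?R by (blast)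
  next
    assume ?R
    then obtain \<epsilon> where "\<epsilon> \<in> L0_pos M" "\<forall>y\<in>carrier E. L0_le M (nrm y) \<epsilon> \<longrightarrow> x \<oplus>\<^bsub>E\<^esub> y \<in> U"
      by blast
    then show ?L by (intro exI[of _ "{nrm}"] exI[of _ \<epsilon>]) simp
  qed
  then show ?thesis
    by (subst openin_L0_seminorm_topology) (auto simp: nrm_closed)
qed

lemma topspace_norm_topology: "topspace (L0_seminorm_topology M E {nrm}) = carrier E"
proof -
  have "openin (L0_seminorm_topology M E {nrm}) (carrier E)"
    unfolding openin_norm_topology using L0_one_pos[of M] by (auto intro!: bexI[of _ "\<one>\<^bsub>L0 M\<^esub>"])
  then show ?thesis
    by (meson openin_norm_topology openin_subset openin_topspace subset_antisym)
qed

lemma net_converges_norm_iff: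
  assumes x: "x \<in> D \<rightarrow> carrier E" and l: "l \<in> carrier E"
  shows "net_converges (L0_seminorm_topology M E {nrm}) D leq x l \<longleftrightarrow>
    (\<forall>\<epsilon>\<in>L0_pos M. \<exists>\<gamma>\<in>D. \<forall>\<alpha>\<in>D. leq \<gamma> \<alpha> \<longrightarrow> L0_le M (nrm (x \<alpha> \<ominus>\<^bsub>E\<^esub> l)) \<epsilon>)"
proof (intro iffI ballI)
  fix \<epsilon> assume conv: "net_converges (L0_seminorm_topology M E {nrm}) D leq x l"
    and \<epsilon>: "\<epsilon> \<in> L0_pos M"
  define U where "U = {y \<in> carrier E. \<exists>\<delta>\<in>L0_pos M. \<forall>v\<in>carrier E.
    L0_le M (nrm v) \<delta> \<longrightarrow> L0_le M (nrm ((y \<oplus>\<^bsub>E\<^esub> v) \<ominus>\<^bsub>E\<^esub> l)) \<epsilon>}"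
  have "openin (L0_seminorm_topology M E {nrm}) U"
    unfolding openin_norm_topology
  proof (intro conjI ballI)
    show "U \<subseteq> carrier E" by (auto simp: U_def)
    fix y assume "y \<in> U"
    then obtain \<delta> where y: "y \<in> carrier E" and \<delta>: "\<delta> \<in> L0_pos M" "\<And>v. v \<in> carrier E \<Longrightarrow>
      L0_le M (nrm v) \<delta> \<Longrightarrow> L0_le M (nrm ((y \<oplus>\<^bsub>E\<^esub> v) \<ominus>\<^bsub>E\<^esub> l)) \<epsilon>"
      by (auto simp: U_def)
    obtain \<theta> where \<theta>: "\<theta> \<in> L0_pos M" "\<theta> \<oplus>\<^bsub>L0 M\<^esub> \<theta> = \<delta>" using L0_pos_half[OF \<delta>(1)] by blast
    have "y \<oplus>\<^bsub>E\<^esub> u \<in> U" if u: "u \<in> carrier E" "L0_le M (nrm u) \<theta>" for u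
    proof -
      have "L0_le M (nrm ((y \<oplus>\<^bsub>E\<^esub> u \<oplus>\<^bsub>E\<^esub> v) \<ominus>\<^bsub>E\<^esub> l)) \<epsilon>" if v: "v \<in> carrier E" "L0_le M (nrm v) \<theta>" for v
      proof -
        have "L0_le M (nrm (u \<oplus>\<^bsub>E\<^esub> v)) \<delta>"
          using nrm_triangle[OF u(1) v(1)]
            L0_add_mono[OF nrm_closed nrm_closed L0_posD L0_posD u(2) v(2)] u(1) v(1) \<theta>
          by (metis L0_le_trans)
        from \<delta>(2)[OF _ this] show ?thesis
          using u v y by (simp add: M.a_assoc)
      qed
      then show ?thesis using y u \<theta> unfolding U_def by blast
    qed
    then show "\<exists>\<epsilon>\<in>L0_pos M. \<forall>v\<in>carrier E. L0_le M (nrm v) \<epsilon> \<longrightarrow> y \<oplus>\<^bsub>E\<^esub> v \<in> U"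
      using \<theta> by blast
  qed
  moreover have "l \<in> U"
  proof -
    have "(l \<oplus>\<^bsub>E\<^esub> v) \<ominus>\<^bsub>E\<^esub> l = v" if "v \<in> carrier E" for v
      using that l by (simp add: M.a_comm[of l] M.minus_eq M.a_assoc M.r_neg)
    then show ?thesis using l \<epsilon> by (auto simp: U_def)
  qed
  ultimately obtain \<gamma> where \<gamma>: "\<gamma> \<in> D" "\<And>\<alpha>. \<alpha> \<in> D \<Longrightarrow> leq \<gamma> \<alpha> \<Longrightarrow> x \<alpha> \<in> U"
    using conv by (auto simp: net_converges_def)
  have "L0_le M (nrm (y \<ominus>\<^bsub>E\<^esub> l)) \<epsilon>" if "y \<in> U" for y
  proof -
    from that obtain \<delta> where y: "y \<in> carrier E" and \<delta>: "\<delta> \<in> L0_pos M" "\<And>v. v \<in> carrier E \<Longrightarrow>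
      L0_le M (nrm v) \<delta> \<Longrightarrow> L0_le M (nrm ((y \<oplus>\<^bsub>E\<^esub> v) \<ominus>\<^bsub>E\<^esub> l)) \<epsilon>"
      by (auto simp: U_def)
    show ?thesis
      using \<delta>(2)[OF M.zero_closed] L0_le_pos[OF \<delta>(1)] y by (simp add: nrm_zero)
  qed
  then show "\<exists>\<gamma>\<in>D. \<forall>\<alpha>\<in>D. leq \<gamma> \<alpha> \<longrightarrow> L0_le M (nrm (x \<alpha> \<ominus>\<^bsub>E\<^esub> l)) \<epsilon>"
    using \<gamma> by blast
next
  assume conv: "\<forall>\<epsilon>\<in>L0_pos M. \<exists>\<gamma>\<in>D. \<forall>\<alpha>\<in>D. leq \<gamma> \<alpha> \<longrightarrow> L0_le M (nrm (x \<alpha> \<ominus>\<^bsub>E\<^esub> l)) \<epsilon>"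
  show "net_converges (L0_seminorm_topology M E {nrm}) D leq x l"
    unfolding net_converges_def topspace_norm_topology openin_norm_topology
  proof (intro conjI l allI impI)
    fix U assume "(U \<subseteq> carrier E \<and>
     (\<forall>x\<in>U. \<exists>\<epsilon>\<in>L0_pos M. \<forall>y\<in>carrier E. L0_le M (nrm y) \<epsilon> \<longrightarrow> x \<oplus>\<^bsub>E\<^esub> y \<in> U)) \<and> l \<in> U"
    then obtain \<epsilon> where \<epsilon>: "\<epsilon> \<in> L0_pos M"
      "\<And>y. y \<in> carrier E \<Longrightarrow> L0_le M (nrm y) \<epsilon> \<Longrightarrow> l \<oplus>\<^bsub>E\<^esub> y \<in> U" by blast
    obtain \<gamma> where \<gamma>: "\<gamma> \<in> D" "\<And>\<alpha>. \<alpha> \<in> D \<Longrightarrow> leq \<gamma> \<alpha> \<Longrightarrow> L0_le M (nrm (x \<alpha> \<ominus>\<^bsub>E\<^esub> l)) \<epsilon>"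
      using conv \<epsilon>(1) by blast
    have "x \<alpha> \<in> U" if "\<alpha> \<in> D" "leq \<gamma> \<alpha>" for \<alpha>
    proof -
      have c: "x \<alpha> \<in> carrier E" using x that by blast
      have "l \<oplus>\<^bsub>E\<^esub> (x \<alpha> \<ominus>\<^bsub>E\<^esub> l) = x \<alpha>"
        using c l by (simp add: M.minus_eq M.a_comm[of l] M.a_assoc M.l_neg)
      then show ?thesis
        using \<epsilon>(2)[of "x \<alpha> \<ominus>\<^bsub>E\<^esub> l"] \<gamma>(2)[OF that] c l by simp
    qed
    then show "\<exists>\<gamma>\<in>D. \<forall>\<alpha>\<in>D. leq \<gamma> \<alpha> \<longrightarrow> x \<alpha> \<in> U" using \<gamma>(1) by blast
  qed
qed

lemma L0_complete_any_index:
  fixes D :: "'i set"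
  assumes compl: "L0_complete M E nrm"
    and D: "directed_set D leq" and Cau: "L0_Cauchy_net M E nrm D leq x"
  shows "\<exists>l\<in>carrier E. net_converges (L0_seminorm_topology M E {nrm}) D leq x l"
proof -
  have x: "x \<in> D \<rightarrow> carrier E" by (rule conjunct1[OF Cau[unfolded L0_Cauchy_net_def]])
  have "\<forall>\<epsilon>\<in>L0_pos M. \<exists>\<gamma>. \<gamma> \<in> D \<and> (\<forall>\<alpha>\<in>D. \<forall>\<beta>\<in>D. leq \<gamma> \<alpha> \<longrightarrow> leq \<gamma> \<beta> \<longrightarrow>
        L0_le M (nrm (x \<alpha> \<ominus>\<^bsub>E\<^esub> x \<beta>)) \<epsilon>)"
    by (rule conjunct2[OF Cau[unfolded L0_Cauchy_net_def Bex_def]])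
  from bchoice[OF this] obtain g where gg: "\<forall>\<epsilon>\<in>L0_pos M. g \<epsilon> \<in> D \<and>
      (\<forall>\<alpha>\<in>D. \<forall>\<beta>\<in>D. leq (g \<epsilon>) \<alpha> \<longrightarrow> leq (g \<epsilon>) \<beta> \<longrightarrow>
        L0_le M (nrm (x \<alpha> \<ominus>\<^bsub>E\<^esub> x \<beta>)) \<epsilon>)" ..
  then have g: "\<And>\<epsilon>. \<epsilon> \<in> L0_pos M \<Longrightarrow> g \<epsilon> \<in> D"
    and g_le: "\<And>\<epsilon> \<alpha> \<beta>. \<epsilon> \<in> L0_pos M \<Longrightarrow> \<alpha> \<in> D \<Longrightarrow> \<beta> \<in> D \<Longrightarrow> leq (g \<epsilon>) \<alpha> \<Longrightarrow> leq (g \<epsilon>) \<beta> \<Longrightarrow>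
        L0_le M (nrm (x \<alpha> \<ominus>\<^bsub>E\<^esub> x \<beta>)) \<epsilon>"
    by simp_all
  have D_refl: "\<And>a. a \<in> D \<Longrightarrow> leq a a" and D_dir: "\<And>a b. a \<in> D \<Longrightarrow> b \<in> D \<Longrightarrow> \<exists>c\<in>D. leq a c \<and> leq b c"
    using D unfolding directed_set_def by blast+
  define leq' where "leq' = (\<lambda>\<alpha> \<beta>. L0_le M \<beta> \<alpha>)"
  have y: "x \<circ> g \<in> L0_pos M \<rightarrow> carrier E" using x g by auto
  have "directed_set (L0_pos M) leq'"
    unfolding directed_set_def leq'_def
    using L0_one_pos[of M] L0_pos_min[of _ M] L0_le_trans[of M] L0_le_refl[of M] by (intro conjI) (fast | simp)+
  moreover have "L0_Cauchy_net M E nrm (L0_pos M) leq' (x \<circ> g)"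
    unfolding L0_Cauchy_net_def
  proof (intro conjI y ballI)
    fix \<epsilon> assume "\<epsilon> \<in> L0_pos M"
    then obtain \<theta> where \<theta>: "\<theta> \<in> L0_pos M" "\<theta> \<oplus>\<^bsub>L0 M\<^esub> \<theta> = \<epsilon>" using L0_pos_half by blast
    have "L0_le M (nrm ((x \<circ> g) \<alpha> \<ominus>\<^bsub>E\<^esub> (x \<circ> g) \<beta>)) \<epsilon>"
      if ab: "\<alpha> \<in> L0_pos M" "\<beta> \<in> L0_pos M" "leq' \<theta> \<alpha>" "leq' \<theta> \<beta>" for \<alpha> \<beta>
    proof -
      obtain c where c: "c \<in> D" "leq (g \<alpha>) c" "leq (g \<beta>) c" using D_dir g ab by blast
      have "L0_le M (nrm (x (g \<alpha>) \<ominus>\<^bsub>E\<^esub> x c)) \<theta>" "L0_le M (nrm (x c \<ominus>\<^bsub>E\<^esub> x (g \<beta>))) \<theta>"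
        using g_le[OF ab(1) g[OF ab(1)] c(1) D_refl[OF g[OF ab(1)]] c(2)]
          g_le[OF ab(2) c(1) g[OF ab(2)] c(3) D_refl[OF g[OF ab(2)]]] ab(3,4)
        unfolding leq'_def by (blast intro: L0_le_trans)+
      then show ?thesis
        using nrm_dist_triangle[of "x (g \<alpha>)" "x c" "x (g \<beta>)" \<theta> \<theta>] x g ab c(1) \<theta> L0_posD[OF \<theta>(1)]
        by (auto simp: Pi_iff)
    qed
    then show "\<exists>\<gamma>\<in>L0_pos M. \<forall>\<alpha>\<in>L0_pos M. \<forall>\<beta>\<in>L0_pos M. leq' \<gamma> \<alpha> \<longrightarrow> leq' \<gamma> \<beta> \<longrightarrow>
        L0_le M (nrm ((x \<circ> g) \<alpha> \<ominus>\<^bsub>E\<^esub> (x \<circ> g) \<beta>)) \<epsilon>"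
      using \<theta>(1) by blast
  qed
  ultimately obtain l where l: "l \<in> carrier E"
    and "net_converges (L0_seminorm_topology M E {nrm}) (L0_pos M) leq' (x \<circ> g) l"
    using compl unfolding L0_complete_def by blast
  then have conv: "\<forall>\<epsilon>\<in>L0_pos M. \<exists>\<gamma>\<in>L0_pos M. \<forall>\<alpha>\<in>L0_pos M. leq' \<gamma> \<alpha> \<longrightarrow>
      L0_le M (nrm ((x \<circ> g) \<alpha> \<ominus>\<^bsub>E\<^esub> l)) \<epsilon>"
    using net_converges_norm_iff[OF y l] by blast
  have "\<exists>\<gamma>\<in>D. \<forall>\<alpha>\<in>D. leq \<gamma> \<alpha> \<longrightarrow> L0_le M (nrm (x \<alpha> \<ominus>\<^bsub>E\<^esub> l)) \<epsilon>" if \<epsilon>: "\<epsilon> \<in> L0_pos M" for \<epsilon>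
  proof -
    obtain \<theta> where \<theta>: "\<theta> \<in> L0_pos M" "\<theta> \<oplus>\<^bsub>L0 M\<^esub> \<theta> = \<epsilon>" using L0_pos_half[OF \<epsilon>] by blast
    obtain \<gamma> where \<gamma>: "\<gamma> \<in> L0_pos M"
      "\<And>\<alpha>. \<alpha> \<in> L0_pos M \<Longrightarrow> L0_le M \<alpha> \<gamma> \<Longrightarrow> L0_le M (nrm (x (g \<alpha>) \<ominus>\<^bsub>E\<^esub> l)) \<theta>"
      using conv \<theta>(1) unfolding leq'_def by auto
    obtain \<delta> where \<delta>: "\<delta> \<in> L0_pos M" "L0_le M \<delta> \<gamma>" "L0_le M \<delta> \<theta>"
      using L0_pos_min[OF \<gamma>(1) \<theta>(1)] by blast
    have "L0_le M (nrm (x \<alpha> \<ominus>\<^bsub>E\<^esub> l)) \<epsilon>" if \<alpha>: "\<alpha> \<in> D" "leq (g \<delta>) \<alpha>" for \<alpha>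
    proof -
      have "L0_le M (nrm (x \<alpha> \<ominus>\<^bsub>E\<^esub> x (g \<delta>))) \<theta>"
        using g_le[OF \<delta>(1) \<alpha>(1) g[OF \<delta>(1)] \<alpha>(2) D_refl[OF g[OF \<delta>(1)]]] \<delta>(3)
        by (rule L0_le_trans)
      then show ?thesis
        using nrm_dist_triangle[of "x \<alpha>" "x (g \<delta>)" l \<theta> \<theta>] x g \<alpha>(1) \<theta> \<delta> \<gamma>(2) L0_posD[OF \<theta>(1)] l
        by (auto simp: Pi_iff)
    qed
    then show ?thesis using g[OF \<delta>(1)] by blast
  qed
  then show ?thesis
    using l net_converges_norm_iff[OF x l] by blast
qed

end

end

theory Submission
  imports Defs
begin

text \<open>If \<open>K\<close> is weak-star closed, so are its intersections with dual balls, because a dual ball is an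
  intersection of the closed sets of functionals \<open>z\<close> with \<open>\<bar>z x\<bar> \<le> \<epsilon> \<parallel>x\<parallel>\<close> (\<open>closedin_dual_ball\<close>).

  For the converse let \<open>z0\<close> lie outside \<open>K\<close>; after a translation \<open>z0 = 0\<close>.  It suffices to find a
  point \<open>x\<close>, an event \<open>A\<close> of positive probability and a random variable \<open>a\<close>, positive on \<open>A\<close>, with
  \<open>k x \<ge> a\<close> on \<open>A\<close> for all \<open>k \<in> K\<close>: then \<open>K\<close> misses the neighbourhood of zero on which
  \<open>\<bar>z x\<bar> \<le> a / 2\<close> holds on \<open>A\<close>.  The classical argument of Krein and Smulian constructs \<open>x\<close> with the help of the
  weak-star compactness of dual balls, which need not hold over \<open>L0\<close>.  The proof here uses the
  Hahn-Banach theorem \<open>Hahn_Banach_L0\<close> in its place.  If two closed convex sets of functionals with support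
  functions \<open>f\<close> and \<open>g\<close> have no common member, then the inf-convolution of \<open>f\<close> and \<open>g\<close> cannot
  be bounded below, since it would dominate a linear functional, which would lie in both
  sets; so \<open>f u + g (- u) < 0\<close> for some \<open>u\<close>, and \<open>u\<close> separates the two sets.  Over \<open>L0\<close> all this
  happens event by event, and \<open>stable_exhaustion\<close> glues the parts; the result is \<open>separation_alternative\<close>.

  The point \<open>x\<close> is the limit of an iteration.  Let \<open>K n\<close> be the part of \<open>K\<close> in the dual ball of radius
  \<open>R n = m + 1 + n\<close>, where \<open>m\<close> bounds some member of \<open>K\<close>.  Suppose \<open>x n\<close> lies in the unit
  ball and \<open>k (x n) \<ge> a n\<close> for all \<open>k \<in> K n\<close>.  No member of \<open>K (n+1)\<close> is bounded by \<open>R n\<close> and has a value at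
  \<open>x n\<close> below \<open>a n\<close>, so the members of \<open>K (n+1)\<close> are separated from the functionals of that kind
  by a point, which after normalisation has the form \<open>x (n+1) = (1 - t) (x n) + t y\<close> with
  \<open>\<parallel>y\<parallel> \<le> 1\<close>.  The margin grows from \<open>a n\<close> to about \<open>(1 - t) (a n) + t (R n)\<close>,
  hence at least by about \<open>t\<close>, while the point moves by at most \<open>2 t\<close> (\<open>margin_step\<close>).  All margins are at most
  \<open>m\<close>, so the steps are summable and the points converge almost surely (\<open>separation_from_zero\<close>).
  Stability and completeness of \<open>E\<close> turn this into an element of \<open>E\<close>
  (\<open>almost_sure_limit_exists\<close>).

  The functional that the Hahn-Banach theorem provides lies below the support function of \<open>K n\<close>; it
  belongs to \<open>K\<close> because a weak-star closed, convex and stable set is determined by its support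
  function (\<open>closed_convex_bipolar\<close>).\<close>

section \<open>Order and lattice structure of the ring of random variables\<close>

lemma L0_rv_uminus:
  assumes "\<eta> \<in> carrier (L0 M)"
  shows "AE w in M. L0_rv (\<ominus>\<^bsub>L0 M\<^esub> \<eta>) w = - L0_rv \<eta> w"
proof -
  have "AE w in M. L0_rv (\<eta> \<oplus>\<^bsub>L0 M\<^esub> \<ominus>\<^bsub>L0 M\<^esub> \<eta>) w = 0"
    using L0_rv_zero[of M] assms by (simp add: L0.r_neg)
  moreover have "AE w in M. L0_rv (\<eta> \<oplus>\<^bsub>L0 M\<^esub> \<ominus>\<^bsub>L0 M\<^esub> \<eta>) w = L0_rv \<eta> w + L0_rv (\<ominus>\<^bsub>L0 M\<^esub> \<eta>) w"
    using assms by (intro L0_rv_add) simp_all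
  ultimately show ?thesis by eventually_elim simp
qed

lemma L0_rv_diff:
  assumes "\<eta> \<in> carrier (L0 M)" "\<xi> \<in> carrier (L0 M)"
  shows "AE w in M. L0_rv (\<eta> \<ominus>\<^bsub>L0 M\<^esub> \<xi>) w = L0_rv \<eta> w - L0_rv \<xi> w"
  using L0_rv_add[OF assms(1) L0.a_inv_closed[OF assms(2)]] L0_rv_uminus[OF assms(2)]
  unfolding a_minus_def by eventually_elim simp

lemma L0_class_pos:
  assumes "f \<in> borel_measurable M" "AE w in M. 0 < f w"
  shows "L0_class M f \<in> L0_pos M"
  unfolding L0_pos_iff using L0_rv_class[OF assms(1)] assms by auto

lemma L0_class_add:
  assumes [measurable]: "f \<in> borel_measurable M" "g \<in> borel_measurable M"
  shows "L0_class M f \<oplus>\<^bsub>L0 M\<^esub> L0_class M g = L0_class M (\<lambda>w. f w + g w)"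
  apply (rule L0_eqI[of _ M])
    apply (simp_all add: L0_add_closed)
  using L0_rv_add[of "L0_class M f" M "L0_class M g"] L0_rv_class[of f M] L0_rv_class[of g M]
    L0_rv_class[of "\<lambda>w. f w + g w" M] by auto

lemma L0_class_mult:
  assumes [measurable]: "f \<in> borel_measurable M" "g \<in> borel_measurable M"
  shows "L0_class M f \<otimes>\<^bsub>L0 M\<^esub> L0_class M g = L0_class M (\<lambda>w. f w * g w)"
  apply (rule L0_eqI[of _ M])
    apply (simp_all add: L0_mult_closed)
  using L0_rv_mult[of "L0_class M f" M "L0_class M g"] L0_rv_class[of f M] L0_rv_class[of g M]
    L0_rv_class[of "\<lambda>w. f w * g w" M] by auto

lemma L0_class_one: "L0_class M (\<lambda>_. 1) = \<one>\<^bsub>L0 M\<^esub>"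
  by (simp add: L0_def)

lemma L0_class_zero: "L0_class M (\<lambda>_. 0) = \<zero>\<^bsub>L0 M\<^esub>"
  by (simp add: L0_def)

lemma L0_pos_inverse:
  assumes "\<eta> \<in> L0_pos M"
  obtains \<theta> where "\<theta> \<in> L0_pos M" "\<theta> \<otimes>\<^bsub>L0 M\<^esub> \<eta> = \<one>\<^bsub>L0 M\<^esub>"
proof
  note [measurable] = assms[THEN L0_posD, THEN L0_rv_measurable]
  have pos: "AE w in M. 0 < L0_rv \<eta> w" using assms by (simp add: L0_pos_iff)
  show "L0_class M (\<lambda>w. inverse (L0_rv \<eta> w)) \<in> L0_pos M"
    using pos by (intro L0_class_pos) auto
  have "L0_class M (\<lambda>w. inverse (L0_rv \<eta> w)) \<otimes>\<^bsub>L0 M\<^esub> L0_class M (L0_rv \<eta>) = \<one>\<^bsub>L0 M\<^esub>"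
    unfolding L0_class_one[symmetric]
    by (subst L0_class_mult) (use pos in \<open>auto intro!: L0_class_eqI\<close>)
  then show "L0_class M (\<lambda>w. inverse (L0_rv \<eta> w)) \<otimes>\<^bsub>L0 M\<^esub> \<eta> = \<one>\<^bsub>L0 M\<^esub>"
    using assms by (simp add: L0_class_rv L0_posD)
qed

lemma L0_mult_left_mono:
  assumes "a \<in> carrier (L0 M)" "b \<in> carrier (L0 M)" "\<eta> \<in> L0_pos M" "L0_le M a b"
  shows "L0_le M (\<eta> \<otimes>\<^bsub>L0 M\<^esub> a) (\<eta> \<otimes>\<^bsub>L0 M\<^esub> b)"
  using L0_rv_mult[OF L0_posD[OF assms(3)] assms(1)] L0_rv_mult[OF L0_posD[OF assms(3)] assms(2)]
    conjunct2[OF assms(3)[unfolded L0_pos_iff]] assms(4)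
  unfolding L0_le_def by eventually_elim (simp add: mult_left_mono)

text \<open>Dedekind completeness holds because the integral of the arctangent is bounded on all random
  variables and strictly increasing up to null sets.  Among the random variables that lie below every upper
  bound of \<open>S\<close>, which are closed under countable suprema, one maximises it, and a maximiser cannot be
  enlarged by any member of \<open>S\<close>.\<close>

lemma L0_lub_exists:
  assumes "prob_space M" and S: "S \<subseteq> carrier (L0 M)" and s0: "s0 \<in> S"
    and b: "b \<in> carrier (L0 M)" "\<And>s. s \<in> S \<Longrightarrow> L0_le M s b"
  shows "\<exists>\<eta>. L0_is_lub M S \<eta>"
proof -
  interpret prob_space M by fact
  define U where "U = {\<zeta> \<in> carrier (L0 M). \<forall>s\<in>S. L0_le M s \<zeta>}"
  define G where "G = {g \<in> borel_measurable M. \<forall>\<zeta>\<in>U. AE w in M. g w \<le> L0_rv \<zeta> w}"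
  define \<phi> where "\<phi> g = (\<integral>w. arctan (g w) \<partial>M)" for g
  have Gm[measurable_dest]: "g \<in> borel_measurable M" if "g \<in> G" for g
    using that by (simp add: G_def)
  have bU: "b \<in> U" using b by (simp add: U_def)
  have SG: "L0_rv s \<in> G" if "s \<in> S" for s
    using that S by (auto simp: G_def U_def L0_le_def)
  have int: "integrable M (\<lambda>w. arctan (g w))" if [measurable]: "g \<in> borel_measurable M" for g
  proof (rule integrable_const_bound[of _ "pi/2"])
    show "AE w in M. norm (arctan (g w)) \<le> pi/2"
      using arctan_bounded by (auto intro!: AE_I2 simp only: real_norm_def abs_le_iff) (smt (verit))+
  qed simp
  have \<phi>_mono: "\<phi> g \<le> \<phi> h" if [measurable]: "g \<in> borel_measurable M" "h \<in> borel_measurable M"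
    and "AE w in M. g w \<le> h w" for g h
    unfolding \<phi>_def using that(3) by (intro integral_mono_AE int that(1,2)) (auto simp: arctan_le_iff)
  have "\<phi> g \<le> (\<integral>w. pi/2 \<partial>M)" if "g \<in> G" for g
    unfolding \<phi>_def using that
    by (intro integral_mono int Gm) (use arctan_bounded in \<open>auto simp: less_imp_le\<close>)
  then have bdd: "bdd_above (\<phi> ` G)" by (intro bdd_aboveI) blast
  have "\<exists>g\<in>G. Sup (\<phi> ` G) - 1 / real (Suc n) < \<phi> g" for n
    using less_cSup_iff[OF _ bdd, of "Sup (\<phi> ` G) - 1 / real (Suc n)"] SG[OF s0] by force
  then obtain g where g: "\<And>n. g n \<in> G" "\<And>n. Sup (\<phi> ` G) - 1 / real (Suc n) < \<phi> (g n)" by metis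
  note [measurable] = L0_rv_measurable[OF b(1)] Gm[OF g(1)]
  define h where "h w = (SUP n. min (g n w) (L0_rv b w))" for w
  have bdd_w: "bdd_above (range (\<lambda>n. min (g n w) (L0_rv b w)))" for w
    by (auto intro!: bdd_aboveI[of _ "L0_rv b w"])
  have hm[measurable]: "h \<in> borel_measurable M"
    unfolding h_def by (rule borel_measurable_cSUP) (use bdd_w in auto)
  have "AE w in M. h w \<le> L0_rv \<zeta> w" if "\<zeta> \<in> U" for \<zeta>
  proof -
    have "AE w in M. \<forall>n. g n w \<le> L0_rv \<zeta> w"
      using g(1) that by (auto simp: AE_all_countable G_def)
    then show ?thesis by eventually_elim (auto simp: h_def min.coboundedI1 intro!: cSUP_least)
  qed
  then have hG: "h \<in> G" by (simp add: G_def)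
  have "AE w in M. g n w \<le> h w" for n
  proof -
    have "AE w in M. g n w \<le> L0_rv b w" using g(1) bU by (auto simp: G_def)
    then show ?thesis
    proof eventually_elim
      case (elim w)
      then show ?case unfolding h_def using cSUP_upper[OF UNIV_I bdd_w, of n w] by simp
    qed
  qed
  then have "\<phi> (g n) \<le> \<phi> h" for n by (intro \<phi>_mono) auto
  then have "Sup (\<phi> ` G) \<le> \<phi> h + 1 / real (Suc n)" for n
    using g(2)[of n] by (smt (verit))
  then have sup: "Sup (\<phi> ` G) \<le> \<phi> h"
    using LIMSEQ_le_const[OF tendsto_add[OF tendsto_const LIMSEQ_inverse_real_of_nat, of "\<phi> h"], of "Sup (\<phi> ` G)"]
    by (simp add: inverse_eq_divide)
  have upper: "AE w in M. L0_rv s w \<le> h w" if s: "s \<in> S" for s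
  proof -
    define k where "k w = max (h w) (L0_rv s w)" for w
    have [measurable]: "k \<in> borel_measurable M" unfolding k_def using S s by (auto intro!: borel_measurable_max)
    have "k \<in> G" using hG SG[OF s] unfolding G_def k_def by auto
    then have "\<phi> k \<le> \<phi> h" using cSup_upper[OF _ bdd] sup by force
    moreover have "(\<integral>w. arctan (k w) - arctan (h w) \<partial>M) = \<phi> k - \<phi> h"
      unfolding \<phi>_def by (intro Bochner_Integration.integral_diff int) auto
    moreover have nn: "AE w in M. 0 \<le> arctan (k w) - arctan (h w)"
      by (auto simp: k_def arctan_le_iff)
    ultimately have "(\<integral>w. arctan (k w) - arctan (h w) \<partial>M) = 0"
      using integral_nonneg_AE[OF nn] by linarith
    then have "AE w in M. arctan (k w) - arctan (h w) = 0"
      using integral_nonneg_eq_0_iff_AE[OF _ nn] int by simp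
    then show ?thesis by eventually_elim (auto simp: k_def max_def arctan_eq_iff split: if_splits)
  qed
  have "L0_is_lub M S (L0_class M h)"
    unfolding L0_is_lub_def
  proof (intro conjI ballI impI)
    fix s assume "s \<in> S"
    from upper[OF this] L0_rv_class[OF hm] show "L0_le M s (L0_class M h)"
      unfolding L0_le_def by eventually_elim simp
  next
    fix \<zeta> assume "\<zeta> \<in> carrier (L0 M)" "\<forall>s\<in>S. L0_le M s \<zeta>"
    then have "AE w in M. h w \<le> L0_rv \<zeta> w" using hG by (auto simp: G_def U_def)
    with L0_rv_class[OF hm] show "L0_le M (L0_class M h) \<zeta>"
      unfolding L0_le_def by eventually_elim simp
  qed simp
  then show ?thesis ..
qed

definition L0_is_glb :: "'w measure \<Rightarrow> 'w L0 set \<Rightarrow> 'w L0 \<Rightarrow> bool" where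
  "L0_is_glb M S \<eta> \<longleftrightarrow> \<eta> \<in> carrier (L0 M) \<and> (\<forall>\<xi>\<in>S. L0_le M \<eta> \<xi>) \<and>
     (\<forall>\<zeta>\<in>carrier (L0 M). (\<forall>\<xi>\<in>S. L0_le M \<zeta> \<xi>) \<longrightarrow> L0_le M \<zeta> \<eta>)"

lemma L0_glb_exists:
  assumes "prob_space M" and S: "S \<subseteq> carrier (L0 M)" "S \<noteq> {}"
    and b: "b \<in> carrier (L0 M)" "\<And>s. s \<in> S \<Longrightarrow> L0_le M b s"
  shows "\<exists>\<eta>. L0_is_glb M S \<eta>"
proof -
  let ?L = "{\<zeta> \<in> carrier (L0 M). \<forall>\<xi>\<in>S. L0_le M \<zeta> \<xi>}"
  obtain s where "s \<in> S" using S by blast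
  with S b have "\<exists>\<eta>. L0_is_lub M ?L \<eta>"
    by (intro L0_lub_exists[OF assms(1), of _ b s]) auto
  then show ?thesis using S(1) by (auto simp: L0_is_lub_def L0_is_glb_def subset_iff)
qed

section \<open>Sublinear functions and the Hahn-Banach theorem\<close>

text \<open>Homogeneity is required for strictly positive scalars only.  These are invertible, so
  that it passes to infima without any argument on the event where a scalar vanishes.\<close>

definition L0_sublinear ::
  "'w measure \<Rightarrow> ('w L0, 'e, 'm) module_scheme \<Rightarrow> ('e \<Rightarrow> 'w L0) \<Rightarrow> bool" where
  "L0_sublinear M E p \<longleftrightarrow> p \<in> carrier E \<rightarrow> carrier (L0 M) \<and>
     (\<forall>x\<in>carrier E. \<forall>y\<in>carrier E. L0_le M (p (x \<oplus>\<^bsub>E\<^esub> y)) (p x \<oplus>\<^bsub>L0 M\<^esub> p y)) \<and>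
     (\<forall>\<eta>\<in>L0_pos M. \<forall>x\<in>carrier E. p (\<eta> \<odot>\<^bsub>E\<^esub> x) = \<eta> \<otimes>\<^bsub>L0 M\<^esub> p x)"

locale L0_module = prob_space M + Module.module "L0 M" E
  for M :: "'w measure" and E :: "('w L0, 'e, 'm) module_scheme" (structure)
begin

lemma sublinear_closed: "L0_sublinear M E p \<Longrightarrow> x \<in> carrier E \<Longrightarrow> p x \<in> carrier (L0 M)"
  by (auto simp: L0_sublinear_def)

lemma sublinear_add: 
  assumes "L0_sublinear M E p" "x \<in> carrier E" "y \<in> carrier E"
  shows "AE w in M. L0_rv (p (x \<oplus> y)) w \<le> L0_rv (p x) w + L0_rv (p y) w"
proof -
  have "L0_le M (p (x \<oplus> y)) (p x \<oplus>\<^bsub>L0 M\<^esub> p y)" using assms by (simp add: L0_sublinear_def)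
  with L0_rv_add[OF sublinear_closed[OF assms(1,2)] sublinear_closed[OF assms(1,3)]] show ?thesis
    unfolding L0_le_def by eventually_elim simp
qed

lemma sublinear_scale:
  assumes "L0_sublinear M E p" "x \<in> carrier E" "f \<in> borel_measurable M" "AE w in M. 0 < f w"
  shows "AE w in M. L0_rv (p (L0_class M f \<odot> x)) w = f w * L0_rv (p x) w"
proof -
  have "p (L0_class M f \<odot> x) = L0_class M f \<otimes>\<^bsub>L0 M\<^esub> p x"
    using assms L0_class_pos[OF assms(3,4)] by (simp add: L0_sublinear_def)
  then show ?thesis
    using L0_rv_mult[OF L0_class_carrier[OF assms(3)] sublinear_closed[OF assms(1,2)]]
      L0_rv_class[OF assms(3)] by auto
qed

lemma smult_class_add:
  assumes "f \<in> borel_measurable M" "g \<in> borel_measurable M" "x \<in> carrier E"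
  shows "L0_class M (\<lambda>w. f w + g w) \<odot> x = L0_class M f \<odot> x \<oplus> L0_class M g \<odot> x"
  using assms by (simp add: L0_class_add[symmetric] smult_l_distr)

lemma sublinear_zero:
  assumes "L0_sublinear M E p"
  shows "AE w in M. L0_rv (p \<zero>) w = 0"
  using sublinear_scale[OF assms M.zero_closed, of "\<lambda>_. 2"] by simp

lemma sublinear_neg:
  assumes "L0_sublinear M E p" "x \<in> carrier E"
  shows "AE w in M. - L0_rv (p (\<ominus> x)) w \<le> L0_rv (p x) w"
  using sublinear_zero[OF assms(1)] sublinear_add[OF assms(1) assms(2) M.a_inv_closed[OF assms(2)]]
    assms(2) by (auto simp: M.r_neg)

text \<open>This is the one source of new sublinear functions: infima along a chain, inf-convolutions, and
  the directional modifications in the proof of the Hahn-Banach theorem are all infima of sets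
  \<open>S x\<close> that are subadditive and positively homogeneous in \<open>x\<close>.\<close>

lemma sublinear_inf:
  assumes S: "\<And>x. x \<in> carrier E \<Longrightarrow> S x \<subseteq> carrier (L0 M) \<and> S x \<noteq> {}"
    and bound: "\<And>x. x \<in> carrier E \<Longrightarrow> \<exists>b\<in>carrier (L0 M). \<forall>\<xi>\<in>S x. L0_le M b \<xi>"
    and add: "\<And>x y \<xi> \<zeta>. x \<in> carrier E \<Longrightarrow> y \<in> carrier E \<Longrightarrow> \<xi> \<in> S x \<Longrightarrow> \<zeta> \<in> S y \<Longrightarrow>
        \<exists>\<theta>\<in>S (x \<oplus> y). L0_le M \<theta> (\<xi> \<oplus>\<^bsub>L0 M\<^esub> \<zeta>)"
    and hom: "\<And>x \<xi> \<eta>. x \<in> carrier E \<Longrightarrow> \<eta> \<in> L0_pos M \<Longrightarrow> \<xi> \<in> S x \<Longrightarrow>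
        \<exists>\<theta>\<in>S (\<eta> \<odot> x). L0_le M \<theta> (\<eta> \<otimes>\<^bsub>L0 M\<^esub> \<xi>)"
  obtains p where "L0_sublinear M E p" "p \<in> extensional (carrier E)"
    "\<And>x. x \<in> carrier E \<Longrightarrow> L0_is_glb M (S x) (p x)"
proof -
  have "\<exists>\<eta>. L0_is_glb M (S x) \<eta>" if x: "x \<in> carrier E" for x
    using S[OF x] bound[OF x] by (metis L0_glb_exists prob_space_axioms)
  then obtain q where q: "\<And>x. x \<in> carrier E \<Longrightarrow> L0_is_glb M (S x) (q x)" by metis
  define p where "p = restrict q (carrier E)"
  have p: "L0_is_glb M (S x) (p x)" if "x \<in> carrier E" for x
    using q[OF that] that by (simp add: p_def)
  have pc: "p x \<in> carrier (L0 M)" if "x \<in> carrier E" for x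
    using p[OF that] by (simp add: L0_is_glb_def)
  have lower: "L0_le M (p x) \<xi>" if "x \<in> carrier E" "\<xi> \<in> S x" for x \<xi>
    using p that by (auto simp: L0_is_glb_def)
  have greatest: "L0_le M \<zeta> (p x)"
    if "x \<in> carrier E" "\<zeta> \<in> carrier (L0 M)" "\<And>\<xi>. \<xi> \<in> S x \<Longrightarrow> L0_le M \<zeta> \<xi>" for x \<zeta>
    using p that by (auto simp: L0_is_glb_def)
  have Sc: "\<xi> \<in> carrier (L0 M)" if "x \<in> carrier E" "\<xi> \<in> S x" for x \<xi>
    using S that by blast
  have le_add: "L0_le M (p (x \<oplus> y)) (p x \<oplus>\<^bsub>L0 M\<^esub> p y)"
    if x: "x \<in> carrier E" and y: "y \<in> carrier E" for x y
  proof -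
    let ?s = "p (x \<oplus> y)"
    have sc: "?s \<in> carrier (L0 M)" using pc x y by simp
    have 1: "AE w in M. L0_rv ?s w \<le> L0_rv \<xi> w + L0_rv \<zeta> w" if "\<xi> \<in> S x" "\<zeta> \<in> S y" for \<xi> \<zeta>
    proof -
      obtain \<theta> where "\<theta> \<in> S (x \<oplus> y)" "L0_le M \<theta> (\<xi> \<oplus>\<^bsub>L0 M\<^esub> \<zeta>)" using add[OF x y \<open>\<xi> \<in> S x\<close> \<open>\<zeta> \<in> S y\<close>] by blast
      with lower[of "x \<oplus> y" \<theta>] L0_rv_add[OF Sc[OF x \<open>\<xi> \<in> S x\<close>] Sc[OF y \<open>\<zeta> \<in> S y\<close>]] x y
      show ?thesis by (auto simp: L0_le_def)
    qed
    have 2: "AE w in M. L0_rv ?s w - L0_rv (p y) w \<le> L0_rv \<xi> w" if \<xi>: "\<xi> \<in> S x" for \<xi>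
    proof -
      have "L0_le M (?s \<ominus>\<^bsub>L0 M\<^esub> \<xi>) (p y)"
      proof (rule greatest[OF y])
        show "L0_le M (?s \<ominus>\<^bsub>L0 M\<^esub> \<xi>) \<zeta>" if "\<zeta> \<in> S y" for \<zeta>
          using L0_rv_diff[OF sc Sc[OF x \<xi>]] 1[OF \<xi> that] unfolding L0_le_def by eventually_elim simp
      qed (use sc Sc[OF x \<xi>] in simp)
      with L0_rv_diff[OF sc Sc[OF x \<xi>]] show ?thesis
        unfolding L0_le_def by eventually_elim simp
    qed
    have "L0_le M (?s \<ominus>\<^bsub>L0 M\<^esub> p y) (p x)"
    proof (rule greatest[OF x])
      show "L0_le M (?s \<ominus>\<^bsub>L0 M\<^esub> p y) \<xi>" if "\<xi> \<in> S x" for \<xi>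
        using L0_rv_diff[OF sc pc[OF y]] 2[OF that] unfolding L0_le_def by eventually_elim simp
    qed (use sc pc[OF y] in simp)
    with L0_rv_diff[OF sc pc[OF y]] L0_rv_add[OF pc[OF x] pc[OF y]] show ?thesis
      unfolding L0_le_def by eventually_elim simp
  qed
  have le_hom: "L0_le M (p (\<eta> \<odot> x)) (\<eta> \<otimes>\<^bsub>L0 M\<^esub> p x)"
    if \<eta>: "\<eta> \<in> L0_pos M" and x: "x \<in> carrier E" for \<eta> x
  proof -
    note \<eta>c = L0_posD[OF \<eta>]
    obtain \<theta> where \<theta>: "\<theta> \<in> L0_pos M" and inv: "\<theta> \<otimes>\<^bsub>L0 M\<^esub> \<eta> = \<one>\<^bsub>L0 M\<^esub>" using L0_pos_inverse[OF \<eta>] .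
    note \<theta>c = L0_posD[OF \<theta>]
    have s: "p (\<eta> \<odot> x) \<in> carrier (L0 M)" using pc x \<eta>c by simp
    have "L0_le M (\<theta> \<otimes>\<^bsub>L0 M\<^esub> p (\<eta> \<odot> x)) (p x)"
    proof (intro greatest)
      fix \<xi> assume \<xi>: "\<xi> \<in> S x"
      obtain \<zeta> where "\<zeta> \<in> S (\<eta> \<odot> x)" "L0_le M \<zeta> (\<eta> \<otimes>\<^bsub>L0 M\<^esub> \<xi>)" using hom[OF x \<eta> \<xi>] by blast
      then have "L0_le M (p (\<eta> \<odot> x)) (\<eta> \<otimes>\<^bsub>L0 M\<^esub> \<xi>)"
        using lower x \<eta>c by (blast intro: L0_le_trans)
      then have "L0_le M (\<theta> \<otimes>\<^bsub>L0 M\<^esub> p (\<eta> \<odot> x)) (\<theta> \<otimes>\<^bsub>L0 M\<^esub> (\<eta> \<otimes>\<^bsub>L0 M\<^esub> \<xi>))"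
        using \<theta> s \<eta>c Sc[OF x \<xi>] by (intro L0_mult_left_mono) auto
      then show "L0_le M (\<theta> \<otimes>\<^bsub>L0 M\<^esub> p (\<eta> \<odot> x)) \<xi>"
        using \<theta>c \<eta>c Sc[OF x \<xi>] inv by (simp add: L0.m_assoc[symmetric])
    qed (use x \<theta>c s in auto)
    then have "L0_le M (\<eta> \<otimes>\<^bsub>L0 M\<^esub> (\<theta> \<otimes>\<^bsub>L0 M\<^esub> p (\<eta> \<odot> x))) (\<eta> \<otimes>\<^bsub>L0 M\<^esub> p x)"
      using \<eta> \<theta>c s pc[OF x] by (intro L0_mult_left_mono) auto
    moreover have "\<eta> \<otimes>\<^bsub>L0 M\<^esub> \<theta> = \<one>\<^bsub>L0 M\<^esub>" using inv \<theta>c \<eta>c by (simp add: L0.m_comm)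
    ultimately show ?thesis using \<eta>c \<theta>c s by (simp add: L0.m_assoc[symmetric])
  qed
  have hom_eq: "p (\<eta> \<odot> x) = \<eta> \<otimes>\<^bsub>L0 M\<^esub> p x"
    if \<eta>: "\<eta> \<in> L0_pos M" and x: "x \<in> carrier E" for \<eta> x
  proof -
    note \<eta>c = L0_posD[OF \<eta>]
    obtain \<theta> where \<theta>: "\<theta> \<in> L0_pos M" and inv: "\<theta> \<otimes>\<^bsub>L0 M\<^esub> \<eta> = \<one>\<^bsub>L0 M\<^esub>" using L0_pos_inverse[OF \<eta>] .
    note \<theta>c = L0_posD[OF \<theta>]
    have s: "p (\<eta> \<odot> x) \<in> carrier (L0 M)" using pc x \<eta>c by simp
    have inv': "\<eta> \<otimes>\<^bsub>L0 M\<^esub> \<theta> = \<one>\<^bsub>L0 M\<^esub>" using inv \<theta>c \<eta>c by (simp add: L0.m_comm)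
    have "L0_le M (p (\<theta> \<odot> (\<eta> \<odot> x))) (\<theta> \<otimes>\<^bsub>L0 M\<^esub> p (\<eta> \<odot> x))"
      using le_hom \<theta> x \<eta>c by simp
    then have "L0_le M (p x) (\<theta> \<otimes>\<^bsub>L0 M\<^esub> p (\<eta> \<odot> x))"
      using x \<eta>c \<theta>c inv by (simp add: smult_assoc1[symmetric])
    then have "L0_le M (\<eta> \<otimes>\<^bsub>L0 M\<^esub> p x) (\<eta> \<otimes>\<^bsub>L0 M\<^esub> (\<theta> \<otimes>\<^bsub>L0 M\<^esub> p (\<eta> \<odot> x)))"
      using \<eta> \<theta>c s pc[OF x] by (intro L0_mult_left_mono) auto
    then have "L0_le M (\<eta> \<otimes>\<^bsub>L0 M\<^esub> p x) (p (\<eta> \<odot> x))"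
      using \<eta>c \<theta>c s inv' by (simp add: L0.m_assoc[symmetric])
    then show ?thesis using le_hom[OF \<eta> x] s \<eta>c pc[OF x] by (intro L0_le_antisym) auto
  qed
  show ?thesis
  proof (rule that)
    show "L0_sublinear M E p" using pc le_add hom_eq by (auto simp: L0_sublinear_def)
    show "p \<in> extensional (carrier E)" by (simp add: p_def)
  qed (rule p)
qed

text \<open>Zorn's lemma: the infimum along a chain is again sublinear, and it is finite because each member
  \<open>q\<close> of the chain satisfies \<open>q x \<ge> - q (- x) \<ge> - p (- x)\<close>.\<close>

lemma sublinear_minimal_below:
  assumes p: "L0_sublinear M E p"
  obtains m where "L0_sublinear M E m" "m \<in> extensional (carrier E)"
    "\<And>x. x \<in> carrier E \<Longrightarrow> L0_le M (m x) (p x)"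
    "\<And>q. L0_sublinear M E q \<Longrightarrow> q \<in> extensional (carrier E) \<Longrightarrow>
       (\<And>x. x \<in> carrier E \<Longrightarrow> L0_le M (q x) (m x)) \<Longrightarrow> q = m"
proof -
  define A where "A = {q \<in> extensional (carrier E). L0_sublinear M E q \<and> (\<forall>x\<in>carrier E. L0_le M (q x) (p x))}"
  define P where "P q r \<longleftrightarrow> (\<forall>x\<in>carrier E. L0_le M (r x) (q x))" for q r :: "'e \<Rightarrow> 'w L0"
  have "\<exists>m\<in>A. \<forall>q\<in>A. P m q \<longrightarrow> q = m"
  proof (rule predicate_Zorn)
    show "partial_order_on A (relation_of P A)"
    proof (rule partial_order_on_relation_ofI)
      show "P q q" for q by (simp add: P_def L0_le_refl)
      show "P q s" if "P q r" "P r s" for q r s using that by (auto simp: P_def intro: L0_le_trans)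
      show "q = r" if "q \<in> A" "r \<in> A" "P q r" "P r q" for q r
      proof (rule extensionalityI[of _ "carrier E"])
        fix x assume x: "x \<in> carrier E"
        have "q x \<in> carrier (L0 M)" "r x \<in> carrier (L0 M)"
          using that x by (auto simp: A_def intro: sublinear_closed)
        then show "q x = r x" using that x by (intro L0_le_antisym) (auto simp: P_def)
      qed (use that in \<open>auto simp: A_def\<close>)
    qed
  next
    fix C assume "C \<in> Chains (relation_of P A)"
    then have CA: "C \<subseteq> A" and chain: "\<And>q r. q \<in> C \<Longrightarrow> r \<in> C \<Longrightarrow> P q r \<or> P r q"
      by (auto simp: Chains_def relation_of_def)
    show "\<exists>u\<in>A. \<forall>q\<in>C. P q u"
    proof (cases "C = {}")
      case True
      have "L0_sublinear M E (restrict p (carrier E))"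
        using p by (auto simp: L0_sublinear_def L0_posD)
      then show ?thesis using True by (auto simp: A_def L0_le_refl)
    next
      case False
      have Csub: "L0_sublinear M E q" "\<And>x. x \<in> carrier E \<Longrightarrow> L0_le M (q x) (p x)" if "q \<in> C" for q
        using CA that by (auto simp: A_def)
      obtain u where u: "L0_sublinear M E u" "u \<in> extensional (carrier E)"
        "\<And>x. x \<in> carrier E \<Longrightarrow> L0_is_glb M ((\<lambda>q. q x) ` C) (u x)"
      proof (rule sublinear_inf)
        fix x assume x: "x \<in> carrier E"
        show "(\<lambda>q. q x) ` C \<subseteq> carrier (L0 M) \<and> (\<lambda>q. q x) ` C \<noteq> {}"
          using Csub x False by (auto intro: sublinear_closed)
        have pc: "p (\<ominus> x) \<in> carrier (L0 M)" using sublinear_closed[OF p] x by simp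
        have "L0_le M (\<ominus>\<^bsub>L0 M\<^esub> p (\<ominus> x)) (q x)" if "q \<in> C" for q
          using sublinear_neg[OF Csub(1)[OF that] x] Csub(2)[OF that M.a_inv_closed[OF x]] L0_rv_uminus[OF pc]
          unfolding L0_le_def by eventually_elim simp
        then show "\<exists>b\<in>carrier (L0 M). \<forall>\<xi>\<in>(\<lambda>q. q x) ` C. L0_le M b \<xi>"
          using pc by (intro bexI[of _ "\<ominus>\<^bsub>L0 M\<^esub> p (\<ominus> x)"]) auto
      next
        fix x y \<xi> \<zeta> assume xy: "x \<in> carrier E" "y \<in> carrier E" and "\<xi> \<in> (\<lambda>q. q x) ` C" "\<zeta> \<in> (\<lambda>q. q y) ` C"
        then obtain q r where qr: "q \<in> C" "\<xi> = q x" "r \<in> C" "\<zeta> = r y" by blast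
        have "P q q" "P r r" by (auto simp: P_def L0_le_refl)
        then have "\<exists>s\<in>C. P q s \<and> P r s" using chain[OF qr(1,3)] qr(1,3) by blast
        then obtain s where s: "s \<in> C" "L0_le M (s x) (q x)" "L0_le M (s y) (r y)" using xy by (auto simp: P_def)
        have "L0_le M (s (x \<oplus> y)) (s x \<oplus>\<^bsub>L0 M\<^esub> s y)" using Csub(1)[OF s(1)] xy by (simp add: L0_sublinear_def)
        moreover have "L0_le M (s x \<oplus>\<^bsub>L0 M\<^esub> s y) (\<xi> \<oplus>\<^bsub>L0 M\<^esub> \<zeta>)"
          unfolding qr using s xy qr(1,3) by (intro L0_add_mono sublinear_closed[OF Csub(1)])
        ultimately show "\<exists>\<theta>\<in>(\<lambda>q. q (x \<oplus> y)) ` C. L0_le M \<theta> (\<xi> \<oplus>\<^bsub>L0 M\<^esub> \<zeta>)"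
          using s(1) by (auto intro: L0_le_trans)
      next
        fix x \<xi> \<eta> assume "x \<in> carrier E" "\<eta> \<in> L0_pos M" "\<xi> \<in> (\<lambda>q. q x) ` C"
        then show "\<exists>\<theta>\<in>(\<lambda>q. q (\<eta> \<odot> x)) ` C. L0_le M \<theta> (\<eta> \<otimes>\<^bsub>L0 M\<^esub> \<xi>)"
          using Csub(1) by (auto simp: L0_sublinear_def intro!: L0_le_refl)
      qed blast
      have le: "L0_le M (u x) (q x)" if "q \<in> C" "x \<in> carrier E" for q x
        using u(3) that by (auto simp: L0_is_glb_def)
      moreover obtain q where "q \<in> C" using False by blast
      ultimately have "u \<in> A"
        using u(1,2) Csub(2) unfolding A_def by (blast intro: L0_le_trans)
      then show ?thesis using le by (auto simp: P_def)
    qed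
  qed
  then obtain m where m: "m \<in> A" "\<And>q. q \<in> A \<Longrightarrow> P m q \<Longrightarrow> q = m" by blast
  show ?thesis
  proof (rule that)
    fix q assume q: "L0_sublinear M E q" "q \<in> extensional (carrier E)" "\<And>x. x \<in> carrier E \<Longrightarrow> L0_le M (q x) (m x)"
    then show "q = m" using m(1) by (intro m(2)) (auto simp: A_def P_def intro: L0_le_trans)
  qed (use m(1) in \<open>auto simp: A_def\<close>)
qed

text \<open>A minimal sublinear function \<open>m\<close> is additive: for a direction \<open>y\<close> the function
  \<open>x \<mapsto> inf {m (x + t y) - t m y | t > 0}\<close> is sublinear and below \<open>m\<close>, so by minimality
  \<open>m x \<le> m (x + y) - m y\<close>.  Homogeneity under strictly positive scalars is enough to start from,
  because every scalar is a difference of two strictly positive ones.\<close>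

theorem Hahn_Banach_L0:
  assumes p: "L0_sublinear M E p"
  obtains z where "L0_linear M E z" "z \<in> extensional (carrier E)"
    "\<And>x. x \<in> carrier E \<Longrightarrow> L0_le M (z x) (p x)"
proof -
  obtain m where m: "L0_sublinear M E m" "m \<in> extensional (carrier E)"
    "\<And>x. x \<in> carrier E \<Longrightarrow> L0_le M (m x) (p x)"
    and min: "\<And>q. L0_sublinear M E q \<Longrightarrow> q \<in> extensional (carrier E) \<Longrightarrow>
       (\<And>x. x \<in> carrier E \<Longrightarrow> L0_le M (q x) (m x)) \<Longrightarrow> q = m"
    using sublinear_minimal_below[OF p] by blast
  note mc = sublinear_closed[OF m(1)]
  have mhom: "m (\<eta> \<odot> x) = \<eta> \<otimes>\<^bsub>L0 M\<^esub> m x" if "\<eta> \<in> L0_pos M" "x \<in> carrier E" for \<eta> x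
    using m(1) that by (simp add: L0_sublinear_def)
  have super: "L0_le M (m x \<oplus>\<^bsub>L0 M\<^esub> m y) (m (x \<oplus> y))"
    if x: "x \<in> carrier E" and y: "y \<in> carrier E" for x y
  proof -
    define S where "S x = (\<lambda>t. m (x \<oplus> t \<odot> y) \<ominus>\<^bsub>L0 M\<^esub> t \<otimes>\<^bsub>L0 M\<^esub> m y) ` L0_pos M" for x
    have rvS: "AE w in M. L0_rv (m (x \<oplus> t \<odot> y) \<ominus>\<^bsub>L0 M\<^esub> t \<otimes>\<^bsub>L0 M\<^esub> m y) w
        = L0_rv (m (x \<oplus> t \<odot> y)) w - L0_rv (m (t \<odot> y)) w"
      if "t \<in> L0_pos M" "x \<in> carrier E" for x t
      using L0_rv_diff[of "m (x \<oplus> t \<odot> y)" M "t \<otimes>\<^bsub>L0 M\<^esub> m y"] mhom[OF that(1) y] that y mc L0_posD[OF that(1)]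
      by simp
    obtain q where q: "L0_sublinear M E q" "q \<in> extensional (carrier E)"
      "\<And>x. x \<in> carrier E \<Longrightarrow> L0_is_glb M (S x) (q x)"
    proof (rule sublinear_inf)
      fix x assume x: "x \<in> carrier E"
      show "S x \<subseteq> carrier (L0 M) \<and> S x \<noteq> {}"
        using x y L0_one_pos[of M] by (auto simp: S_def L0_posD mc)
      have "L0_le M (\<ominus>\<^bsub>L0 M\<^esub> m (\<ominus> x)) \<xi>" if "\<xi> \<in> S x" for \<xi>
      proof -
        obtain t where t: "t \<in> L0_pos M" "\<xi> = m (x \<oplus> t \<odot> y) \<ominus>\<^bsub>L0 M\<^esub> t \<otimes>\<^bsub>L0 M\<^esub> m y"
          using \<open>\<xi> \<in> S x\<close> unfolding S_def by blast
        have ty: "t \<odot> y \<in> carrier E" using L0_posD[OF t(1)] y by simp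
        have "(x \<oplus> t \<odot> y) \<oplus> \<ominus> x = t \<odot> y"
          using x ty by (simp add: M.a_comm[of x] M.a_assoc M.r_neg)
        then show ?thesis
          using sublinear_add[OF m(1) _ M.a_inv_closed[OF x], of "x \<oplus> t \<odot> y"] x ty
            rvS[OF t(1) x] L0_rv_uminus[OF mc[OF M.a_inv_closed[OF x]]]
          unfolding L0_le_def t(2) by (auto elim: eventually_elim2)
      qed
      then show "\<exists>b\<in>carrier (L0 M). \<forall>\<xi>\<in>S x. L0_le M b \<xi>"
        using mc x by (intro bexI[of _ "\<ominus>\<^bsub>L0 M\<^esub> m (\<ominus> x)"]) auto
    next
      fix a b \<xi> \<zeta> assume ab: "a \<in> carrier E" "b \<in> carrier E" and "\<xi> \<in> S a" "\<zeta> \<in> S b"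
      then obtain s t where st: "s \<in> L0_pos M" "\<xi> = m (a \<oplus> s \<odot> y) \<ominus>\<^bsub>L0 M\<^esub> s \<otimes>\<^bsub>L0 M\<^esub> m y"
        "t \<in> L0_pos M" "\<zeta> = m (b \<oplus> t \<odot> y) \<ominus>\<^bsub>L0 M\<^esub> t \<otimes>\<^bsub>L0 M\<^esub> m y" unfolding S_def by blast
      note c = L0_posD[OF st(1)] L0_posD[OF st(3)]
      have posst: "s \<oplus>\<^bsub>L0 M\<^esub> t \<in> L0_pos M"
        using L0_rv_add[OF c] st(1,3) c by (auto simp: L0_pos_iff elim!: eventually_elim2)
      have e: "(a \<oplus> b) \<oplus> (s \<oplus>\<^bsub>L0 M\<^esub> t) \<odot> y = (a \<oplus> s \<odot> y) \<oplus> (b \<oplus> t \<odot> y)"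
        using ab c y by (simp add: smult_l_distr M.a_ac)
      let ?\<theta> = "m ((a \<oplus> b) \<oplus> (s \<oplus>\<^bsub>L0 M\<^esub> t) \<odot> y) \<ominus>\<^bsub>L0 M\<^esub> (s \<oplus>\<^bsub>L0 M\<^esub> t) \<otimes>\<^bsub>L0 M\<^esub> m y"
      have "AE w in M. L0_rv (m ((s \<oplus>\<^bsub>L0 M\<^esub> t) \<odot> y)) w = L0_rv (m (s \<odot> y)) w + L0_rv (m (t \<odot> y)) w"
        using L0_rv_add[of "s \<otimes>\<^bsub>L0 M\<^esub> m y" M "t \<otimes>\<^bsub>L0 M\<^esub> m y"] c mc[OF y]
        by (simp add: mhom posst st y L0.l_distr)
      then have "L0_le M ?\<theta> (\<xi> \<oplus>\<^bsub>L0 M\<^esub> \<zeta>)"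
        using rvS[OF posst M.a_closed[OF ab]] rvS[OF st(1) ab(1)] rvS[OF st(3) ab(2)]
          L0_rv_add[of \<xi> M \<zeta>] sublinear_add[OF m(1), of "a \<oplus> s \<odot> y" "b \<oplus> t \<odot> y"] ab c y mc
        unfolding L0_le_def st(2,4) e by (simp add: eventually_conj_iff[symmetric]) (auto elim: eventually_mono)
      then show "\<exists>\<theta>\<in>S (a \<oplus> b). L0_le M \<theta> (\<xi> \<oplus>\<^bsub>L0 M\<^esub> \<zeta>)"
        using posst by (auto simp: S_def)
    next
      fix a \<xi> \<eta> assume a: "a \<in> carrier E" and \<eta>: "\<eta> \<in> L0_pos M" and "\<xi> \<in> S a"
      then obtain s where s: "s \<in> L0_pos M" "\<xi> = m (a \<oplus> s \<odot> y) \<ominus>\<^bsub>L0 M\<^esub> s \<otimes>\<^bsub>L0 M\<^esub> m y" unfolding S_def by blast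
      note c = L0_posD[OF s(1)] L0_posD[OF \<eta>]
      have pos: "\<eta> \<otimes>\<^bsub>L0 M\<^esub> s \<in> L0_pos M"
        using L0_rv_mult[OF c(2,1)] s(1) \<eta> c by (auto simp: L0_pos_iff elim!: eventually_elim2)
      have e: "\<eta> \<odot> a \<oplus> (\<eta> \<otimes>\<^bsub>L0 M\<^esub> s) \<odot> y = \<eta> \<odot> (a \<oplus> s \<odot> y)"
        using a c y by (simp add: smult_r_distr smult_assoc1)
      have "m (\<eta> \<odot> a \<oplus> (\<eta> \<otimes>\<^bsub>L0 M\<^esub> s) \<odot> y) \<ominus>\<^bsub>L0 M\<^esub> (\<eta> \<otimes>\<^bsub>L0 M\<^esub> s) \<otimes>\<^bsub>L0 M\<^esub> m y = \<eta> \<otimes>\<^bsub>L0 M\<^esub> \<xi>"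
        using a c y mc by (simp add: e mhom[OF \<eta>] s(2) L0.minus_eq L0.r_distr L0.r_minus L0.m_assoc)
      then show "\<exists>\<theta>\<in>S (\<eta> \<odot> a). L0_le M \<theta> (\<eta> \<otimes>\<^bsub>L0 M\<^esub> \<xi>)"
        using pos unfolding S_def by (intro bexI[OF _ imageI[OF pos]]) (simp add: L0_le_refl)
    qed blast
    have le: "L0_le M (q x) (m (x \<oplus> t \<odot> y) \<ominus>\<^bsub>L0 M\<^esub> t \<otimes>\<^bsub>L0 M\<^esub> m y)" if "x \<in> carrier E" "t \<in> L0_pos M" for x t
      using q(3)[OF that(1)] that(2) by (auto simp: L0_is_glb_def S_def)
    have le1: "L0_le M (q x) (m (x \<oplus> y) \<ominus>\<^bsub>L0 M\<^esub> m y)" if "x \<in> carrier E" for x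
      using le[OF that L0_one_pos] mc[OF y] y by simp
    have "L0_le M (q x) (m x)" if "x \<in> carrier E" for x
      using le1[OF that] L0_rv_diff[OF mc[OF M.a_closed[OF that y]] mc[OF y]] sublinear_add[OF m(1) that y]
      unfolding L0_le_def by eventually_elim simp
    then have "q = m" using q by (intro min) auto
    then show ?thesis
      using le1[OF x] L0_rv_diff[OF mc[OF M.a_closed[OF x y]] mc[OF y]] L0_rv_add[OF mc[OF x] mc[OF y]]
      unfolding L0_le_def by (auto elim: eventually_elim2)
  qed
  have add: "m (x \<oplus> y) = m x \<oplus>\<^bsub>L0 M\<^esub> m y" if "x \<in> carrier E" "y \<in> carrier E" for x y
    using super[OF that] m(1) mc that by (intro L0_le_antisym) (auto simp: L0_sublinear_def)
  have "m (\<eta> \<odot> x) = \<eta> \<otimes>\<^bsub>L0 M\<^esub> m x" if \<eta>: "\<eta> \<in> carrier (L0 M)" and x: "x \<in> carrier E" for \<eta> x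
  proof -
    note [measurable] = L0_rv_measurable[OF \<eta>]
    let ?u = "L0_class M (\<lambda>w. \<bar>L0_rv \<eta> w\<bar> + 1)" and ?v = "L0_class M (\<lambda>w. \<bar>L0_rv \<eta> w\<bar> - L0_rv \<eta> w + 1)"
    have uv: "?u \<in> L0_pos M" "?v \<in> L0_pos M" by (auto intro!: L0_class_pos AE_I2)
    note c = L0_posD[OF uv(1)] L0_posD[OF uv(2)]
    have "?v \<oplus>\<^bsub>L0 M\<^esub> L0_class M (L0_rv \<eta>) = ?u"
      by (subst L0_class_add) (auto intro!: L0_class_eqI)
    then have sum: "?v \<oplus>\<^bsub>L0 M\<^esub> \<eta> = ?u" using \<eta> by (simp add: L0_class_rv)
    have "?v \<otimes>\<^bsub>L0 M\<^esub> m x \<oplus>\<^bsub>L0 M\<^esub> m (\<eta> \<odot> x) = m (?v \<odot> x \<oplus> \<eta> \<odot> x)"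
      using c \<eta> x by (simp add: add mhom[OF uv(2)])
    also have "\<dots> = m (?u \<odot> x)"
      using c \<eta> x by (simp add: smult_l_distr[symmetric] sum)
    also have "\<dots> = ?u \<otimes>\<^bsub>L0 M\<^esub> m x" by (rule mhom[OF uv(1) x])
    also have "\<dots> = ?v \<otimes>\<^bsub>L0 M\<^esub> m x \<oplus>\<^bsub>L0 M\<^esub> \<eta> \<otimes>\<^bsub>L0 M\<^esub> m x"
      using c \<eta> mc[OF x] by (simp add: sum[symmetric] L0.l_distr)
    finally have eq: "?v \<otimes>\<^bsub>L0 M\<^esub> m x \<oplus>\<^bsub>L0 M\<^esub> m (\<eta> \<odot> x) = ?v \<otimes>\<^bsub>L0 M\<^esub> m x \<oplus>\<^bsub>L0 M\<^esub> \<eta> \<otimes>\<^bsub>L0 M\<^esub> m x" .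
    note cl = L0.m_closed[OF c(2) mc[OF x]] L0.m_closed[OF \<eta> mc[OF x]] mc[OF smult_closed[OF \<eta> x]]
    show ?thesis
    proof (rule L0_eqI[OF cl(3,2)])
      show "AE w in M. L0_rv (m (\<eta> \<odot> x)) w = L0_rv (\<eta> \<otimes>\<^bsub>L0 M\<^esub> m x) w"
        using L0_rv_add[OF cl(1,3)] L0_rv_add[OF cl(1,2)] unfolding eq by eventually_elim simp
    qed
  qed
  then have "L0_linear M E m" using mc add by (auto simp: L0_linear_def)
  then show ?thesis using that m(2,3) by blast
qed

end

section \<open>Exhaustion of events\<close>

text \<open>Concatenation turns a maximising sequence for the probability of the event where the property
  holds into a member \<open>t\<close> that attains the maximum.  A member with the property on a non-null part of
  \<open>A\<close> where \<open>t\<close> lacks it could be concatenated with \<open>t\<close>, against maximality.\<close>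

lemma (in prob_space) stable_exhaustion:
  fixes \<Phi> :: "'t \<Rightarrow> 'a \<Rightarrow> bool"
  assumes T: "T \<noteq> {}" and A: "A \<in> sets M"
    and meas: "\<And>t. t \<in> T \<Longrightarrow> {w \<in> space M. \<Phi> t w} \<in> sets M"
    and concat: "\<And>ts N. range ts \<subseteq> T \<Longrightarrow> N \<in> measurable M (count_space (UNIV :: nat set)) \<Longrightarrow>
        \<exists>t\<in>T. AE w in M. \<Phi> (ts (N w)) w \<longrightarrow> \<Phi> t w"
  obtains (all) t where "t \<in> T" "AE w\<in>A in M. \<Phi> t w"
    | (none) B where "B \<in> sets M" "B \<subseteq> A" "0 < prob B" "\<And>t. t \<in> T \<Longrightarrow> AE w\<in>B in M. \<not> \<Phi> t w"
proof -
  define H where "H t = A \<inter> {w \<in> space M. \<Phi> t w}" for t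
  have Hm: "H t \<in> sets M" if "t \<in> T" for t using meas[OF that] A by (auto simp: H_def)
  let ?\<alpha> = "SUP t\<in>T. prob (H t)"
  have bdd: "bdd_above ((\<lambda>t. prob (H t)) ` T)" by (intro bdd_aboveI[of _ 1]) auto
  have "\<exists>t\<in>T. ?\<alpha> - 1 / real (Suc n) < prob (H t)" for n
    using less_cSup_iff[OF _ bdd, of "?\<alpha> - 1 / real (Suc n)"] T by force
  then obtain ts where ts: "\<And>n. ts n \<in> T" "\<And>n. ?\<alpha> - 1 / real (Suc n) < prob (H (ts n))" by metis
  \<comment> \<open>the default value of \<open>LEAST\<close> is harmless: it is taken only where no \<open>ts n\<close> has the property\<close>
  have N: "(\<lambda>w. LEAST n. \<Phi> (ts n) w) \<in> measurable M (count_space UNIV)"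
    using meas[OF ts(1)] by (intro measurable_Least) (simp add: pred_def)
  obtain t where t: "t \<in> T" "AE w in M. \<Phi> (ts (LEAST n. \<Phi> (ts n) w)) w \<longrightarrow> \<Phi> t w"
    using concat[of ts, OF _ N] ts(1) by blast
  have "prob (H (ts n)) \<le> prob (H t)" for n
  proof (rule finite_measure_mono_AE)
    show "AE w in M. w \<in> H (ts n) \<longrightarrow> w \<in> H t"
      using t(2) by eventually_elim (auto simp: H_def intro: LeastI)
  qed (rule Hm[OF t(1)])
  then have "?\<alpha> \<le> prob (H t) + 1 / real (Suc n)" for n
    using ts(2)[of n] by (smt (verit))
  then have max: "?\<alpha> \<le> prob (H t)"
    using LIMSEQ_le_const[OF tendsto_add[OF tendsto_const LIMSEQ_inverse_real_of_nat, of "prob (H t)"], of ?\<alpha>]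
    by (simp add: inverse_eq_divide)
  define B where "B = A - H t"
  have B: "B \<in> sets M" using A Hm[OF t(1)] by (auto simp: B_def)
  have none_B: "AE w\<in>B in M. \<not> \<Phi> t' w" if t': "t' \<in> T" for t'
  proof -
    have N: "(\<lambda>w. if \<Phi> t w then 0 else 1 :: nat) \<in> measurable M (count_space UNIV)"
      using meas[OF t(1)] by (intro measurable_If) auto
    obtain u where u: "u \<in> T" "AE w in M. \<Phi> ((\<lambda>n::nat. if n = 0 then t else t') (if \<Phi> t w then 0 else 1)) w \<longrightarrow> \<Phi> u w"
      using concat[OF _ N, of "\<lambda>n. if n = 0 then t else t'"] t(1) t' by auto
    have sets: "B \<inter> H t' \<in> sets M" using B Hm[OF t'] by auto
    have "prob (H t \<union> (B \<inter> H t')) \<le> prob (H u)"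
    proof (rule finite_measure_mono_AE)
      show "AE w in M. w \<in> H t \<union> (B \<inter> H t') \<longrightarrow> w \<in> H u"
        using u(2) by eventually_elim (auto simp: H_def B_def)
    qed (rule Hm[OF u(1)])
    also have "\<dots> \<le> prob (H t)" using cSup_upper[OF _ bdd] u(1) max by force
    finally have "prob (B \<inter> H t') = 0"
      using finite_measure_Union[OF Hm[OF t(1)] sets] measure_nonneg[of M "B \<inter> H t'"] B_def
      by (metis Diff_disjoint Int_assoc Int_empty_left add.commute add_le_same_cancel2 order_antisym)
    then have "AE w in M. w \<notin> B \<inter> H t'"
      using sets by (simp add: prob_eq_0)
    then show ?thesis using AE_space by eventually_elim (auto simp: B_def H_def)
  qed
  show ?thesis
  proof (cases "prob B = 0")
    case True
    then have "AE w in M. w \<notin> B" using B by (simp add: prob_eq_0)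
    then have "AE w\<in>A in M. \<Phi> t w" by eventually_elim (auto simp: B_def H_def)
    then show ?thesis using all t(1) by blast
  next
    case False
    then have "0 < prob B" using measure_nonneg[of M B] by linarith
    then show ?thesis using none[OF B _ _ none_B] by (auto simp: B_def)
  qed
qed

section \<open>Normed modules and bounded functionals\<close>

lemma AE_le_if_le_add_inverse_Suc:
  fixes f g h :: "'w \<Rightarrow> real"
  assumes "\<And>n. AE w in M. f w \<le> g w + h w / real (Suc n)"
  shows "AE w in M. f w \<le> g w"
proof -
  have "AE w in M. \<forall>n. f w \<le> g w + h w / real (Suc n)"
    using assms by (simp add: AE_all_countable)
  then show ?thesis
  proof eventually_elim
    case (elim w)
    have "(\<lambda>n. g w + h w * inverse (real (Suc n))) \<longlonglongrightarrow> g w + h w * 0"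
      by (intro tendsto_intros LIMSEQ_inverse_real_of_nat)
    then show ?case
      using LIMSEQ_le_const[of "\<lambda>n. g w + h w * inverse (real (Suc n))" "g w" "f w"] elim
      by (simp add: divide_inverse)
  qed
qed

lemma L0_rv_ind: "A \<in> sets M \<Longrightarrow> AE w in M. L0_rv (L0_ind M A) w = indicator A w"
  unfolding L0_ind_def by (intro L0_rv_class) simp

lemma topspace_L0_topology: "topspace (L0_topology M) = carrier (L0 M)"
proof -
  have "openin (L0_topology M) (carrier (L0 M))"
    unfolding openin_L0_topology using L0_one_pos by (auto intro: L0_add_closed)
  then show ?thesis
    by (metis openin_L0_topology openin_subset openin_topspace subset_antisym)
qed

locale L0_normed = L0_module M E for M :: "'w measure" and E :: "('w L0, 'e, 'm) module_scheme" (structure) +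
  fixes nrm :: "'e \<Rightarrow> 'w L0"
  assumes nm: "L0_normed_module M E nrm"
begin

abbreviation norm_rv :: "'e \<Rightarrow> 'w \<Rightarrow> real" where
  "norm_rv x \<equiv> L0_rv (nrm x)"

abbreviation scale :: "('w \<Rightarrow> real) \<Rightarrow> 'e \<Rightarrow> 'e" where
  "scale f x \<equiv> L0_class M f \<odot> x"

abbreviation dual :: "('w L0, 'e \<Rightarrow> 'w L0) module" where
  "dual \<equiv> L0_dual M E nrm"

abbreviation weak_star :: "('e \<Rightarrow> 'w L0) topology" where
  "weak_star \<equiv> L0_weak_star M E nrm"

text \<open>The bound is a real function and not an element of \<open>L0\<close>, and no infimum over the bounds is
  taken: most arguments need one pointwise bound and never the dual norm itself.\<close>

definition bounded_by :: "('w \<Rightarrow> real) \<Rightarrow> ('e \<Rightarrow> 'w L0) \<Rightarrow> bool" where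
  "bounded_by R z \<longleftrightarrow> (\<forall>x\<in>carrier E. AE w in M. \<bar>L0_rv (z x) w\<bar> \<le> R w * norm_rv x w)"

lemma scale_closed: "f \<in> borel_measurable M \<Longrightarrow> x \<in> carrier E \<Longrightarrow> scale f x \<in> carrier E"
  by simp

lemmas norm_closed = nrm_closed[OF nm]

lemma norm_rv_measurable [measurable]: "x \<in> carrier E \<Longrightarrow> norm_rv x \<in> borel_measurable M"
  by (intro L0_rv_measurable norm_closed)

lemma norm_rv_nonneg: "x \<in> carrier E \<Longrightarrow> AE w in M. 0 \<le> norm_rv x w"
proof -
  assume "x \<in> carrier E"
  then have "nrm x \<in> L0_nonneg M"
    using nm by (auto simp: L0_normed_module_def L0_norm_def L0_seminorm_def)
  then have "L0_le M \<zero>\<^bsub>L0 M\<^esub> (nrm x)" by (simp add: L0_nonneg_def)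
  with L0_rv_zero[of M] show ?thesis unfolding L0_le_def by eventually_elim simp
qed

lemma norm_rv_add:
  assumes "x \<in> carrier E" "y \<in> carrier E"
  shows "AE w in M. norm_rv (x \<oplus> y) w \<le> norm_rv x w + norm_rv y w"
  using nrm_triangle[OF nm assms] L0_rv_add[OF norm_closed[OF assms(1)] norm_closed[OF assms(2)]]
  unfolding L0_le_def by eventually_elim simp

lemma norm_rv_scale:
  assumes "f \<in> borel_measurable M" "x \<in> carrier E"
  shows "AE w in M. norm_rv (scale f x) w = \<bar>f w\<bar> * norm_rv x w"
proof -
  have c: "L0_class M f \<in> carrier (L0 M)" using assms by simp
  show ?thesis
    using L0_rv_mult[OF L0_abs_closed[OF c] norm_closed[OF assms(2)]] L0_rv_abs[OF c] L0_rv_class[OF assms(1)]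
    unfolding nrm_smult[OF nm c assms(2)] by eventually_elim simp
qed

lemma norm_rv_zero: "AE w in M. norm_rv \<zero> w = 0"
  using L0_rv_zero[of M] by (simp add: nrm_zero[OF nm])

lemma norm_rv_minus_sym: "x \<in> carrier E \<Longrightarrow> y \<in> carrier E \<Longrightarrow> norm_rv (x \<ominus> y) = norm_rv (y \<ominus> x)"
  by (simp add: nrm_minus_sym[OF nm])

lemma norm_rv_diff_add:
  assumes "x \<in> carrier E" "y \<in> carrier E" "z \<in> carrier E"
  shows "AE w in M. norm_rv (x \<ominus> z) w \<le> norm_rv (x \<ominus> y) w + norm_rv (y \<ominus> z) w"
proof -
  have "(x \<ominus> y) \<oplus> (y \<ominus> z) = x \<ominus> z"
    using assms by (simp add: M.minus_eq M.a_assoc M.r_neg1)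
  then show ?thesis using norm_rv_add[of "x \<ominus> y" "y \<ominus> z"] assms by simp
qed

lemma norm_rv_Lipschitz:
  assumes "x \<in> carrier E" "y \<in> carrier E"
  shows "AE w in M. \<bar>norm_rv x w - norm_rv y w\<bar> \<le> norm_rv (x \<ominus> y) w"
proof -
  have "\<ominus> \<zero> = \<zero>" by (metis M.l_zero M.r_neg M.zero_closed M.a_inv_closed)
  then have 1: "norm_rv (u \<ominus> \<zero>) = norm_rv u" if "u \<in> carrier E" for u
    by (simp only: M.minus_eq M.r_zero[OF that])
  show ?thesis
    using norm_rv_diff_add[OF assms M.zero_closed] norm_rv_diff_add[OF assms(2,1) M.zero_closed]
    unfolding norm_rv_minus_sym[OF assms(2,1)] 1[OF assms(1)] 1[OF assms(2)]
    by eventually_elim simp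
qed

lemma linear_closed: "L0_linear M E z \<Longrightarrow> x \<in> carrier E \<Longrightarrow> z x \<in> carrier (L0 M)"
  by (auto simp: L0_linear_def)

lemma linear_measurable: "L0_linear M E z \<Longrightarrow> x \<in> carrier E \<Longrightarrow> L0_rv (z x) \<in> borel_measurable M"
  by (intro L0_rv_measurable linear_closed)

lemma linear_add:
  assumes "L0_linear M E z" "x \<in> carrier E" "y \<in> carrier E"
  shows "AE w in M. L0_rv (z (x \<oplus> y)) w = L0_rv (z x) w + L0_rv (z y) w"
  using L0_rv_add[of "z x" M "z y"] assms by (auto simp: L0_linear_def)

lemma linear_scale:
  assumes "L0_linear M E z" "f \<in> borel_measurable M" "x \<in> carrier E"
  shows "AE w in M. L0_rv (z (scale f x)) w = f w * L0_rv (z x) w"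
proof -
  have "z (scale f x) = L0_class M f \<otimes>\<^bsub>L0 M\<^esub> z x" using assms by (simp add: L0_linear_def)
  with L0_rv_mult[OF L0_class_carrier[OF assms(2)] linear_closed[OF assms(1,3)]] L0_rv_class[OF assms(2)]
  show ?thesis by auto
qed

lemma linear_zero:
  assumes "L0_linear M E z"
  shows "AE w in M. L0_rv (z \<zero>) w = 0"
  using linear_add[OF assms M.zero_closed M.zero_closed] by simp

lemma linear_uminus:
  assumes "L0_linear M E z" "x \<in> carrier E"
  shows "AE w in M. L0_rv (z (\<ominus> x)) w = - L0_rv (z x) w"
  using linear_add[OF assms(1) assms(2) M.a_inv_closed[OF assms(2)]] linear_zero[OF assms(1)] assms(2)
  by (simp add: M.r_neg) (auto elim: eventually_elim2)

lemma linear_diff: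
  assumes "L0_linear M E z" "x \<in> carrier E" "y \<in> carrier E"
  shows "AE w in M. L0_rv (z (x \<ominus> y)) w = L0_rv (z x) w - L0_rv (z y) w"
  using linear_add[OF assms(1,2) M.a_inv_closed[OF assms(3)]] linear_uminus[OF assms(1,3)]
  unfolding M.minus_eq by eventually_elim simp

lemma bounded_by_Lipschitz:
  assumes "L0_linear M E z" "bounded_by R z" "x \<in> carrier E" "y \<in> carrier E"
  shows "AE w in M. \<bar>L0_rv (z x) w - L0_rv (z y) w\<bar> \<le> R w * norm_rv (x \<ominus> y) w"
proof -
  have "AE w in M. \<bar>L0_rv (z (x \<ominus> y)) w\<bar> \<le> R w * norm_rv (x \<ominus> y) w"
    using assms by (simp add: bounded_by_def)
  with linear_diff[OF assms(1,3,4)] show ?thesis by eventually_elim simp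
qed

lemma bounded_by_mono:
  assumes "bounded_by R z" "AE w in M. R w \<le> R' w"
  shows "bounded_by R' z"
  unfolding bounded_by_def
proof
  fix x assume x: "x \<in> carrier E"
  then have "AE w in M. \<bar>L0_rv (z x) w\<bar> \<le> R w * norm_rv x w"
    using assms(1) by (simp add: bounded_by_def)
  with assms(2) norm_rv_nonneg[OF x] show "AE w in M. \<bar>L0_rv (z x) w\<bar> \<le> R' w * norm_rv x w"
    by eventually_elim (meson mult_right_mono order_trans)
qed

text \<open>Where \<open>\<parallel>x\<parallel>\<close> vanishes the quotient \<open>e / \<parallel>x\<parallel>\<close> is useless, so \<open>x\<close> is rescaled by
  \<open>e / (\<parallel>x\<parallel> + 1/n)\<close> and \<open>n\<close> tends to infinity.\<close>

lemma bounded_byI_scaling: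
  assumes z: "L0_linear M E z"
    and [measurable]: "e \<in> borel_measurable M" and pos: "AE w in M. 0 < e w"
    and bound: "\<And>y. y \<in> carrier E \<Longrightarrow> AE w in M. norm_rv y w \<le> e w \<Longrightarrow> AE w in M. \<bar>L0_rv (z y) w\<bar> \<le> c w"
  shows "bounded_by (\<lambda>w. c w / e w) z"
  unfolding bounded_by_def
proof
  fix x assume x: "x \<in> carrier E"
  note [measurable] = norm_rv_measurable[OF x]
  have "AE w in M. \<bar>L0_rv (z x) w\<bar> \<le> c w / e w * norm_rv x w + (c w / e w) / real (Suc n)" for n
  proof -
    define f where "f w = e w / (norm_rv x w + 1 / real (Suc n))" for w
    have fm[measurable]: "f \<in> borel_measurable M" unfolding f_def by measurable
    have "AE w in M. norm_rv (scale f x) w \<le> e w"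
      using norm_rv_scale[OF fm x] norm_rv_nonneg[OF x] pos
    proof eventually_elim
      case (elim w)
      have p: "0 < norm_rv x w + 1 / real (Suc n)" using elim by (simp add: add_nonneg_pos)
      have "f w * norm_rv x w \<le> e w"
        using elim p by (simp add: f_def field_simps)
      then show ?case using elim p by (simp add: f_def)
    qed
    from bound[OF _ this] have "AE w in M. \<bar>L0_rv (z (scale f x)) w\<bar> \<le> c w" using x by simp
    with linear_scale[OF z _ x, of f, simplified] norm_rv_nonneg[OF x] pos
    show ?thesis
    proof eventually_elim
      case (elim w)
      have p: "0 < norm_rv x w + 1 / real (Suc n)" using elim by (simp add: add_nonneg_pos)
      have fp: "f w > 0" using p elim by (simp add: f_def)
      have "f w * \<bar>L0_rv (z x) w\<bar> \<le> c w" using elim fp by (simp add: abs_mult)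
      then have "\<bar>L0_rv (z x) w\<bar> \<le> c w / f w" using fp by (simp add: field_simps)
      also have "c w / f w = c w / e w * norm_rv x w + (c w / e w) / real (Suc n)"
        by (simp add: f_def distrib_left add_divide_distrib mult.commute)
      finally show ?case .
    qed
  qed
  then show "AE w in M. \<bar>L0_rv (z x) w\<bar> \<le> c w / e w * norm_rv x w"
    by (rule AE_le_if_le_add_inverse_Suc)
qed

text \<open>Balls in \<open>L0\<close> need not be open, so the proof that a continuous functional is bounded uses the
  random variables of modulus strictly below \<open>1\<close>: they form an open set, whose open preimage contains a
  ball around zero.\<close>

lemma dual_carrier_iff:
  "z \<in> carrier dual \<longleftrightarrow> z \<in> extensional (carrier E) \<and> L0_linear M E z \<and>
     (\<exists>R\<in>borel_measurable M. bounded_by R z)"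
proof -
  have "continuous_map (L0_seminorm_topology M E {nrm}) (L0_topology M) z \<longleftrightarrow>
     (\<exists>R\<in>borel_measurable M. bounded_by R z)" if z: "L0_linear M E z"
  proof
    assume cont: "continuous_map (L0_seminorm_topology M E {nrm}) (L0_topology M) z"
    define U where "U = {\<xi> \<in> carrier (L0 M). AE w in M. \<bar>L0_rv \<xi> w\<bar> < 1}"
    have "openin (L0_topology M) U"
      unfolding openin_L0_topology
    proof (intro conjI ballI)
      fix \<xi> assume \<xi>: "\<xi> \<in> U"
      then have \<xi>c: "\<xi> \<in> carrier (L0 M)" and lt: "AE w in M. \<bar>L0_rv \<xi> w\<bar> < 1" by (auto simp: U_def)
      note [measurable] = L0_rv_measurable[OF \<xi>c]
      let ?e = "L0_class M (\<lambda>w. (1 - \<bar>L0_rv \<xi> w\<bar>) / 2)"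
      show "\<exists>\<epsilon>\<in>L0_pos M. \<forall>\<zeta>\<in>carrier (L0 M). L0_le M (L0_abs M \<zeta>) \<epsilon> \<longrightarrow> \<xi> \<oplus>\<^bsub>L0 M\<^esub> \<zeta> \<in> U"
      proof (intro bexI ballI impI)
        show "?e \<in> L0_pos M" using lt by (intro L0_class_pos) auto
        fix \<zeta> assume \<zeta>: "\<zeta> \<in> carrier (L0 M)" "L0_le M (L0_abs M \<zeta>) ?e"
        have "AE w in M. L0_rv ?e w = (1 - \<bar>L0_rv \<xi> w\<bar>) / 2" by (intro L0_rv_class) measurable
        with lt L0_rv_abs[OF \<zeta>(1)] L0_rv_add[OF \<xi>c \<zeta>(1)] \<zeta>(2)
        have "AE w in M. \<bar>L0_rv (\<xi> \<oplus>\<^bsub>L0 M\<^esub> \<zeta>) w\<bar> < 1"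
          unfolding L0_le_def by eventually_elim argo
        then show "\<xi> \<oplus>\<^bsub>L0 M\<^esub> \<zeta> \<in> U" using \<xi>c \<zeta> by (simp add: U_def L0_add_closed)
      qed
    qed (auto simp: U_def)
    then have "openin (L0_seminorm_topology M E {nrm}) {x \<in> carrier E. z x \<in> U}"
      using openin_continuous_map_preimage[OF cont] by (simp add: topspace_norm_topology[OF nm])
    moreover have "\<zero> \<in> {x \<in> carrier E. z x \<in> U}"
      using linear_zero[OF z] linear_closed[OF z] by (auto simp: U_def elim: eventually_mono)
    ultimately obtain \<epsilon> where \<epsilon>: "\<epsilon> \<in> L0_pos M"
      "\<And>y. y \<in> carrier E \<Longrightarrow> L0_le M (nrm y) \<epsilon> \<Longrightarrow> \<zero> \<oplus> y \<in> {x \<in> carrier E. z x \<in> U}"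
      unfolding openin_norm_topology[OF nm] by blast
    have "bounded_by (\<lambda>w. 1 / L0_rv \<epsilon> w) z"
    proof (rule bounded_byI_scaling[OF z L0_rv_measurable[OF L0_posD[OF \<epsilon>(1)]]])
      show "AE w in M. 0 < L0_rv \<epsilon> w" using \<epsilon>(1) by (simp add: L0_pos_iff)
      fix y assume "y \<in> carrier E" "AE w in M. norm_rv y w \<le> L0_rv \<epsilon> w"
      then have "z y \<in> U" using \<epsilon>(2)[of y] by (simp add: L0_le_def)
      then show "AE w in M. \<bar>L0_rv (z y) w\<bar> \<le> 1" by (auto simp: U_def elim: eventually_mono)
    qed
    then show "\<exists>R\<in>borel_measurable M. bounded_by R z"
      using L0_rv_measurable[OF L0_posD[OF \<epsilon>(1)]] by (intro bexI[of _ "\<lambda>w. 1 / L0_rv \<epsilon> w"]) auto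
  next
    assume "\<exists>R\<in>borel_measurable M. bounded_by R z"
    then obtain R where [measurable]: "R \<in> borel_measurable M" and R: "bounded_by R z" by blast
    show "continuous_map (L0_seminorm_topology M E {nrm}) (L0_topology M) z"
      unfolding continuous_map_def topspace_norm_topology[OF nm] topspace_L0_topology
    proof (intro conjI allI impI)
      show "z \<in> carrier E \<rightarrow> carrier (L0 M)" using linear_closed[OF z] by blast
      fix U assume U: "openin (L0_topology M) U"
      show "openin (L0_seminorm_topology M E {nrm}) {x \<in> carrier E. z x \<in> U}"
        unfolding openin_norm_topology[OF nm]
      proof (intro conjI ballI)
        fix x assume "x \<in> {x \<in> carrier E. z x \<in> U}"
        then have x: "x \<in> carrier E" "z x \<in> U" by auto
        obtain \<epsilon> where \<epsilon>: "\<epsilon> \<in> L0_pos M"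
          "\<And>\<xi>. \<xi> \<in> carrier (L0 M) \<Longrightarrow> L0_le M (L0_abs M \<xi>) \<epsilon> \<Longrightarrow> z x \<oplus>\<^bsub>L0 M\<^esub> \<xi> \<in> U"
          using U x(2) unfolding openin_L0_topology by blast
        note [measurable] = L0_rv_measurable[OF L0_posD[OF \<epsilon>(1)]]
        define d where "d w = L0_rv \<epsilon> w / (\<bar>R w\<bar> + 1)" for w
        have [measurable]: "d \<in> borel_measurable M" unfolding d_def by measurable
        have epos: "AE w in M. 0 < L0_rv \<epsilon> w" using \<epsilon>(1) by (simp add: L0_pos_iff)
        show "\<exists>\<epsilon>\<in>L0_pos M. \<forall>y\<in>carrier E. L0_le M (nrm y) \<epsilon> \<longrightarrow> x \<oplus> y \<in> {x \<in> carrier E. z x \<in> U}"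
        proof (intro bexI ballI impI)
          show "L0_class M d \<in> L0_pos M"
            using epos by (intro L0_class_pos) (auto simp: d_def elim: eventually_mono)
          fix y assume y: "y \<in> carrier E" and "L0_le M (nrm y) (L0_class M d)"
          then have le: "AE w in M. norm_rv y w \<le> L0_rv (L0_class M d) w" by (simp add: L0_le_def)
          have dd: "AE w in M. L0_rv (L0_class M d) w = d w" by (rule L0_rv_class) measurable
          have "AE w in M. \<bar>L0_rv (z y) w\<bar> \<le> R w * norm_rv y w" using R y by (simp add: bounded_by_def)
          with le dd L0_rv_abs[OF linear_closed[OF z y]] epos norm_rv_nonneg[OF y]
          have "L0_le M (L0_abs M (z y)) \<epsilon>"
            unfolding L0_le_def
          proof eventually_elim
            case (elim w)
            have "R w * norm_rv y w \<le> (\<bar>R w\<bar> + 1) * d w"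
              using elim by (intro mult_mono) auto
            also have "\<dots> = L0_rv \<epsilon> w" by (simp add: d_def)
            finally show ?case using elim by simp
          qed
          then show "x \<oplus> y \<in> {x \<in> carrier E. z x \<in> U}"
            using \<epsilon>(2)[OF linear_closed[OF z y]] z x y by (simp add: L0_linear_def)
        qed
      qed auto
    qed
  qed
  then show ?thesis by (auto simp: L0_dual_def)
qed

lemma dualD:
  assumes "z \<in> carrier dual"
  shows "L0_linear M E z" "z \<in> extensional (carrier E)"
  using assms by (auto simp: dual_carrier_iff)

lemma dual_bound:
  assumes "z \<in> carrier dual"
  obtains R where "R \<in> borel_measurable M" "bounded_by R z" "\<And>w. 0 \<le> R w"
proof -
  obtain R where [measurable]: "R \<in> borel_measurable M" and R: "bounded_by R z"
    using assms by (auto simp: dual_carrier_iff)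
  show ?thesis
    using bounded_by_mono[OF R, of "\<lambda>w. \<bar>R w\<bar>"] by (intro that[of "\<lambda>w. \<bar>R w\<bar>"]) auto
qed

end

section \<open>Concatenation and completeness\<close>

locale L0_stable = L0_normed M E nrm
  for M :: "'w measure" and E :: "('w L0, 'e, 'm) module_scheme" (structure) and nrm :: "'e \<Rightarrow> 'w L0" +
  assumes stable: "stable_with_uniqueness M E"
begin

lemma ae_partition_vimage:
  assumes [measurable]: "N \<in> measurable M (count_space (UNIV :: nat set))"
  shows "ae_partition M (\<lambda>k. {w \<in> space M. N w = k})"
proof -
  have 1: "{w \<in> space M. N w = i} \<inter> {w \<in> space M. N w = j} = {}" if "i \<noteq> j" for i j using that by auto
  have 2: "space M - (\<Union>k. {w \<in> space M. N w = k}) = {}" by auto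
  show ?thesis unfolding ae_partition_def by (intro conjI allI impI; (subst 1 2)?) (simp_all add: 1 2)
qed

text \<open>A partition is encoded by a random index \<open>N\<close>, its pieces being the events \<open>N = k\<close>.  The
  concatenation is then the random member \<open>xs (N w)\<close> of the sequence, and instead of one equation
  for each piece a single pointwise equation of norms describes it.\<close>

lemma concatenation_exists:
  assumes xs: "\<And>n. xs n \<in> carrier E" and N[measurable]: "N \<in> measurable M (count_space (UNIV :: nat set))"
  obtains x where "x \<in> carrier E" "AE w in M. norm_rv (x \<ominus> xs (N w)) w = 0"
proof -
  have "\<exists>x. is_concatenation M E (\<lambda>k. {w \<in> space M. N w = k}) xs x"
    using stable ae_partition_vimage[OF N] xs unfolding stable_with_uniqueness_def by blast
  then obtain x where x: "x \<in> carrier E"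
    and cat: "\<And>k. L0_ind M {w \<in> space M. N w = k} \<odot> x = L0_ind M {w \<in> space M. N w = k} \<odot> xs k"
    unfolding is_concatenation_def by blast
  have "AE w in M. N w = k \<longrightarrow> norm_rv (x \<ominus> xs k) w = 0" for k
  proof -
    have m: "indicat_real {w \<in> space M. N w = k} \<in> borel_measurable M" by simp
    have "scale (indicator {w \<in> space M. N w = k}) (x \<ominus> xs k) = \<zero>"
      using cat[of k] x xs[of k] m unfolding L0_ind_def
      by (simp add: M.minus_eq smult_r_distr smult_r_minus M.r_neg)
    then show ?thesis
      using norm_rv_scale[OF m M.minus_closed[OF x xs[of k]]] norm_rv_zero AE_space
      by (auto simp: indicator_def elim: eventually_elim2)
  qed
  then have "AE w in M. \<forall>k. N w = k \<longrightarrow> norm_rv (x \<ominus> xs k) w = 0"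
    unfolding AE_all_countable by blast
  then have "AE w in M. norm_rv (x \<ominus> xs (N w)) w = 0" by (auto elim: eventually_mono)
  with x show ?thesis by (rule that)
qed

lemma dual_concatenation_exists:
  assumes ks: "\<And>n. ks n \<in> carrier dual" and N[measurable]: "N \<in> measurable M (count_space (UNIV :: nat set))"
  obtains k where "k \<in> carrier dual" "\<And>x. x \<in> carrier E \<Longrightarrow> AE w in M. L0_rv (k x) w = L0_rv (ks (N w) x) w"
proof -
  note lin = dualD(1)[OF ks]
  define k where "k = (\<lambda>x\<in>carrier E. L0_class M (\<lambda>w. L0_rv (ks (N w) x) w))"
  have m: "(\<lambda>w. L0_rv (ks (N w) x) w) \<in> borel_measurable M" if "x \<in> carrier E" for x
    using linear_measurable[OF lin that] N by (rule measurable_compose_countable)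
  have k: "AE w in M. L0_rv (k x) w = L0_rv (ks (N w) x) w" if "x \<in> carrier E" for x
    using L0_rv_class[OF m[OF that]] that by (simp add: k_def)
  have kc: "k x \<in> carrier (L0 M)" if "x \<in> carrier E" for x
    using m that by (simp add: k_def)
  have "k (x \<oplus> y) = k x \<oplus>\<^bsub>L0 M\<^esub> k y" if x: "x \<in> carrier E" and y: "y \<in> carrier E" for x y
  proof (rule L0_eqI[OF kc L0_add_closed[OF kc[OF x] kc[OF y]]])
    have "AE w in M. \<forall>n. L0_rv (ks n (x \<oplus> y)) w = L0_rv (ks n x) w + L0_rv (ks n y) w"
      using linear_add[OF lin x y] by (simp add: AE_all_countable)
    with L0_rv_add[OF kc[OF x] kc[OF y]] k[OF x] k[OF y] k[OF M.a_closed[OF x y]]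
    show "AE w in M. L0_rv (k (x \<oplus> y)) w = L0_rv (k x \<oplus>\<^bsub>L0 M\<^esub> k y) w"
      by eventually_elim simp
  qed (use x y in simp)
  moreover have "k (\<eta> \<odot> x) = \<eta> \<otimes>\<^bsub>L0 M\<^esub> k x" if \<eta>: "\<eta> \<in> carrier (L0 M)" and x: "x \<in> carrier E" for \<eta> x
  proof (rule L0_eqI[OF kc L0_mult_closed[OF \<eta> kc[OF x]]])
    have "AE w in M. \<forall>n. L0_rv (ks n (\<eta> \<odot> x)) w = L0_rv \<eta> w * L0_rv (ks n x) w"
      using linear_scale[OF lin L0_rv_measurable[OF \<eta>] x] by (simp add: AE_all_countable L0_class_rv[OF \<eta>])
    with L0_rv_mult[OF \<eta> kc[OF x]] k[OF x] k[OF smult_closed[OF \<eta> x]]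
    show "AE w in M. L0_rv (k (\<eta> \<odot> x)) w = L0_rv (\<eta> \<otimes>\<^bsub>L0 M\<^esub> k x) w"
      by eventually_elim simp
  qed (use \<eta> x in simp)
  ultimately have "L0_linear M E k" using kc by (auto simp: L0_linear_def)
  moreover obtain R where R: "\<And>n. R n \<in> borel_measurable M" "\<And>n. bounded_by (R n) (ks n)"
    using ks unfolding dual_carrier_iff by metis
  have "bounded_by (\<lambda>w. R (N w) w) k"
    unfolding bounded_by_def
  proof
    fix x assume x: "x \<in> carrier E"
    have "AE w in M. \<forall>n. \<bar>L0_rv (ks n x) w\<bar> \<le> R n w * norm_rv x w"
      using R(2) x by (simp add: AE_all_countable bounded_by_def)
    with k[OF x] show "AE w in M. \<bar>L0_rv (k x) w\<bar> \<le> R (N w) w * norm_rv x w"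
      by eventually_elim simp
  qed
  moreover have "(\<lambda>w. R (N w) w) \<in> borel_measurable M"
    using R(1) N by (rule measurable_compose_countable)
  moreover have "k \<in> extensional (carrier E)" by (simp add: k_def)
  ultimately have "k \<in> carrier dual" by (auto simp: dual_carrier_iff)
  then show ?thesis using k by (rule that)
qed

text \<open>In the topology of an \<open>L0\<close>-norm almost sure convergence of the norms is not convergence.
  Stability repairs this: for each strictly positive \<open>\<epsilon>\<close> the members of the sequence are concatenated
  at the first random index whose error bound is at most \<open>\<epsilon>\<close>, and the elements so obtained form
  a Cauchy net.\<close>

lemma almost_sure_limit_exists:
  assumes compl: "L0_complete M E nrm"
    and xs: "\<And>n. xs n \<in> carrier E"
    and c[measurable]: "\<And>n. c n \<in> borel_measurable M"
    and step: "\<And>n. AE w in M. norm_rv (xs (Suc n) \<ominus> xs n) w \<le> c (Suc n) w - c n w"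
    and bdd: "AE w in M. bdd_above (range (\<lambda>n. c n w))"
  obtains x b where "x \<in> carrier E" "\<And>n. AE w in M. norm_rv (x \<ominus> xs n) w \<le> b n w"
    "AE w in M. (\<lambda>n. b n w) \<longlonglongrightarrow> 0"
proof -
  define b where "b n w = lim (\<lambda>n. c n w) - c n w" for n w
  have [measurable]: "b n \<in> borel_measurable M" for n unfolding b_def by measurable
  have "AE w in M. \<forall>n. 0 \<le> norm_rv (xs (Suc n) \<ominus> xs n) w" "AE w in M. \<forall>n. norm_rv (xs (Suc n) \<ominus> xs n) w \<le> c (Suc n) w - c n w"
    using xs step by (simp_all add: AE_all_countable norm_rv_nonneg)
  then have inc: "AE w in M. incseq (\<lambda>n. c n w)"
  proof eventually_elim
    case (elim w)
    have "c n w \<le> c (Suc n) w" for n using elim[rule_format, of n] by linarith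
    then show ?case by (rule incseq_SucI)
  qed
  have lim: "AE w in M. (\<lambda>n. c n w) \<longlonglongrightarrow> lim (\<lambda>n. c n w)"
    using inc bdd
  proof eventually_elim
    case (elim w)
    then have "convergent (\<lambda>n. c n w)"
      using LIMSEQ_incseq_SUP convergent_def by blast
    then show ?case by (simp add: convergent_LIMSEQ_iff)
  qed
  have b0: "AE w in M. (\<lambda>n. b n w) \<longlonglongrightarrow> 0"
    using lim
  proof eventually_elim
    case (elim w)
    have "(\<lambda>n. lim (\<lambda>n. c n w) - c n w) \<longlonglongrightarrow> lim (\<lambda>n. c n w) - lim (\<lambda>n. c n w)"
      by (intro tendsto_intros elim)
    then show ?case by (simp add: b_def)
  qed
  have tel: "AE w in M. norm_rv (xs (n + j) \<ominus> xs n) w \<le> c (n + j) w - c n w" for n j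
  proof (induction j)
    case 0
    have "xs n \<ominus> xs n = \<zero>" using xs by (simp add: M.minus_eq M.r_neg)
    then show ?case using norm_rv_zero by (auto elim!: eventually_mono)
  next
    case (Suc j)
    from Suc.IH step[of "n + j"] norm_rv_diff_add[OF xs xs xs, of "Suc (n + j)" n "n + j"] show ?case
      unfolding add_Suc_right by eventually_elim simp
  qed
  have tail: "AE w in M. \<forall>n m. n \<le> m \<longrightarrow> norm_rv (xs m \<ominus> xs n) w \<le> b n w"
  proof -
    have "AE w in M. \<forall>n j. norm_rv (xs (n + j) \<ominus> xs n) w \<le> c (n + j) w - c n w"
      using tel by (simp add: AE_all_countable)
    with inc lim show ?thesis
    proof eventually_elim
      case (elim w)
      have "norm_rv (xs m \<ominus> xs n) w \<le> b n w" if "n \<le> m" for m n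
      proof -
        have "c m w \<le> lim (\<lambda>n. c n w)" using elim(1,2) by (rule incseq_le)
        moreover have "norm_rv (xs m \<ominus> xs n) w \<le> c m w - c n w" using elim(3)[rule_format, of n "m - n"] that by simp
        ultimately show ?thesis by (simp add: b_def)
      qed
      then show ?case by blast
    qed
  qed
  \<comment> \<open>first index at which the tail bound is at most \<open>e\<close>; it exists almost everywhere\<close>
  define Nn where "Nn e w = (LEAST n. b n w \<le> L0_rv e w)" for e w
  have Nm: "Nn e \<in> measurable M (count_space UNIV)" if "e \<in> L0_pos M" for e
  proof -
    note [measurable] = L0_rv_measurable[OF L0_posD[OF that]]
    show ?thesis unfolding Nn_def by measurable
  qed
  have "\<forall>e\<in>L0_pos M. \<exists>x. x \<in> carrier E \<and> (AE w in M. norm_rv (x \<ominus> xs (Nn e w)) w = 0)"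
    using concatenation_exists[of xs, OF xs Nm] by blast
  from bchoice[OF this] obtain X where X: "\<And>e. e \<in> L0_pos M \<Longrightarrow> X e \<in> carrier E"
    "\<And>e. e \<in> L0_pos M \<Longrightarrow> AE w in M. norm_rv (X e \<ominus> xs (Nn e w)) w = 0" by blast
  \<comment> \<open>the random index may lie before or after \<open>n\<close>; the error is then at most \<open>e\<close> or \<open>b n\<close>\<close>
  have close: "AE w in M. norm_rv (X e \<ominus> xs n) w \<le> b n w + L0_rv e w" if e: "e \<in> L0_pos M" for e n
  proof -
    have "AE w in M. \<forall>k. norm_rv (X e \<ominus> xs n) w \<le> norm_rv (X e \<ominus> xs k) w + norm_rv (xs k \<ominus> xs n) w"
      using norm_rv_diff_add[OF X(1)[OF e] xs xs] by (simp add: AE_all_countable)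
    moreover have "AE w in M. 0 < L0_rv e w" using e by (simp add: L0_pos_iff)
    moreover have "AE w in M. \<forall>n. 0 \<le> norm_rv (xs n \<ominus> xs n) w"
      using norm_rv_nonneg xs by (simp add: AE_all_countable)
    ultimately show ?thesis
      using tail X(2)[OF e] b0
    proof eventually_elim
      case (elim w)
      have "\<exists>m. b m w \<le> L0_rv e w"
        using order_tendstoD(2)[OF elim(6), of "L0_rv e w"] elim(2)
        by (auto simp: eventually_sequentially intro: less_imp_le)
      then have Ne: "b (Nn e w) w \<le> L0_rv e w" unfolding Nn_def by (rule LeastI_ex)
      have b_nonneg: "0 \<le> b m w" for m
        using elim(3)[rule_format, of m] elim(4)[rule_format, of m m] by simp
      show ?case
      proof (cases "n \<le> Nn e w")
        case True
        then show ?thesis using elim(1)[rule_format, of "Nn e w"] elim(4,5,2) by fastforce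
      next
        case False
        then have "norm_rv (xs n \<ominus> xs (Nn e w)) w \<le> b (Nn e w) w" using elim(4) by simp
        then show ?thesis
          using elim(1)[rule_format, of "Nn e w"] elim(5) Ne b_nonneg[of n] norm_rv_minus_sym[OF xs xs, of n "Nn e w"]
          by simp
      qed
    qed
  qed
  have X_dist: "AE w in M. norm_rv (X d \<ominus> X e) w \<le> L0_rv d w + L0_rv e w"
    if d: "d \<in> L0_pos M" and e: "e \<in> L0_pos M" for d e
  proof -
    have "AE w in M. \<forall>n. norm_rv (X d \<ominus> X e) w \<le> norm_rv (X d \<ominus> xs n) w + norm_rv (xs n \<ominus> X e) w"
      using norm_rv_diff_add[OF X(1)[OF d] xs X(1)[OF e]] by (simp add: AE_all_countable)
    moreover have "AE w in M. \<forall>n. norm_rv (X d \<ominus> xs n) w \<le> b n w + L0_rv d w"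
      "AE w in M. \<forall>n. norm_rv (X e \<ominus> xs n) w \<le> b n w + L0_rv e w"
      using close d e by (simp_all add: AE_all_countable)
    ultimately show ?thesis
      using b0
    proof eventually_elim
      case (elim w)
      have "(\<lambda>n. b n w + L0_rv d w + (b n w + L0_rv e w)) \<longlonglongrightarrow> 0 + L0_rv d w + (0 + L0_rv e w)"
        by (intro tendsto_intros elim)
      moreover have "norm_rv (X d \<ominus> X e) w \<le> b n w + L0_rv d w + (b n w + L0_rv e w)" for n
        using elim(1-3)[rule_format, of n] norm_rv_minus_sym[OF xs X(1)[OF e], of n] by simp
      ultimately show ?case using LIMSEQ_le_const by fastforce
    qed
  qed
  have Xpi: "X \<in> L0_pos M \<rightarrow> carrier E" using X(1) by blast
  have "directed_set (L0_pos M) (\<lambda>a b. L0_le M b a)"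
    unfolding directed_set_def
    using L0_one_pos[of M] L0_pos_min[of _ M] L0_le_trans[of M] L0_le_refl[of M] by (intro conjI) (fast | simp)+
  moreover have "L0_Cauchy_net M E nrm (L0_pos M) (\<lambda>a b. L0_le M b a) X"
    unfolding L0_Cauchy_net_def
  proof (intro conjI Xpi ballI)
    fix \<epsilon> assume "\<epsilon> \<in> L0_pos M"
    then obtain \<theta> where \<theta>: "\<theta> \<in> L0_pos M" "\<theta> \<oplus>\<^bsub>L0 M\<^esub> \<theta> = \<epsilon>" using L0_pos_half by blast
    have "L0_le M (nrm (X \<alpha> \<ominus> X \<beta>)) \<epsilon>"
      if "\<alpha> \<in> L0_pos M" "\<beta> \<in> L0_pos M" "L0_le M \<alpha> \<theta>" "L0_le M \<beta> \<theta>" for \<alpha> \<beta>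
      using X_dist[OF that(1,2)] that(3,4) L0_rv_add[OF \<theta>(1)[THEN L0_posD] \<theta>(1)[THEN L0_posD]]
      unfolding L0_le_def \<theta>(2) by eventually_elim simp
    then show "\<exists>\<gamma>\<in>L0_pos M. \<forall>\<alpha>\<in>L0_pos M. \<forall>\<beta>\<in>L0_pos M. L0_le M \<alpha> \<gamma> \<longrightarrow> L0_le M \<beta> \<gamma> \<longrightarrow>
        L0_le M (nrm (X \<alpha> \<ominus> X \<beta>)) \<epsilon>"
      using \<theta>(1) by blast
  qed
  ultimately obtain l where l: "l \<in> carrier E"
    and net: "net_converges (L0_seminorm_topology M E {nrm}) (L0_pos M) (\<lambda>a b. L0_le M b a) X l"
    using compl unfolding L0_complete_def by blast
  have conv: "\<forall>\<epsilon>\<in>L0_pos M. \<exists>\<gamma>\<in>L0_pos M. \<forall>\<alpha>\<in>L0_pos M. L0_le M \<alpha> \<gamma> \<longrightarrow>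
      L0_le M (nrm (X \<alpha> \<ominus> l)) \<epsilon>"
    by (rule iffD1[OF net_converges_norm_iff[OF nm Xpi l] net])
  have "AE w in M. norm_rv (l \<ominus> xs n) w \<le> b n w" for n
  proof (rule AE_le_if_le_add_inverse_Suc[where h = "\<lambda>_. 2"])
    fix j
    let ?e = "L0_class M (\<lambda>_. 1 / real (Suc j))"
    have e: "?e \<in> L0_pos M" by (intro L0_class_pos) auto
    obtain \<gamma> where \<gamma>: "\<gamma> \<in> L0_pos M"
      "\<And>\<alpha>. \<alpha> \<in> L0_pos M \<Longrightarrow> L0_le M \<alpha> \<gamma> \<Longrightarrow> L0_le M (nrm (X \<alpha> \<ominus> l)) ?e"
      using bspec[OF conv e] by blast
    obtain \<alpha> where \<alpha>: "\<alpha> \<in> L0_pos M" "L0_le M \<alpha> \<gamma>" "L0_le M \<alpha> ?e" using L0_pos_min[OF \<gamma>(1) e] by blast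
    have "AE w in M. L0_rv ?e w = 1 / real (Suc j)" by (intro L0_rv_class) simp
    with \<gamma>(2)[OF \<alpha>(1,2)] \<alpha>(3) close[OF \<alpha>(1), of n] norm_rv_diff_add[OF l X(1)[OF \<alpha>(1)] xs, of n]
    show "AE w in M. norm_rv (l \<ominus> xs n) w \<le> b n w + 2 / real (Suc j)"
      unfolding L0_le_def norm_rv_minus_sym[OF X(1)[OF \<alpha>(1)] l] by eventually_elim simp
  qed
  with l show ?thesis using that b0 by blast
qed

end

section \<open>The weak-star topology\<close>

context L0_normed
begin

text \<open>All linear operations on functionals, with coefficients in \<open>L0\<close>, are instances of this one, which
  is evaluated pointwise on representatives.\<close>

definition comb :: "('w \<Rightarrow> real) \<Rightarrow> ('e \<Rightarrow> 'w L0) \<Rightarrow> ('w \<Rightarrow> real) \<Rightarrow> ('e \<Rightarrow> 'w L0) \<Rightarrow> 'e \<Rightarrow> 'w L0" where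
  "comb f z g z' = (\<lambda>x\<in>carrier E. L0_class M (\<lambda>w. f w * L0_rv (z x) w + g w * L0_rv (z' x) w))"

lemma comb_rv:
  assumes "L0_linear M E z" "L0_linear M E z'" "f \<in> borel_measurable M" "g \<in> borel_measurable M" "x \<in> carrier E"
  shows "AE w in M. L0_rv (comb f z g z' x) w = f w * L0_rv (z x) w + g w * L0_rv (z' x) w"
proof -
  note [measurable] = assms(3,4) linear_measurable[OF assms(1,5)] linear_measurable[OF assms(2,5)]
  show ?thesis using assms(5) by (simp add: comb_def L0_rv_class)
qed

lemma linear_comb:
  assumes z: "L0_linear M E z" and z': "L0_linear M E z'"
    and [measurable]: "f \<in> borel_measurable M" "g \<in> borel_measurable M"
  shows "L0_linear M E (comb f z g z')"
proof -
  note rv = comb_rv[OF z z' assms(3,4)]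
  have c: "comb f z g z' x \<in> carrier (L0 M)" if "x \<in> carrier E" for x
  proof -
    note [measurable] = linear_measurable[OF z that] linear_measurable[OF z' that]
    show ?thesis using that by (simp add: comb_def)
  qed
  have "comb f z g z' (x \<oplus> y) = comb f z g z' x \<oplus>\<^bsub>L0 M\<^esub> comb f z g z' y"
    if x: "x \<in> carrier E" and y: "y \<in> carrier E" for x y
  proof (rule L0_eqI[OF c L0_add_closed[OF c[OF x] c[OF y]]])
    show "AE w in M. L0_rv (comb f z g z' (x \<oplus> y)) w = L0_rv (comb f z g z' x \<oplus>\<^bsub>L0 M\<^esub> comb f z g z' y) w"
      using rv[OF M.a_closed[OF x y]] rv[OF x] rv[OF y] linear_add[OF z x y] linear_add[OF z' x y]
        L0_rv_add[OF c[OF x] c[OF y]]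
      by eventually_elim (simp add: algebra_simps)
  qed (use x y in simp)
  moreover have "comb f z g z' (\<eta> \<odot> x) = \<eta> \<otimes>\<^bsub>L0 M\<^esub> comb f z g z' x"
    if \<eta>: "\<eta> \<in> carrier (L0 M)" and x: "x \<in> carrier E" for \<eta> x
  proof (rule L0_eqI[OF c L0_mult_closed[OF \<eta> c[OF x]]])
    note m = L0_rv_measurable[OF \<eta>]
    show "AE w in M. L0_rv (comb f z g z' (\<eta> \<odot> x)) w = L0_rv (\<eta> \<otimes>\<^bsub>L0 M\<^esub> comb f z g z' x) w"
      using rv[OF smult_closed[OF \<eta> x]] rv[OF x] linear_scale[OF z m x] linear_scale[OF z' m x]
        L0_rv_mult[OF \<eta> c[OF x]]
      unfolding L0_class_rv[OF \<eta>] by eventually_elim (simp add: algebra_simps)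
  qed (use \<eta> x in simp)
  ultimately show ?thesis using c by (auto simp: L0_linear_def)
qed

lemma bounded_by_comb:
  assumes "L0_linear M E z" "L0_linear M E z'" "f \<in> borel_measurable M" "g \<in> borel_measurable M"
    and "bounded_by R z" "bounded_by S z'"
  shows "bounded_by (\<lambda>w. \<bar>f w\<bar> * R w + \<bar>g w\<bar> * S w) (comb f z g z')"
  unfolding bounded_by_def
proof
  fix x assume x: "x \<in> carrier E"
  have "AE w in M. \<bar>L0_rv (z x) w\<bar> \<le> R w * norm_rv x w" "AE w in M. \<bar>L0_rv (z' x) w\<bar> \<le> S w * norm_rv x w"
    using assms(5,6) x by (simp_all add: bounded_by_def)
  with comb_rv[OF assms(1-4) x]
  show "AE w in M. \<bar>L0_rv (comb f z g z' x) w\<bar> \<le> (\<bar>f w\<bar> * R w + \<bar>g w\<bar> * S w) * norm_rv x w"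
  proof eventually_elim
    case (elim w)
    have "\<bar>f w * L0_rv (z x) w + g w * L0_rv (z' x) w\<bar> \<le> \<bar>f w\<bar> * \<bar>L0_rv (z x) w\<bar> + \<bar>g w\<bar> * \<bar>L0_rv (z' x) w\<bar>"
      using abs_triangle_ineq[of "f w * L0_rv (z x) w" "g w * L0_rv (z' x) w"] by (simp add: abs_mult)
    also have "\<dots> \<le> \<bar>f w\<bar> * (R w * norm_rv x w) + \<bar>g w\<bar> * (S w * norm_rv x w)"
      using elim by (intro add_mono mult_left_mono) auto
    finally show ?case using elim by (simp add: algebra_simps)
  qed
qed

lemma comb_in_dual:
  assumes "z \<in> carrier dual" "z' \<in> carrier dual"
    and [measurable]: "f \<in> borel_measurable M" "g \<in> borel_measurable M"
  shows "comb f z g z' \<in> carrier dual"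
proof -
  note lin = assms(1,2)[THEN dualD(1)]
  obtain R where [measurable]: "R \<in> borel_measurable M" and R: "bounded_by R z"
    using dual_bound[OF assms(1)] by blast
  obtain S where [measurable]: "S \<in> borel_measurable M" and S: "bounded_by S z'"
    using dual_bound[OF assms(2)] by blast
  have "(\<lambda>w. \<bar>f w\<bar> * R w + \<bar>g w\<bar> * S w) \<in> borel_measurable M" by measurable
  moreover have "comb f z g z' \<in> extensional (carrier E)" by (simp add: comb_def)
  ultimately show ?thesis
    using linear_comb[OF lin assms(3,4)] bounded_by_comb[OF lin assms(3,4) R S]
    by (auto simp: dual_carrier_iff)
qed

lemma dual_eqI:
  assumes "z \<in> carrier dual" "z' \<in> carrier dual"
    and "\<And>x. x \<in> carrier E \<Longrightarrow> AE w in M. L0_rv (z x) w = L0_rv (z' x) w"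
  shows "z = z'"
  using assms by (intro extensionalityI[of _ "carrier E"] L0_eqI[of _ M] linear_closed) (auto simp: dual_carrier_iff)

lemma dual_add_eq_comb:
  assumes "z \<in> carrier dual" "z' \<in> carrier dual"
  shows "z \<oplus>\<^bsub>dual\<^esub> z' = comb (\<lambda>_. 1) z (\<lambda>_. 1) z'"
proof -
  have "z x \<oplus>\<^bsub>L0 M\<^esub> z' x = comb (\<lambda>_. 1) z (\<lambda>_. 1) z' x" if x: "x \<in> carrier E" for x
  proof (rule L0_eqI)
    note c = linear_closed[OF dualD(1)[OF assms(1)] x] linear_closed[OF dualD(1)[OF assms(2)] x]
    show "z x \<oplus>\<^bsub>L0 M\<^esub> z' x \<in> carrier (L0 M)" using c by simp
    show "comb (\<lambda>_. 1) z (\<lambda>_. 1) z' x \<in> carrier (L0 M)"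
      using linear_closed[OF dualD(1)[OF comb_in_dual] x] assms by simp
    show "AE w in M. L0_rv (z x \<oplus>\<^bsub>L0 M\<^esub> z' x) w = L0_rv (comb (\<lambda>_. 1) z (\<lambda>_. 1) z' x) w"
      using L0_rv_add[OF c] comb_rv[OF assms[THEN dualD(1)] _ _ x, of "\<lambda>_. 1" "\<lambda>_. 1", simplified]
      by eventually_elim simp
  qed
  then show ?thesis by (auto simp: L0_dual_def comb_def intro!: restrict_ext)
qed

lemma convex_comb:
  assumes K: "K \<subseteq> carrier dual" and conv: "L0_convex M dual K" and k: "k \<in> K" "k' \<in> K"
    and [measurable]: "s \<in> borel_measurable M" and s: "AE w in M. 0 \<le> s w \<and> s w \<le> 1"
  shows "comb s k (\<lambda>w. 1 - s w) k' \<in> K"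
proof -
  let ?s = "L0_class M s" and ?t = "\<one>\<^bsub>L0 M\<^esub> \<ominus>\<^bsub>L0 M\<^esub> L0_class M s"
  have rs: "AE w in M. L0_rv ?s w = s w" by (rule L0_rv_class) measurable
  have sc: "?s \<in> carrier (L0 M)" and tc: "?t \<in> carrier (L0 M)" by (simp_all add: L0_closed)
  have rt: "AE w in M. L0_rv ?t w = 1 - s w"
    using L0_rv_diff[OF L0_one_closed sc] rs L0_rv_one by eventually_elim simp
  have "L0_le M \<zero>\<^bsub>L0 M\<^esub> ?s" "L0_le M ?s \<one>\<^bsub>L0 M\<^esub>"
    unfolding L0_le_def using rs s L0_rv_zero[of M] L0_rv_one[of M] by (eventually_elim, simp)+
  then have "?s \<odot>\<^bsub>dual\<^esub> k \<oplus>\<^bsub>dual\<^esub> ?t \<odot>\<^bsub>dual\<^esub> k' \<in> K"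
    using conv k sc unfolding L0_convex_def by blast
  moreover have "?s \<odot>\<^bsub>dual\<^esub> k \<oplus>\<^bsub>dual\<^esub> ?t \<odot>\<^bsub>dual\<^esub> k' = comb s k (\<lambda>w. 1 - s w) k'"
  proof -
    have kd: "k \<in> carrier dual" "k' \<in> carrier dual" using K k by auto
    have "?s \<otimes>\<^bsub>L0 M\<^esub> k x \<oplus>\<^bsub>L0 M\<^esub> ?t \<otimes>\<^bsub>L0 M\<^esub> k' x = comb s k (\<lambda>w. 1 - s w) k' x" if x: "x \<in> carrier E" for x
    proof (rule L0_eqI)
      note c = linear_closed[OF dualD(1)[OF kd(1)] x] linear_closed[OF dualD(1)[OF kd(2)] x]
      note m = L0_mult_closed[OF sc c(1)] L0_mult_closed[OF tc c(2)]
      show "?s \<otimes>\<^bsub>L0 M\<^esub> k x \<oplus>\<^bsub>L0 M\<^esub> ?t \<otimes>\<^bsub>L0 M\<^esub> k' x \<in> carrier (L0 M)" by (intro L0_add_closed m)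
      show "comb s k (\<lambda>w. 1 - s w) k' x \<in> carrier (L0 M)"
        using linear_closed[OF dualD(1)[OF comb_in_dual[OF kd]] x] by simp
      have "AE w in M. L0_rv (comb s k (\<lambda>w. 1 - s w) k' x) w = s w * L0_rv (k x) w + (1 - s w) * L0_rv (k' x) w"
        by (rule comb_rv[OF kd[THEN dualD(1)] _ _ x]) measurable
      with L0_rv_add[OF m] L0_rv_mult[OF sc c(1)] L0_rv_mult[OF tc c(2)] rs rt
      show "AE w in M. L0_rv (?s \<otimes>\<^bsub>L0 M\<^esub> k x \<oplus>\<^bsub>L0 M\<^esub> ?t \<otimes>\<^bsub>L0 M\<^esub> k' x) w = L0_rv (comb s k (\<lambda>w. 1 - s w) k' x) w"
        by eventually_elim simp
    qed
    then show ?thesis by (auto simp: L0_dual_def comb_def intro!: restrict_ext)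
  qed
  ultimately show ?thesis by simp
qed

lemma openin_weak_star:
  "openin weak_star U \<longleftrightarrow> U \<subseteq> carrier dual \<and>
     (\<forall>z\<in>U. \<exists>F e. finite F \<and> F \<subseteq> carrier E \<and> e \<in> borel_measurable M \<and> (AE w in M. 0 < e w) \<and>
       (\<forall>z'\<in>carrier dual. (\<forall>x\<in>F. AE w in M. \<bar>L0_rv (z' x) w - L0_rv (z x) w\<bar> \<le> e w) \<longrightarrow> z' \<in> U))"
proof -
  have cl: "p x \<in> carrier (L0 M)" if "p \<in> (\<lambda>x z. L0_abs M (z x)) ` carrier E" "x \<in> carrier dual" for p x
    using that by (auto intro!: L0_abs_closed linear_closed dualD(1))
  have open_iff: "openin weak_star U \<longleftrightarrow> U \<subseteq> carrier dual \<and>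
     (\<forall>z\<in>U. \<exists>F \<epsilon>. finite F \<and> F \<subseteq> (\<lambda>x z. L0_abs M (z x)) ` carrier E \<and> \<epsilon> \<in> L0_pos M \<and>
        (\<forall>y\<in>carrier dual. (\<forall>p\<in>F. L0_le M (p y) \<epsilon>) \<longrightarrow> z \<oplus>\<^bsub>dual\<^esub> y \<in> U))"
    unfolding L0_weak_star_def by (rule openin_L0_seminorm_topology) (rule cl)
  have "(\<exists>F \<epsilon>. finite F \<and> F \<subseteq> (\<lambda>x z. L0_abs M (z x)) ` carrier E \<and> \<epsilon> \<in> L0_pos M \<and>
        (\<forall>y\<in>carrier dual. (\<forall>p\<in>F. L0_le M (p y) \<epsilon>) \<longrightarrow> z \<oplus>\<^bsub>dual\<^esub> y \<in> U)) \<longleftrightarrow>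
     (\<exists>F e. finite F \<and> F \<subseteq> carrier E \<and> e \<in> borel_measurable M \<and> (AE w in M. 0 < e w) \<and>
       (\<forall>z'\<in>carrier dual. (\<forall>x\<in>F. AE w in M. \<bar>L0_rv (z' x) w - L0_rv (z x) w\<bar> \<le> e w) \<longrightarrow> z' \<in> U))"
    (is "?L \<longleftrightarrow> ?R") if z: "z \<in> carrier dual" for z
  proof
    assume ?L
    then obtain F0 \<epsilon> where F0: "finite F0" "F0 \<subseteq> (\<lambda>x z. L0_abs M (z x)) ` carrier E" and \<epsilon>: "\<epsilon> \<in> L0_pos M"
      and U: "\<And>y. y \<in> carrier dual \<Longrightarrow> (\<forall>p\<in>F0. L0_le M (p y) \<epsilon>) \<Longrightarrow> z \<oplus>\<^bsub>dual\<^esub> y \<in> U" by blast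
    obtain F where F: "finite F" "F \<subseteq> carrier E" "F0 = (\<lambda>x z. L0_abs M (z x)) ` F"
      using finite_subset_image[OF F0] by blast
    have nbhd: "z' \<in> U" if z': "z' \<in> carrier dual"
      and le: "\<forall>x\<in>F. AE w in M. \<bar>L0_rv (z' x) w - L0_rv (z x) w\<bar> \<le> L0_rv \<epsilon> w" for z'
    proof -
      let ?y = "comb (\<lambda>_. 1) z' (\<lambda>_. -1) z"
      have y: "?y \<in> carrier dual" using z z' by (intro comb_in_dual) auto
      have rv: "AE w in M. L0_rv (?y x) w = L0_rv (z' x) w - L0_rv (z x) w" if "x \<in> carrier E" for x
        using comb_rv[OF dualD(1)[OF z'] dualD(1)[OF z] _ _ that, of "\<lambda>_. 1" "\<lambda>_. -1"] by simp
      have "L0_le M (L0_abs M (?y x)) \<epsilon>" if "x \<in> F" for x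
      proof -
        have x: "x \<in> carrier E" using F that by blast
        show ?thesis
          using rv[OF x] bspec[OF le that] L0_rv_abs[OF linear_closed[OF dualD(1)[OF y] x]]
          unfolding L0_le_def by eventually_elim simp
      qed
      then have "z \<oplus>\<^bsub>dual\<^esub> ?y \<in> U" using U[OF y] F(3) by blast
      moreover have "z \<oplus>\<^bsub>dual\<^esub> ?y = z'"
        unfolding dual_add_eq_comb[OF z y]
      proof (rule dual_eqI)
        fix x assume x: "x \<in> carrier E"
        show "AE w in M. L0_rv (comb (\<lambda>_. 1) z (\<lambda>_. 1) ?y x) w = L0_rv (z' x) w"
          using comb_rv[OF dualD(1)[OF z] dualD(1)[OF y] _ _ x, of "\<lambda>_. 1" "\<lambda>_. 1", simplified] rv[OF x]
          by eventually_elim simp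
      qed (use z z' y in \<open>auto intro: comb_in_dual\<close>)
      ultimately show ?thesis by simp
    qed
    have "AE w in M. 0 < L0_rv \<epsilon> w" using \<epsilon> by (simp add: L0_pos_iff)
    then show ?R
      using F(1,2) L0_rv_measurable[OF L0_posD[OF \<epsilon>]] nbhd
      by (intro exI[of _ F] exI[of _ "L0_rv \<epsilon>"] conjI ballI impI)
  next
    assume ?R
    then obtain F e where F: "finite F" "F \<subseteq> carrier E" and [measurable]: "e \<in> borel_measurable M"
      and e: "AE w in M. 0 < e w"
      and U: "\<And>z'. z' \<in> carrier dual \<Longrightarrow> (\<forall>x\<in>F. AE w in M. \<bar>L0_rv (z' x) w - L0_rv (z x) w\<bar> \<le> e w) \<Longrightarrow> z' \<in> U"
      by blast
    have re: "AE w in M. L0_rv (L0_class M e) w = e w" by (rule L0_rv_class) measurable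
    have "z \<oplus>\<^bsub>dual\<^esub> y \<in> U" if y: "y \<in> carrier dual"
      and le: "\<forall>p\<in>(\<lambda>x z. L0_abs M (z x)) ` F. L0_le M (p y) (L0_class M e)" for y
    proof (rule U)
      show "z \<oplus>\<^bsub>dual\<^esub> y \<in> carrier dual" unfolding dual_add_eq_comb[OF z y] using z y by (intro comb_in_dual) auto
      show "\<forall>x\<in>F. AE w in M. \<bar>L0_rv ((z \<oplus>\<^bsub>dual\<^esub> y) x) w - L0_rv (z x) w\<bar> \<le> e w"
      proof
        fix x assume xF: "x \<in> F"
        then have x: "x \<in> carrier E" using F by blast
        have "L0_le M (L0_abs M (y x)) (L0_class M e)" using bspec[OF le imageI[OF xF]] by simp
        then show "AE w in M. \<bar>L0_rv ((z \<oplus>\<^bsub>dual\<^esub> y) x) w - L0_rv (z x) w\<bar> \<le> e w"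
          unfolding dual_add_eq_comb[OF z y] L0_le_def
          using comb_rv[OF dualD(1)[OF z] dualD(1)[OF y] _ _ x, of "\<lambda>_. 1" "\<lambda>_. 1", simplified]
            L0_rv_abs[OF linear_closed[OF dualD(1)[OF y] x]] re
          by eventually_elim simp
      qed
    qed
    then show ?L
      using F L0_class_pos[OF \<open>e \<in> borel_measurable M\<close> e]
      by (intro exI[of _ "(\<lambda>x z. L0_abs M (z x)) ` F"] exI[of _ "L0_class M e"]) auto
  qed
  then show ?thesis
    unfolding open_iff by (intro conj_cong[OF refl] ball_cong[OF refl]) (drule (1) subsetD)
qed

lemma topspace_weak_star: "topspace weak_star = carrier dual"
proof -
  have "openin weak_star (carrier dual)"
    unfolding openin_weak_star by (auto intro!: exI[of _ "{}"] exI[of _ "\<lambda>_. 1"])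
  then show ?thesis
    using conjunct1[OF iffD1[OF openin_weak_star openin_topspace]] openin_subset by (intro equalityI)
qed

text \<open>Evaluations at points of \<open>E\<close> are closed under linear combinations with coefficients in \<open>L0\<close>, so
  a weak-star separation found in finitely many coordinates is given by a single point \<open>u\<close>.\<close>

lemma finite_combination_exists:
  assumes "finite F" "F \<subseteq> carrier E" "\<And>x. x \<in> F \<Longrightarrow> d x \<in> borel_measurable M"
  shows "\<exists>u\<in>carrier E. \<forall>z. L0_linear M E z \<longrightarrow> (AE w in M. L0_rv (z u) w = (\<Sum>x\<in>F. d x w * L0_rv (z x) w))"
  using assms
proof (induction F rule: finite_induct)
  case empty
  show ?case using linear_zero by (intro bexI[of _ "\<zero>"]) auto
next
  case (insert x F)
  then obtain u where u: "u \<in> carrier E"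
    "\<And>z. L0_linear M E z \<Longrightarrow> AE w in M. L0_rv (z u) w = (\<Sum>x\<in>F. d x w * L0_rv (z x) w)" by auto
  have x: "x \<in> carrier E" and d: "d x \<in> borel_measurable M" using insert.prems by auto
  show ?case
  proof (intro bexI allI impI)
    show "scale (d x) x \<oplus> u \<in> carrier E" using x d u by simp
    fix z assume z: "L0_linear M E z"
    show "AE w in M. L0_rv (z (scale (d x) x \<oplus> u)) w = (\<Sum>x\<in>insert x F. d x w * L0_rv (z x) w)"
      using linear_add[OF z scale_closed[OF d x] u(1)] linear_scale[OF z d x] u(2)[OF z] insert.hyps
      by (auto elim: eventually_elim2)
  qed
qed

lemma dual_norm_le_iff:
  assumes z: "z \<in> carrier dual" and \<epsilon>: "\<epsilon> \<in> L0_pos M"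
  shows "L0_le M (L0_dual_norm M E nrm z) \<epsilon> \<longleftrightarrow> bounded_by (L0_rv \<epsilon>) z"
proof -
  note lin = dualD(1)[OF z]
  let ?S = "{L0_abs M (z x) |x. x \<in> carrier E \<and> L0_le M (nrm x) \<one>\<^bsub>L0 M\<^esub>}"
  have le1: "AE w in M. norm_rv x w \<le> 1" if "L0_le M (nrm x) \<one>\<^bsub>L0 M\<^esub>" for x
    using that L0_rv_one[of M] unfolding L0_le_def by eventually_elim simp
  have bound: "L0_le M (L0_abs M (z x)) (L0_class M R)"
    if R: "bounded_by R z" "R \<in> borel_measurable M" "AE w in M. 0 \<le> R w" and x: "x \<in> carrier E" "L0_le M (nrm x) \<one>\<^bsub>L0 M\<^esub>" for R x
  proof -
    have "AE w in M. \<bar>L0_rv (z x) w\<bar> \<le> R w * norm_rv x w" using R x by (simp add: bounded_by_def)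
    with le1[OF x(2)] R(3) L0_rv_abs[OF linear_closed[OF lin x(1)]] L0_rv_class[OF R(2)]
    show ?thesis
      unfolding L0_le_def
    proof eventually_elim
      case (elim w)
      have "R w * norm_rv x w \<le> R w" using elim by (simp add: mult_left_le)
      then show ?case using elim by simp
    qed
  qed
  obtain R where R: "R \<in> borel_measurable M" "bounded_by R z" "\<And>w. 0 \<le> R w" using dual_bound[OF z] by metis
  have "L0_le M (nrm \<zero>) \<one>\<^bsub>L0 M\<^esub>"
    using norm_rv_zero L0_rv_one[of M] unfolding L0_le_def by eventually_elim simp
  then have zero_mem: "L0_abs M (z \<zero>) \<in> ?S" using M.zero_closed by blast
  have "\<exists>\<eta>. L0_is_lub M ?S \<eta>"
  proof (rule L0_lub_exists[OF prob_space_axioms _ zero_mem])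
    show "?S \<subseteq> carrier (L0 M)" using L0_abs_closed[OF linear_closed[OF lin]] by blast
    show "L0_class M R \<in> carrier (L0 M)" using R(1) by simp
    show "L0_le M s (L0_class M R)" if "s \<in> ?S" for s
      using that bound[OF R(2,1)] R(3) by auto
  qed
  then obtain \<eta> where "L0_is_lub M ?S \<eta>" ..
  then have lub: "L0_is_lub M ?S (L0_dual_norm M E nrm z)"
    unfolding L0_dual_norm_def using L0_esssup_eq[of M ?S \<eta>] by simp
  have epos: "AE w in M. 0 < L0_rv \<epsilon> w" using \<epsilon> by (simp add: L0_pos_iff)
  show ?thesis
  proof
    assume le: "L0_le M (L0_dual_norm M E nrm z) \<epsilon>"
    have "bounded_by (\<lambda>w. L0_rv \<epsilon> w / 1) z"
    proof (rule bounded_byI_scaling[OF lin])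
      fix y assume y: "y \<in> carrier E" "AE w in M. norm_rv y w \<le> 1"
      have "L0_le M (nrm y) \<one>\<^bsub>L0 M\<^esub>"
        unfolding L0_le_def using y(2) L0_rv_one[of M] by eventually_elim simp
      then have "L0_le M (L0_abs M (z y)) (L0_dual_norm M E nrm z)"
        using lub y(1) unfolding L0_is_lub_def by blast
      then show "AE w in M. \<bar>L0_rv (z y) w\<bar> \<le> L0_rv \<epsilon> w"
        using le L0_rv_abs[OF linear_closed[OF lin y(1)]]
        unfolding L0_le_def by eventually_elim simp
    qed auto
    then show "bounded_by (L0_rv \<epsilon>) z" by simp
  next
    assume b: "bounded_by (L0_rv \<epsilon>) z"
    have "L0_le M (L0_abs M (z x)) \<epsilon>" if "x \<in> carrier E" "L0_le M (nrm x) \<one>\<^bsub>L0 M\<^esub>" for x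
      using bound[OF b L0_rv_measurable[OF L0_posD[OF \<epsilon>]] _ that] epos
      by (simp add: L0_class_rv[OF L0_posD[OF \<epsilon>]] less_imp_le eventually_mono)
    then show "L0_le M (L0_dual_norm M E nrm z) \<epsilon>"
      using lub L0_posD[OF \<epsilon>] unfolding L0_is_lub_def by blast
  qed
qed

text \<open>A functional outside the ball violates the bound at some \<open>x\<close> on a non-null event.  The tolerance of the
  neighbourhood is half the excess there, and \<open>1\<close> elsewhere, because a tolerance has to be
  strictly positive everywhere.\<close>

lemma closedin_dual_ball:
  assumes R[measurable]: "R \<in> borel_measurable M"
  shows "closedin weak_star {z \<in> carrier dual. bounded_by R z}"
  unfolding closedin_def topspace_weak_star openin_weak_star
proof (intro conjI ballI)
  fix z assume "z \<in> carrier dual - {z \<in> carrier dual. bounded_by R z}"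
  then obtain x where z: "z \<in> carrier dual" and x: "x \<in> carrier E"
    and n: "\<not> (AE w in M. \<bar>L0_rv (z x) w\<bar> \<le> R w * norm_rv x w)"
    by (auto simp: bounded_by_def)
  note [measurable] = linear_measurable[OF dualD(1)[OF z] x] norm_rv_measurable[OF x]
  define g where "g w = \<bar>L0_rv (z x) w\<bar> - R w * norm_rv x w" for w
  define e where "e w = (if 0 < g w then g w / 2 else 1)" for w
  have [measurable]: "e \<in> borel_measurable M" unfolding e_def g_def by measurable
  have nb: "\<not> bounded_by R z'" if "AE w in M. \<bar>L0_rv (z' x) w - L0_rv (z x) w\<bar> \<le> e w" for z'
  proof
    assume "bounded_by R z'"
    then have "AE w in M. \<bar>L0_rv (z' x) w\<bar> \<le> R w * norm_rv x w" using x by (simp add: bounded_by_def)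
    with that have "AE w in M. \<bar>L0_rv (z x) w\<bar> \<le> R w * norm_rv x w"
    proof eventually_elim
      case (elim w)
      have "\<bar>L0_rv (z x) w\<bar> \<le> \<bar>L0_rv (z' x) w\<bar> + \<bar>L0_rv (z' x) w - L0_rv (z x) w\<bar>" by linarith
      with elim show ?case by (auto simp: e_def g_def not_less split: if_splits)
    qed
    with n show False ..
  qed
  show "\<exists>F e. finite F \<and> F \<subseteq> carrier E \<and> e \<in> borel_measurable M \<and> (AE w in M. 0 < e w) \<and>
       (\<forall>z'\<in>carrier dual. (\<forall>x\<in>F. AE w in M. \<bar>L0_rv (z' x) w - L0_rv (z x) w\<bar> \<le> e w) \<longrightarrow>
         z' \<in> carrier dual - {z \<in> carrier dual. bounded_by R z})"
  proof (intro exI[of _ "{x}"] exI[of _ e] conjI ballI impI)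
    show "AE w in M. 0 < e w" by (simp add: e_def)
    fix z' assume "z' \<in> carrier dual" "\<forall>x\<in>{x}. AE w in M. \<bar>L0_rv (z' x) w - L0_rv (z x) w\<bar> \<le> e w"
    with nb show "z' \<in> carrier dual - {z \<in> carrier dual. bounded_by R z}" by simp
  qed (use x in simp_all)
qed auto

end

section \<open>Closed convex sets and their support functions\<close>

context L0_stable
begin

lemma relatively_stable_concatenation:
  assumes rs: "relatively_stable M dual K"
    and ks: "\<And>n. ks n \<in> K" and N: "N \<in> measurable M (count_space (UNIV :: nat set))"
  obtains k where "k \<in> K" "\<And>x. x \<in> carrier E \<Longrightarrow> AE w in M. L0_rv (k x) w = L0_rv (ks (N w) x) w"
proof -
  note [measurable] = N
  have ksd: "\<And>n. ks n \<in> carrier dual" using rs ks unfolding relatively_stable_def by blast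
  obtain k where k: "k \<in> carrier dual" "\<And>x. x \<in> carrier E \<Longrightarrow> AE w in M. L0_rv (k x) w = L0_rv (ks (N w) x) w"
    by (rule dual_concatenation_exists[where ks = ks, OF ksd N]) (rule that)
  have "L0_ind M {w \<in> space M. N w = n} \<odot>\<^bsub>dual\<^esub> k = L0_ind M {w \<in> space M. N w = n} \<odot>\<^bsub>dual\<^esub> ks n" for n
  proof -
    let ?i = "L0_ind M {w \<in> space M. N w = n}"
    have i: "?i \<in> carrier (L0 M)" by (simp add: L0_ind_def)
    have "?i \<otimes>\<^bsub>L0 M\<^esub> k x = ?i \<otimes>\<^bsub>L0 M\<^esub> ks n x" if x: "x \<in> carrier E" for x
    proof (rule L0_eqI)
      note c = linear_closed[OF dualD(1)[OF k(1)] x] linear_closed[OF dualD(1)[OF ksd] x, of n]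
      show "?i \<otimes>\<^bsub>L0 M\<^esub> k x \<in> carrier (L0 M)" "?i \<otimes>\<^bsub>L0 M\<^esub> ks n x \<in> carrier (L0 M)"
        by (intro L0_mult_closed i c)+
      have "AE w in M. L0_rv ?i w = indicator {w \<in> space M. N w = n} w" by (intro L0_rv_ind) measurable
      with k(2)[OF x] L0_rv_mult[OF i c(1)] L0_rv_mult[OF i c(2)]
      show "AE w in M. L0_rv (?i \<otimes>\<^bsub>L0 M\<^esub> k x) w = L0_rv (?i \<otimes>\<^bsub>L0 M\<^esub> ks n x) w"
        by eventually_elim (auto simp: indicator_def)
    qed
    then show ?thesis by (auto simp: L0_dual_def intro!: restrict_ext)
  qed
  then have "is_concatenation M dual (\<lambda>n. {w \<in> space M. N w = n}) ks k"
    using k(1) by (simp add: is_concatenation_def)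
  moreover have "range ks \<subseteq> K" using ks by blast
  ultimately have "k \<in> K"
    using rs ae_partition_vimage[OF N] unfolding relatively_stable_def by blast
  then show ?thesis using k(2) by (rule that)
qed

lemma bounded_by_concatenation:
  assumes k: "\<And>x. x \<in> carrier E \<Longrightarrow> AE w in M. L0_rv (k x) w = L0_rv (ks (N w :: nat) x) w"
    and ks: "\<And>n. bounded_by (R n) (ks n)"
  shows "bounded_by (\<lambda>w. R (N w) w) k"
  unfolding bounded_by_def
proof
  fix x assume x: "x \<in> carrier E"
  have "AE w in M. \<forall>n. \<bar>L0_rv (ks n x) w\<bar> \<le> R n w * norm_rv x w"
    using ks x by (simp add: AE_all_countable bounded_by_def)
  with k[OF x] show "AE w in M. \<bar>L0_rv (k x) w\<bar> \<le> R (N w) w * norm_rv x w"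
    by eventually_elim simp
qed

text \<open>In Euclidean space a nearest point \<open>d\<close> of a convex set to the origin satisfies
  \<open>\<langle>d, d'\<rangle> \<ge> \<parallel>d\<parallel>^2\<close> for all \<open>d'\<close> in the set.  Here the nearest point is only
  approximate and is compared with one point of the segment towards \<open>d'\<close>.\<close>

lemma approximate_minimiser_angle:
  fixes d d' :: "'a \<Rightarrow> real"
  assumes s: "0 < s" and min: "(\<Sum>x\<in>F. (d x)\<^sup>2) \<le> r + s * e"
    and seg: "r \<le> (\<Sum>x\<in>F. (s * d' x + (1 - s) * d x)\<^sup>2)"
    and W: "s * (\<Sum>x\<in>F. (d' x - d x)\<^sup>2) \<le> e"
  shows "(\<Sum>x\<in>F. (d x)\<^sup>2) - e \<le> (\<Sum>x\<in>F. d x * d' x)"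
proof -
  let ?Q = "\<Sum>x\<in>F. (d x)\<^sup>2" and ?P = "\<Sum>x\<in>F. d x * d' x" and ?W = "\<Sum>x\<in>F. (d' x - d x)\<^sup>2"
  have "(s * d' x + (1 - s) * d x)\<^sup>2 = (d x)\<^sup>2 + 2 * s * (d x * d' x - (d x)\<^sup>2) + s * (s * (d' x - d x)\<^sup>2)" for x
    by (simp add: power2_eq_square algebra_simps)
  then have "(\<Sum>x\<in>F. (s * d' x + (1 - s) * d x)\<^sup>2) = ?Q + 2 * s * (?P - ?Q) + s * (s * ?W)"
    by (simp add: sum.distrib sum_distrib_left sum_subtractf right_diff_distrib)
  also have "s * (s * ?W) \<le> s * e" using s W by simp
  finally have "0 \<le> 2 * s * (?P - ?Q) + 2 * (s * e)" using min seg by linarith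
  then have "0 \<le> (2 * s) * (?P - ?Q + e)" by (simp add: algebra_simps)
  then show ?thesis using s by (simp add: zero_le_mult_iff)
qed

text \<open>If \<open>z\<close> were not in \<open>K\<close>, some weak-star neighbourhood of \<open>z\<close>, given by a finite set \<open>F\<close> and a
  tolerance \<open>e\<close>, would miss the bounded part \<open>C K\<close> of \<open>K\<close>.  As \<open>C K\<close> is stable, it has an approximate minimiser \<open>v\<close> of
  \<open>\<Sum>x\<in>F. (v x - z x)^2\<close>.  Convexity makes the point \<open>u = \<Sum>x\<in>F. (v x - z x) x\<close> separate
  \<open>z\<close> from \<open>C K\<close> with a gap that is almost this minimum.  No gap is possible, so the minimum is at
  most \<open>e^2\<close> and \<open>v\<close> lies in the neighbourhood.\<close>

lemma closed_convex_bipolar: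
  fixes R :: "'w \<Rightarrow> real"
  defines "C \<equiv> \<lambda>K. {k \<in> K. bounded_by R k}"
  assumes conv: "L0_convex M dual K" and rs: "relatively_stable M dual K"
    and Rm[measurable]: "R \<in> borel_measurable M"
    and closed: "closedin weak_star (C K)" and ne: "C K \<noteq> {}"
    and z: "z \<in> carrier dual"
    and lower: "\<And>u b. u \<in> carrier E \<Longrightarrow> b \<in> borel_measurable M \<Longrightarrow>
        (\<And>k. k \<in> C K \<Longrightarrow> AE w in M. b w \<le> L0_rv (k u) w) \<Longrightarrow> AE w in M. b w \<le> L0_rv (z u) w"
  shows "z \<in> K"
proof (rule ccontr)
  have K: "K \<subseteq> carrier dual" using rs by (simp add: relatively_stable_def)
  assume "z \<notin> K"
  then have zC: "z \<in> carrier dual - C K" using z by (simp add: C_def)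
  have "openin weak_star (carrier dual - C K)"
    using closed by (simp add: closedin_def topspace_weak_star)
  from bspec[OF conjunct2[OF iffD1[OF openin_weak_star this]] zC]
  obtain F e where F: "finite F" "F \<subseteq> carrier E" and em[measurable]: "e \<in> borel_measurable M"
    and e: "AE w in M. 0 < e w"
    and nbhd: "\<forall>z'\<in>carrier dual. (\<forall>x\<in>F. AE w in M. \<bar>L0_rv (z' x) w - L0_rv (z x) w\<bar> \<le> e w) \<longrightarrow> z' \<in> carrier dual - C K"
    by (elim exE conjE) (rule that)
  note zl = dualD(1)[OF z]
  have CK: "k \<in> carrier dual" "L0_linear M E k" "k \<in> K" "bounded_by R k" if "k \<in> C K" for k
    using that K by (auto simp: C_def intro: dualD(1))
  have meas: "L0_rv (k x) \<in> borel_measurable M" if "L0_linear M E k" "x \<in> F" for k x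
    using that F(2) by (intro linear_measurable) auto
  define Q where "Q v w = (\<Sum>x\<in>F. (L0_rv (v x) w - L0_rv (z x) w)\<^sup>2)" for v w
  have Qm: "Q v \<in> borel_measurable M" if "L0_linear M E v" for v
    unfolding Q_def using meas[OF that] meas[OF zl]
    by (intro borel_measurable_sum borel_measurable_power borel_measurable_diff) auto
  have "\<exists>\<eta>. L0_is_glb M ((\<lambda>v. L0_class M (Q v)) ` C K) \<eta>"
  proof (rule L0_glb_exists[OF prob_space_axioms _ _ L0_zero_closed])
    show "(\<lambda>v. L0_class M (Q v)) ` C K \<subseteq> carrier (L0 M)" using Qm CK(2) by auto
    fix \<xi> assume "\<xi> \<in> (\<lambda>v. L0_class M (Q v)) ` C K"
    then obtain v where v: "v \<in> C K" "\<xi> = L0_class M (Q v)" by blast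
    show "L0_le M \<zero>\<^bsub>L0 M\<^esub> \<xi>"
      unfolding L0_le_def v(2) using L0_rv_class[OF Qm[OF CK(2)[OF v(1)]]] L0_rv_zero[of M]
      by eventually_elim (simp add: Q_def sum_nonneg)
  qed (use ne in simp)
  then obtain \<eta> where \<eta>: "L0_is_glb M ((\<lambda>v. L0_class M (Q v)) ` C K) \<eta>" ..
  define r where "r = L0_rv \<eta>"
  have \<eta>c: "\<eta> \<in> carrier (L0 M)" using \<eta> by (simp add: L0_is_glb_def)
  have rm[measurable]: "r \<in> borel_measurable M" unfolding r_def by (rule L0_rv_measurable[OF \<eta>c])
  have r_le: "AE w in M. r w \<le> Q v w" if "v \<in> C K" for v
  proof -
    have "L0_le M \<eta> (L0_class M (Q v))" using \<eta> that by (auto simp: L0_is_glb_def)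
    with L0_rv_class[OF Qm[OF CK(2)[OF that]]] show ?thesis
      unfolding L0_le_def r_def by eventually_elim simp
  qed
  define W where "W w = (\<Sum>x\<in>F. (2 * R w * norm_rv x w)\<^sup>2)" for w
  have Wm[measurable]: "W \<in> borel_measurable M"
    unfolding W_def using F(2) by (intro borel_measurable_sum borel_measurable_power borel_measurable_times Rm norm_rv_measurable) auto
  have W0: "0 \<le> W w" for w by (simp add: W_def sum_nonneg)
  \<comment> \<open>\<open>W\<close> bounds the squared diameter of \<open>C K\<close> in the coordinates \<open>F\<close>; a segment parameter \<open>s\<close> with
    \<open>s * W \<le> e^2\<close> makes the quadratic error of the comparison small\<close>
  define s where "s w = (e w)\<^sup>2 / (W w + (e w)\<^sup>2)" for w
  have sm[measurable]: "s \<in> borel_measurable M" unfolding s_def by measurable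
  have s: "AE w in M. 0 < s w \<and> s w \<le> 1 \<and> s w * W w \<le> (e w)\<^sup>2"
    using e
  proof eventually_elim
    case (elim w)
    then have p: "0 < (e w)\<^sup>2" by simp
    have "(e w)\<^sup>2 * W w \<le> (e w)\<^sup>2 * (W w + (e w)\<^sup>2)" using p by (intro mult_left_mono) auto
    then show ?case using p W0[of w] by (simp add: s_def field_simps add_nonneg_pos add_pos_nonneg)
  qed
  have "\<exists>v\<in>C K. AE w in M. Q v w \<le> r w + s w * (e w)\<^sup>2"
  proof (rule stable_exhaustion[of "C K" "space M" "\<lambda>v w. Q v w \<le> r w + s w * (e w)\<^sup>2"])
    fix v assume "v \<in> C K"
    then have [measurable]: "Q v \<in> borel_measurable M" by (intro Qm CK)
    show "{w \<in> space M. Q v w \<le> r w + s w * (e w)\<^sup>2} \<in> sets M" by measurable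
  next
    fix ts :: "nat \<Rightarrow> _" and N assume ts: "range ts \<subseteq> C K" and N: "N \<in> measurable M (count_space (UNIV :: nat set))"
    have tsn: "ts n \<in> C K" for n using ts by blast
    obtain k where k: "k \<in> K" "\<And>x. x \<in> carrier E \<Longrightarrow> AE w in M. L0_rv (k x) w = L0_rv (ts (N w) x) w"
      by (rule relatively_stable_concatenation[where ks = ts, OF rs CK(3)[OF tsn] N]) (rule that)
    have "bounded_by R k" using bounded_by_concatenation[where ks = ts and N = N and R = "\<lambda>_. R", OF k(2)] CK(4)[OF tsn] by simp
    then have "k \<in> C K" using k(1) by (simp add: C_def)
    moreover have "AE w in M. \<forall>x\<in>F. L0_rv (k x) w = L0_rv (ts (N w) x) w"
      using k(2) F by (intro AE_finite_allI) auto
    then have "AE w in M. Q (ts (N w)) w \<le> r w + s w * (e w)\<^sup>2 \<longrightarrow> Q k w \<le> r w + s w * (e w)\<^sup>2"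
      by eventually_elim (simp add: Q_def)
    ultimately show "\<exists>t\<in>C K. AE w in M. Q (ts (N w)) w \<le> r w + s w * (e w)\<^sup>2 \<longrightarrow> Q t w \<le> r w + s w * (e w)\<^sup>2" by blast
  next
    fix v assume "v \<in> C K" "AE w in M. w \<in> space M \<longrightarrow> Q v w \<le> r w + s w * (e w)\<^sup>2"
    then show ?thesis using AE_space by (intro bexI[of _ v]) (auto elim: eventually_elim2)
  next
    fix B assume B: "B \<in> sets M" "0 < prob B"
      and none: "\<And>t. t \<in> C K \<Longrightarrow> AE w\<in>B in M. \<not> Q t w \<le> r w + s w * (e w)\<^sup>2"
    \<comment> \<open>on \<open>B\<close> the lower bound \<open>r\<close> could be raised, although it is the greatest\<close>
    let ?l = "\<lambda>w. r w + indicator B w * (s w * (e w)\<^sup>2)"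
    have lm: "?l \<in> borel_measurable M" using B(1) by measurable
    have "L0_le M (L0_class M ?l) \<eta>"
    proof -
      have "L0_le M (L0_class M ?l) \<xi>" if "\<xi> \<in> (\<lambda>v. L0_class M (Q v)) ` C K" for \<xi>
      proof -
        obtain v where v: "v \<in> C K" "\<xi> = L0_class M (Q v)" using \<open>\<xi> \<in> _\<close> by blast
        show ?thesis
          unfolding L0_le_def v(2) using L0_rv_class[OF lm] L0_rv_class[OF Qm[OF CK(2)[OF v(1)]]] none[OF v(1)] r_le[OF v(1)]
          by eventually_elim (auto simp: indicator_def)
      qed
      then show ?thesis using \<eta> lm by (auto simp: L0_is_glb_def)
    qed
    then have "AE w in M. w \<notin> B"
      using L0_rv_class[OF lm] s e unfolding L0_le_def
      by eventually_elim (auto simp: indicator_def r_def mult_le_0_iff split: if_splits)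
    then have "prob B = 0" using B(1) by (simp add: prob_eq_0)
    with B(2) show ?thesis by simp
  qed (use ne in auto)
  then obtain v where v: "v \<in> C K" and Qv: "AE w in M. Q v w \<le> r w + s w * (e w)\<^sup>2" by blast
  note vl = CK(2)[OF v]
  obtain u where u: "u \<in> carrier E"
    "\<And>z'. L0_linear M E z' \<Longrightarrow> AE w in M. L0_rv (z' u) w = (\<Sum>x\<in>F. (L0_rv (v x) w - L0_rv (z x) w) * L0_rv (z' x) w)"
    using finite_combination_exists[OF F, of "\<lambda>x w. L0_rv (v x) w - L0_rv (z x) w"] meas[OF vl] meas[OF zl] by auto
  have angle: "AE w in M. Q v w - (e w)\<^sup>2 + L0_rv (z u) w \<le> L0_rv (k u) w" if k: "k \<in> C K" for k
  proof -
    note kl = CK(2)[OF k]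
    let ?c = "comb s k (\<lambda>w. 1 - s w) v"
    have "?c \<in> K" using s by (intro convex_comb[OF K conv CK(3)[OF k] CK(3)[OF v]]) auto
    moreover have "bounded_by R ?c"
    proof (rule bounded_by_mono[OF bounded_by_comb[OF kl vl _ _ CK(4)[OF k] CK(4)[OF v]]])
      show "AE w in M. \<bar>s w\<bar> * R w + \<bar>1 - s w\<bar> * R w \<le> R w"
        using s by eventually_elim (simp add: algebra_simps)
    qed auto
    ultimately have "?c \<in> C K" by (simp add: C_def)
    then have 1: "AE w in M. r w \<le> Q ?c w" by (rule r_le)
    have 2: "AE w in M. \<forall>x\<in>F. L0_rv (?c x) w = s w * L0_rv (k x) w + (1 - s w) * L0_rv (v x) w"
      using F by (intro AE_finite_allI) (auto intro!: comb_rv kl vl)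
    have 3: "AE w in M. \<forall>x\<in>F. \<bar>L0_rv (k x) w\<bar> \<le> R w * norm_rv x w \<and> \<bar>L0_rv (v x) w\<bar> \<le> R w * norm_rv x w"
      using F CK(4)[OF k] CK(4)[OF v] unfolding bounded_by_def by (intro AE_finite_allI AE_conjI) auto
    show ?thesis
      using 1 2 3 s Qv u(2)[OF kl] u(2)[OF zl]
    proof eventually_elim
      case (elim w)
      let ?d = "\<lambda>x. L0_rv (v x) w - L0_rv (z x) w" and ?d' = "\<lambda>x. L0_rv (k x) w - L0_rv (z x) w"
      have "Q v w - (e w)\<^sup>2 \<le> (\<Sum>x\<in>F. ?d x * ?d' x)"
        unfolding Q_def
      proof (rule approximate_minimiser_angle)
        show "0 < s w" using elim by simp
        show "(\<Sum>x\<in>F. (?d x)\<^sup>2) \<le> r w + s w * (e w)\<^sup>2" using elim by (simp add: Q_def)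
        have "L0_rv (?c x) w - L0_rv (z x) w = s w * ?d' x + (1 - s w) * ?d x" if "x \<in> F" for x
          using elim(2) that by (simp add: algebra_simps)
        then show "r w \<le> (\<Sum>x\<in>F. (s w * ?d' x + (1 - s w) * ?d x)\<^sup>2)"
          using elim(1) by (simp add: Q_def)
        have "(?d' x - ?d x)\<^sup>2 \<le> (2 * R w * norm_rv x w)\<^sup>2" if "x \<in> F" for x
        proof -
          have "\<bar>?d' x - ?d x\<bar> \<le> 2 * R w * norm_rv x w"
            using bspec[OF elim(3) that] unfolding mult.assoc by linarith
          then show ?thesis by (simp add: abs_le_square_iff[symmetric])
        qed
        then have "(\<Sum>x\<in>F. (?d' x - ?d x)\<^sup>2) \<le> W w" unfolding W_def by (intro sum_mono)
        then have "s w * (\<Sum>x\<in>F. (?d' x - ?d x)\<^sup>2) \<le> s w * W w" using elim(4) by (intro mult_left_mono) auto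
        also have "\<dots> \<le> (e w)\<^sup>2" using elim(4) by simp
        finally show "s w * (\<Sum>x\<in>F. (?d' x - ?d x)\<^sup>2) \<le> (e w)\<^sup>2" .
      qed
      also have "\<dots> = L0_rv (k u) w - L0_rv (z u) w"
        using elim(6,7) by (simp add: right_diff_distrib sum_subtractf)
      finally show ?case by simp
    qed
  qed
  have "AE w in M. Q v w - (e w)\<^sup>2 + L0_rv (z u) w \<le> L0_rv (z u) w"
    using Qm[OF vl] linear_measurable[OF zl u(1)] angle by (intro lower[OF u(1)]) auto
  then have "AE w in M. \<forall>x\<in>F. \<bar>L0_rv (v x) w - L0_rv (z x) w\<bar> \<le> e w"
    using e
  proof eventually_elim
    case (elim w)
    have "\<bar>L0_rv (v x) w - L0_rv (z x) w\<bar> \<le> e w" if "x \<in> F" for x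
    proof -
      have "(L0_rv (v x) w - L0_rv (z x) w)\<^sup>2 \<le> Q v w"
        unfolding Q_def using that F(1) by (intro member_le_sum) auto
      also have "\<dots> \<le> (e w)\<^sup>2" using elim by simp
      finally show ?thesis using elim abs_le_square_iff[of "L0_rv (v x) w - L0_rv (z x) w" "e w"] by simp
    qed
    then show ?case by blast
  qed
  then have "\<forall>x\<in>F. AE w in M. \<bar>L0_rv (v x) w - L0_rv (z x) w\<bar> \<le> e w"
    by (auto elim: eventually_mono)
  then have "v \<in> carrier dual - C K" by (rule mp[OF bspec[OF nbhd CK(1)[OF v]]])
  with v show False by blast
qed

section \<open>Separation\<close>

lemma sublinear_Lipschitz:
  assumes f: "L0_sublinear M E f"
    and bound: "\<And>x. x \<in> carrier E \<Longrightarrow> AE w in M. L0_rv (f x) w \<le> R w * norm_rv x w"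
    and x: "x \<in> carrier E" and y: "y \<in> carrier E"
  shows "AE w in M. \<bar>L0_rv (f x) w - L0_rv (f y) w\<bar> \<le> R w * norm_rv (x \<ominus> y) w"
proof -
  have e: "(x \<ominus> y) \<oplus> y = x" "(y \<ominus> x) \<oplus> x = y"
    using x y by (simp_all add: M.minus_eq M.a_assoc M.l_neg)
  show ?thesis
    using sublinear_add[OF f M.minus_closed[OF x y] y] sublinear_add[OF f M.minus_closed[OF y x] x]
      bound[OF M.minus_closed[OF x y]] bound[OF M.minus_closed[OF y x]]
    unfolding e norm_rv_minus_sym[OF y x]
    by eventually_elim linarith
qed

lemma scale_diff_left:
  assumes "f \<in> borel_measurable M" "g \<in> borel_measurable M" "x \<in> carrier E"
  shows "scale f x \<ominus> scale g x = scale (\<lambda>w. f w - g w) x"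
proof -
  have eq: "scale f x = scale (\<lambda>w. f w - g w) x \<oplus> scale g x"
    using smult_class_add[of "\<lambda>w. f w - g w" g x] assms by simp
  have "scale (\<lambda>w. f w - g w) x \<in> carrier E" "scale g x \<in> carrier E"
    using assms by (auto intro!: scale_closed)
  then show ?thesis
    unfolding eq by (simp only: M.minus_eq M.a_assoc M.r_neg M.r_zero M.a_inv_closed)
qed

text \<open>The functionals that are bounded by \<open>c\<close> and have a value of at most \<open>a\<close> at \<open>x\<close> have the
  support function \<open>u \<mapsto> inf {c \<parallel>u - s x\<parallel> + s a | s \<ge> 0}\<close>, and \<open>g\<close> collects the values
  whose infimum over \<open>v\<close> and \<open>s\<close> is its inf-convolution with \<open>f\<close>.  Exhaustion distinguishes two cases.
  If \<open>g\<close> takes negative values at \<open>0\<close> all over \<open>A\<close>, a single pair \<open>v\<close>, \<open>s\<close> achieves this.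
  Otherwise \<open>g\<close> is nonnegative at \<open>0\<close> on an event \<open>B\<close> for all pairs.  Then the
  inf-convolution is finite on \<open>B\<close>, and by the Hahn-Banach theorem a linear functional lies
  below it and therefore below both support functions.\<close>

lemma separation_alternative:
  assumes f: "L0_sublinear M E f"
    and f_le: "\<And>x. x \<in> carrier E \<Longrightarrow> AE w in M. L0_rv (f x) w \<le> R w * norm_rv x w"
    and z1: "L0_linear M E z1" and z1_le: "\<And>x. x \<in> carrier E \<Longrightarrow> AE w in M. L0_rv (z1 x) w \<le> L0_rv (f x) w"
    and cm[measurable]: "c \<in> borel_measurable M" and c0: "AE w in M. 0 \<le> c w"
    and x: "x \<in> carrier E" and am[measurable]: "a \<in> borel_measurable M"
    and A: "A \<in> sets M"
  obtains (separated) v s where "v \<in> carrier E" "s \<in> borel_measurable M" "\<And>w. 0 \<le> s w"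
      "AE w\<in>A in M. L0_rv (f (\<ominus> (v \<oplus> scale s x))) w + c w * norm_rv v w + s w * a w < 0"
    | (common) B z where "B \<in> sets M" "B \<subseteq> A" "0 < prob B" "L0_linear M E z" "z \<in> extensional (carrier E)"
      "\<And>u. u \<in> carrier E \<Longrightarrow> AE w in M. L0_rv (z u) w \<le> L0_rv (f u) w"
      "\<And>u. u \<in> carrier E \<Longrightarrow> AE w\<in>B in M. L0_rv (z u) w \<le> c w * norm_rv u w"
      "AE w\<in>B in M. L0_rv (z x) w \<le> a w"
      "\<And>u. u \<in> carrier E \<Longrightarrow> AE w in M. w \<notin> B \<longrightarrow> L0_rv (z u) w = L0_rv (z1 u) w"
proof -
  let ?pt = "\<lambda>v s. v \<oplus> scale s x"
  define g where "g v s u w = L0_rv (f (u \<ominus> ?pt v s)) w + c w * norm_rv v w + s w * a w" for v s u w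
  define T where "T = {(v, s :: 'w \<Rightarrow> real). v \<in> carrier E \<and> s \<in> borel_measurable M \<and> (\<forall>w. 0 \<le> s w)}"
  have fc: "f u \<in> carrier (L0 M)" if "u \<in> carrier E" for u by (rule sublinear_closed[OF f that])
  have gm: "g v s u \<in> borel_measurable M"
    if "v \<in> carrier E" "s \<in> borel_measurable M" "u \<in> carrier E" for v s u
  proof -
    note [measurable] = that(2) norm_rv_measurable[OF that(1)]
    have [measurable]: "L0_rv (f (u \<ominus> ?pt v s)) \<in> borel_measurable M"
      using that x by (intro L0_rv_measurable fc) simp
    show ?thesis unfolding g_def by measurable
  qed
  have zero_T: "(\<zero>, \<lambda>_. 0) \<in> T" by (simp add: T_def)
  show thesis
  proof (rule stable_exhaustion[where T = T and A = A and \<Phi> = "\<lambda>t w. g (fst t) (snd t) \<zero> w < 0"])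
    show "T \<noteq> {}" using zero_T by blast
    show "A \<in> sets M" by fact
    fix t assume "t \<in> T"
    then have [measurable]: "g (fst t) (snd t) \<zero> \<in> borel_measurable M" by (intro gm) (auto simp: T_def)
    show "{w \<in> space M. g (fst t) (snd t) \<zero> w < 0} \<in> sets M" by measurable
  next
    fix ts :: "nat \<Rightarrow> 'e \<times> ('w \<Rightarrow> real)" and N :: "'w \<Rightarrow> nat" assume ts: "range ts \<subseteq> T" and N: "N \<in> measurable M (count_space UNIV)"
    define vs ss where "vs n = fst (ts n)" and "ss n = snd (ts n)" for n
    have tsT: "ts n \<in> T" for n using ts by blast
    have vs: "vs n \<in> carrier E" and ss: "ss n \<in> borel_measurable M" and ss0: "0 \<le> ss n w" for n w
      using tsT[of n] by (auto simp: T_def vs_def ss_def)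
    obtain v where v: "v \<in> carrier E" "AE w in M. norm_rv (v \<ominus> vs (N w)) w = 0"
      by (rule concatenation_exists[where xs = vs, OF vs N])
    define s where "s w = ss (N w) w" for w
    have s: "s \<in> borel_measurable M" unfolding s_def by (rule measurable_compose_countable[OF ss N])
    have cl: "scale s x \<in> carrier E" "scale (ss n) x \<in> carrier E" for n
      using x s ss by (auto intro: scale_closed)
    have near: "AE w in M. norm_rv ((\<zero> \<ominus> ?pt v s) \<ominus> (\<zero> \<ominus> ?pt (vs n) (ss n))) w
        \<le> norm_rv (v \<ominus> vs n) w + \<bar>s w - ss n w\<bar> * norm_rv x w" for n
    proof -
      have split: "p \<oplus> q \<ominus> (p' \<oplus> q') = (p \<ominus> p') \<oplus> (q \<ominus> q')"
        if "p \<in> carrier E" "q \<in> carrier E" "p' \<in> carrier E" "q' \<in> carrier E" for p q p' q'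
        using that by (simp add: M.minus_eq M.minus_add M.a_ac)
      have neg: "(\<zero> \<ominus> p) \<ominus> (\<zero> \<ominus> q) = \<ominus> (p \<ominus> q)"
        if "p \<in> carrier E" "q \<in> carrier E" for p q
        using that by (simp add: M.minus_eq M.minus_add)
      have "(\<zero> \<ominus> ?pt v s) \<ominus> (\<zero> \<ominus> ?pt (vs n) (ss n))
          = \<ominus> ((v \<ominus> vs n) \<oplus> (scale s x \<ominus> scale (ss n) x))"
        by (simp only: neg split v(1) vs cl M.a_closed)
      then have eq: "nrm ((\<zero> \<ominus> ?pt v s) \<ominus> (\<zero> \<ominus> ?pt (vs n) (ss n)))
          = nrm ((v \<ominus> vs n) \<oplus> scale (\<lambda>w. s w - ss n w) x)"
        using nrm_minus[OF nm M.a_closed[OF M.minus_closed[OF v(1) vs] M.minus_closed[OF cl(1) cl(2)]], of n n]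
        unfolding scale_diff_left[OF s ss x] by simp
      have m: "(\<lambda>w. s w - ss n w) \<in> borel_measurable M" by (intro borel_measurable_diff s ss)
      show ?thesis
        using norm_rv_add[OF M.minus_closed[OF v(1) vs] scale_closed[OF m x]] norm_rv_scale[OF m x]
        unfolding eq by eventually_elim simp
    qed
    have "AE w in M. \<forall>n. \<bar>L0_rv (f (\<zero> \<ominus> ?pt v s)) w - L0_rv (f (\<zero> \<ominus> ?pt (vs n) (ss n))) w\<bar>
        \<le> R w * norm_rv ((\<zero> \<ominus> ?pt v s) \<ominus> (\<zero> \<ominus> ?pt (vs n) (ss n))) w"
      unfolding AE_all_countable using v(1) vs cl by (intro allI sublinear_Lipschitz[OF f f_le]) auto
    moreover have "AE w in M. \<forall>n. norm_rv ((\<zero> \<ominus> ?pt v s) \<ominus> (\<zero> \<ominus> ?pt (vs n) (ss n))) w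
        \<le> norm_rv (v \<ominus> vs n) w + \<bar>s w - ss n w\<bar> * norm_rv x w"
      unfolding AE_all_countable using near by blast
    moreover have "AE w in M. \<forall>n. 0 \<le> norm_rv ((\<zero> \<ominus> ?pt v s) \<ominus> (\<zero> \<ominus> ?pt (vs n) (ss n))) w"
      unfolding AE_all_countable using v(1) vs cl by (intro allI norm_rv_nonneg) auto
    moreover have "AE w in M. \<forall>n. \<bar>norm_rv v w - norm_rv (vs n) w\<bar> \<le> norm_rv (v \<ominus> vs n) w"
      unfolding AE_all_countable using v(1) vs by (intro allI norm_rv_Lipschitz)
    ultimately have "AE w in M. g (vs (N w)) (ss (N w)) \<zero> w = g v s \<zero> w"
      using v(2)
    proof eventually_elim
      case (elim w)
      have 0: "norm_rv ((\<zero> \<ominus> ?pt v s) \<ominus> (\<zero> \<ominus> ?pt (vs (N w)) (ss (N w)))) w = 0"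
        using spec[OF elim(2), of "N w"] spec[OF elim(3), of "N w"] elim(5) by (simp add: s_def)
      have "L0_rv (f (\<zero> \<ominus> ?pt v s)) w = L0_rv (f (\<zero> \<ominus> ?pt (vs (N w)) (ss (N w)))) w"
        using spec[OF elim(1), of "N w"] unfolding 0 by simp
      moreover have "norm_rv v w = norm_rv (vs (N w)) w" using spec[OF elim(4), of "N w"] elim(5) by simp
      ultimately show ?case by (simp add: g_def s_def)
    qed
    then show "\<exists>t\<in>T. AE w in M. g (fst (ts (N w))) (snd (ts (N w))) \<zero> w < 0 \<longrightarrow> g (fst t) (snd t) \<zero> w < 0"
      using v(1) s ss0 by (intro bexI[of _ "(v, s)"]) (auto simp: T_def vs_def ss_def s_def elim: eventually_mono)
  next
    fix t assume t: "t \<in> T" "AE w\<in>A in M. g (fst t) (snd t) \<zero> w < 0"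
    obtain v s where vs: "t = (v, s)" by (cases t)
    have v: "v \<in> carrier E" and s: "s \<in> borel_measurable M" "\<And>w. 0 \<le> s w" using t(1) by (auto simp: T_def vs)
    have "\<zero> \<ominus> ?pt v s = \<ominus> ?pt v s"
      using v scale_closed[OF s(1) x] by (simp add: M.minus_eq)
    then show thesis using t(2) by (intro separated[OF v s]) (simp add: g_def vs)
  next
    fix B assume B: "B \<in> sets M" "B \<subseteq> A" "0 < prob B"
      and none: "\<And>t. t \<in> T \<Longrightarrow> AE w\<in>B in M. \<not> g (fst t) (snd t) \<zero> w < 0"
    \<comment> \<open>off \<open>B\<close> the inf-convolution may be minus infinity; there it is replaced by \<open>z1\<close>\<close>
    define S where "S u = {\<xi> \<in> carrier (L0 M). \<exists>v s. (v, s) \<in> T \<and>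
        (AE w in M. L0_rv \<xi> w = (if w \<in> B then g v s u w else L0_rv (z1 u) w))}" for u
    have S_iff: "\<xi> \<in> S u \<longleftrightarrow> \<xi> \<in> carrier (L0 M) \<and> (\<exists>v s. (v, s) \<in> T \<and>
        (AE w in M. L0_rv \<xi> w = (if w \<in> B then g v s u w else L0_rv (z1 u) w)))" for \<xi> u
      by (simp only: S_def mem_Collect_eq)
    have S_ex: "\<exists>\<xi>\<in>S u. AE w in M. L0_rv \<xi> w = (if w \<in> B then g v s u w else L0_rv (z1 u) w)"
      if "u \<in> carrier E" "(v, s) \<in> T" for u v s
    proof -
      have [measurable]: "g v s u \<in> borel_measurable M" "L0_rv (z1 u) \<in> borel_measurable M" "B \<in> sets M"
        using that B(1) z1 by (auto simp: T_def intro!: gm linear_measurable)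
      have m: "(\<lambda>w. if w \<in> B then g v s u w else L0_rv (z1 u) w) \<in> borel_measurable M" by measurable
      show ?thesis
      proof (intro bexI)
        show "L0_class M (\<lambda>w. if w \<in> B then g v s u w else L0_rv (z1 u) w) \<in> S u"
          unfolding S_iff using L0_rv_class[OF m] that(2) L0_class_carrier[OF m] by blast
      qed (rule L0_rv_class[OF m])
    qed
    obtain q where q: "L0_sublinear M E q" "q \<in> extensional (carrier E)"
      "\<And>u. u \<in> carrier E \<Longrightarrow> L0_is_glb M (S u) (q u)"
    proof (rule sublinear_inf)
      fix u assume u: "u \<in> carrier E"
      show "S u \<subseteq> carrier (L0 M) \<and> S u \<noteq> {}"
        using S_ex[OF u zero_T] unfolding subset_iff S_iff by blast
      note fu = fc[OF M.a_inv_closed[OF u]]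
      have [measurable]: "L0_rv (f (\<ominus> u)) \<in> borel_measurable M" "L0_rv (z1 u) \<in> borel_measurable M" "B \<in> sets M"
        using B(1) by (auto intro!: L0_rv_measurable fu linear_closed[OF z1 u])
      have m: "(\<lambda>w. if w \<in> B then - L0_rv (f (\<ominus> u)) w else L0_rv (z1 u) w) \<in> borel_measurable M" by measurable
      show "\<exists>b\<in>carrier (L0 M). \<forall>\<xi>\<in>S u. L0_le M b \<xi>"
      proof (rule bexI[where x = "L0_class M (\<lambda>w. if w \<in> B then - L0_rv (f (\<ominus> u)) w else L0_rv (z1 u) w)"], rule ballI)
        fix \<xi> assume "\<xi> \<in> S u"
        then obtain v s where vs: "(v, s) \<in> T" and \<xi>: "AE w in M. L0_rv \<xi> w = (if w \<in> B then g v s u w else L0_rv (z1 u) w)"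
          unfolding S_iff by blast
        have v: "v \<in> carrier E" and s: "s \<in> borel_measurable M" using vs by (auto simp: T_def)
        have y: "v \<oplus> scale s x \<in> carrier E" using v scale_closed[OF s x] by simp
        have "(u \<ominus> ?pt v s) \<oplus> \<ominus> u = \<zero> \<ominus> ?pt v s"
          using u y by (simp add: M.minus_eq M.a_comm[of u] M.a_assoc M.r_neg)
        then have "AE w in M. g v s \<zero> w \<le> g v s u w + L0_rv (f (\<ominus> u)) w"
          using sublinear_add[OF f M.minus_closed[OF u y] M.a_inv_closed[OF u]]
          by (auto simp: g_def elim!: eventually_mono)
        with none[OF vs] \<xi> L0_rv_class[OF m] show "L0_le M (L0_class M (\<lambda>w. if w \<in> B then - L0_rv (f (\<ominus> u)) w else L0_rv (z1 u) w)) \<xi>"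
          unfolding L0_le_def by eventually_elim (auto split: if_splits)
      qed (rule L0_class_carrier[OF m])
    next
      fix u u' \<xi> \<zeta> assume u: "u \<in> carrier E" and u': "u' \<in> carrier E" and "\<xi> \<in> S u" and "\<zeta> \<in> S u'"
      then obtain v s v' s' where vs: "(v, s) \<in> T" "(v', s') \<in> T" and \<xi>c: "\<xi> \<in> carrier (L0 M)" "\<zeta> \<in> carrier (L0 M)"
        and \<xi>: "AE w in M. L0_rv \<xi> w = (if w \<in> B then g v s u w else L0_rv (z1 u) w)"
        and \<zeta>: "AE w in M. L0_rv \<zeta> w = (if w \<in> B then g v' s' u' w else L0_rv (z1 u') w)"
        unfolding S_iff by blast
      have v: "v \<in> carrier E" "v' \<in> carrier E" and s: "s \<in> borel_measurable M" "s' \<in> borel_measurable M"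
        using vs by (auto simp: T_def)
      have sum_T: "(v \<oplus> v', \<lambda>w. s w + s' w) \<in> T" using vs by (auto simp: T_def)
      obtain \<theta> where \<theta>: "\<theta> \<in> S (u \<oplus> u')"
        "AE w in M. L0_rv \<theta> w = (if w \<in> B then g (v \<oplus> v') (\<lambda>w. s w + s' w) (u \<oplus> u') w else L0_rv (z1 (u \<oplus> u')) w)"
        using S_ex[OF M.a_closed[OF u u'] sum_T] by blast
      note sx = scale_closed[OF s(1) x] scale_closed[OF s(2) x]
      have "(u \<oplus> u') \<ominus> ((v \<oplus> v') \<oplus> scale (\<lambda>w. s w + s' w) x)
          = (u \<ominus> ?pt v s) \<oplus> (u' \<ominus> ?pt v' s')"
        using u u' v sx unfolding smult_class_add[OF s x] by (simp add: M.minus_eq M.minus_add M.a_ac)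
      then have "AE w in M. L0_rv (f ((u \<oplus> u') \<ominus> ((v \<oplus> v') \<oplus> scale (\<lambda>w. s w + s' w) x))) w
          \<le> L0_rv (f (u \<ominus> ?pt v s)) w + L0_rv (f (u' \<ominus> ?pt v' s')) w"
        using sublinear_add[OF f, of "u \<ominus> ?pt v s" "u' \<ominus> ?pt v' s'"] u u' v sx by simp
      then have "L0_le M \<theta> (\<xi> \<oplus>\<^bsub>L0 M\<^esub> \<zeta>)"
        using \<theta>(2) \<xi> \<zeta> norm_rv_add[OF v] c0 linear_add[OF z1 u u'] L0_rv_add[OF \<xi>c]
        unfolding L0_le_def
      proof eventually_elim
        case (elim w)
        have "c w * norm_rv (v \<oplus> v') w \<le> c w * norm_rv v w + c w * norm_rv v' w"
          using elim by (simp add: mult_left_mono distrib_left[symmetric])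
        then show ?case using elim by (simp add: g_def algebra_simps)
      qed
      then show "\<exists>\<theta>\<in>S (u \<oplus> u'). L0_le M \<theta> (\<xi> \<oplus>\<^bsub>L0 M\<^esub> \<zeta>)" using \<theta>(1) by blast
    next
      fix u \<xi> \<eta> assume u: "u \<in> carrier E" and \<eta>: "\<eta> \<in> L0_pos M" and "\<xi> \<in> S u"
      then obtain v s where vs: "(v, s) \<in> T" and \<xi>c: "\<xi> \<in> carrier (L0 M)"
        and \<xi>: "AE w in M. L0_rv \<xi> w = (if w \<in> B then g v s u w else L0_rv (z1 u) w)"
        unfolding S_iff by blast
      have v: "v \<in> carrier E" and s: "s \<in> borel_measurable M" and s0: "\<And>w. 0 \<le> s w" using vs by (auto simp: T_def)
      define h where "h w = \<bar>L0_rv \<eta> w\<bar>" for w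
      have hm[measurable]: "h \<in> borel_measurable M" unfolding h_def using L0_rv_measurable[OF L0_posD[OF \<eta>]] by simp
      have h\<eta>: "AE w in M. 0 < h w \<and> L0_rv \<eta> w = h w" using \<eta> by (auto simp: L0_pos_iff h_def elim: eventually_mono)
      have \<eta>_eq: "\<eta> = L0_class M h"
      proof -
        have "L0_class M (L0_rv \<eta>) = L0_class M h"
          using h\<eta> by (intro L0_class_eqI) (auto elim: eventually_mono)
        then show ?thesis by (simp only: L0_class_rv[OF L0_posD[OF \<eta>]])
      qed
      have hs_T: "(scale h v, \<lambda>w. h w * s w) \<in> T"
        unfolding T_def mem_Collect_eq prod.case
        by (intro conjI allI scale_closed[OF hm v] borel_measurable_times hm s mult_nonneg_nonneg s0) (simp add: h_def)
      obtain \<theta> where \<theta>: "\<theta> \<in> S (scale h u)"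
        "AE w in M. L0_rv \<theta> w = (if w \<in> B then g (scale h v) (\<lambda>w. h w * s w) (scale h u) w else L0_rv (z1 (scale h u)) w)"
        using S_ex[OF scale_closed[OF hm u] hs_T] by blast
      note sx = scale_closed[OF s x]
      have y: "v \<oplus> scale s x \<in> carrier E" using v sx by simp
      have "scale (\<lambda>w. h w * s w) x = scale h (scale s x)"
        using s x by (simp add: L0_class_mult[symmetric] smult_assoc1)
      then have e: "scale h u \<ominus> (scale h v \<oplus> scale (\<lambda>w. h w * s w) x) = scale h (u \<ominus> ?pt v s)"
        using u v sx by (simp add: M.minus_eq smult_r_distr smult_r_minus)
      have hpos: "AE w in M. 0 < h w" using h\<eta> by (auto elim: eventually_mono)
      have le: "L0_le M \<theta> (\<eta> \<otimes>\<^bsub>L0 M\<^esub> \<xi>)"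
        using \<theta>(2) \<xi> h\<eta> norm_rv_scale[OF hm v] linear_scale[OF z1 hm u] L0_rv_mult[OF L0_posD[OF \<eta>] \<xi>c]
          sublinear_scale[OF f M.minus_closed[OF u y] hm hpos]
        unfolding L0_le_def e
      proof eventually_elim
        case (elim w)
        then show ?case using elim by (auto simp: g_def algebra_simps e)
      qed
      show "\<exists>\<theta>\<in>S (\<eta> \<odot> u). L0_le M \<theta> (\<eta> \<otimes>\<^bsub>L0 M\<^esub> \<xi>)"
        using le[unfolded \<eta>_eq] \<theta>(1) unfolding \<eta>_eq by (rule bexI)
    qed (rule that)
    obtain z where z: "L0_linear M E z" "z \<in> extensional (carrier E)" "\<And>u. u \<in> carrier E \<Longrightarrow> L0_le M (z u) (q u)"
      by (rule Hahn_Banach_L0[OF q(1)]) (rule that)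
    have z_le: "AE w in M. L0_rv (z u) w \<le> (if w \<in> B then g v s u w else L0_rv (z1 u) w)"
      if u: "u \<in> carrier E" and vs: "(v, s) \<in> T" for u v s
    proof -
      obtain \<xi> where \<xi>: "\<xi> \<in> S u" "AE w in M. L0_rv \<xi> w = (if w \<in> B then g v s u w else L0_rv (z1 u) w)"
        using S_ex[OF u vs] ..
      have "L0_le M (q u) \<xi>" using q(3)[OF u] \<xi>(1) unfolding L0_is_glb_def by blast
      with z(3)[OF u] \<xi>(2) show ?thesis unfolding L0_le_def by eventually_elim simp
    qed
    have scale0: "scale (\<lambda>_. 0) x = \<zero>" and scale1: "scale (\<lambda>_. 1) x = x"
      using x by (simp_all add: L0_class_zero L0_class_one)
    have minus_zero: "u \<ominus> \<zero> = u" if "u \<in> carrier E" for u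
    proof -
      have "\<ominus> \<zero> = \<zero>" by (metis M.l_zero M.r_neg M.zero_closed M.a_inv_closed)
      then show ?thesis by (simp only: M.minus_eq M.r_zero[OF that])
    qed
    have self: "u \<ominus> u = \<zero>" if "u \<in> carrier E" for u using that by (simp add: M.minus_eq M.r_neg)
    have off: "AE w in M. w \<notin> B \<longrightarrow> L0_rv (z u) w = L0_rv (z1 u) w" if u: "u \<in> carrier E" for u
      using z_le[OF u zero_T] z_le[OF M.a_inv_closed[OF u] zero_T] linear_uminus[OF z(1) u] linear_uminus[OF z1 u]
      by eventually_elim (auto split: if_splits)
    show thesis
    proof (rule common[OF B z(1,2) _ _ _ off])
      fix u assume u: "u \<in> carrier E"
      show "AE w in M. L0_rv (z u) w \<le> L0_rv (f u) w"
        using z_le[OF u zero_T] z1_le[OF u] norm_rv_zero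
        by eventually_elim (simp add: g_def scale0 minus_zero u split: if_splits)
      have "(u, \<lambda>_. 0) \<in> T" using u by (simp add: T_def)
      from z_le[OF u this] sublinear_zero[OF f]
      show "AE w\<in>B in M. L0_rv (z u) w \<le> c w * norm_rv u w"
        by eventually_elim (simp add: g_def scale0 self u split: if_splits)
    next
      have "(\<zero>, \<lambda>_. 1) \<in> T" by (simp add: T_def)
      from z_le[OF x this] sublinear_zero[OF f] norm_rv_zero
      show "AE w\<in>B in M. L0_rv (z x) w \<le> a w"
        by eventually_elim (simp add: g_def scale1 self x split: if_splits)
    qed
  qed
qed

section \<open>Enlarging the radius\<close>

text \<open>The infimum of all upper bounds is taken rather than a supremum, so that sublinearity is an
  instance of \<open>sublinear_inf\<close>.\<close>

lemma support_function_exists: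
  assumes lin: "\<And>k. k \<in> C \<Longrightarrow> L0_linear M E k" and bdd: "\<And>k. k \<in> C \<Longrightarrow> bounded_by R k"
    and Rm[measurable]: "R \<in> borel_measurable M" and ne: "C \<noteq> {}"
  obtains f where "L0_sublinear M E f"
    "\<And>k x. k \<in> C \<Longrightarrow> x \<in> carrier E \<Longrightarrow> AE w in M. L0_rv (k x) w \<le> L0_rv (f x) w"
    "\<And>x b. x \<in> carrier E \<Longrightarrow> b \<in> borel_measurable M \<Longrightarrow> (\<And>k. k \<in> C \<Longrightarrow> AE w in M. L0_rv (k x) w \<le> b w) \<Longrightarrow>
       AE w in M. L0_rv (f x) w \<le> b w"
proof -
  define S where "S x = {\<xi> \<in> carrier (L0 M). \<forall>k\<in>C. L0_le M (k x) \<xi>}" for x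
  have S_iff: "\<xi> \<in> S x \<longleftrightarrow> \<xi> \<in> carrier (L0 M) \<and> (\<forall>k\<in>C. L0_le M (k x) \<xi>)" for \<xi> x
    by (simp only: S_def mem_Collect_eq)
  obtain k0 where k0: "k0 \<in> C" using ne by blast
  have kc: "k x \<in> carrier (L0 M)" if "k \<in> C" "x \<in> carrier E" for k x
    by (rule linear_closed[OF lin[OF that(1)] that(2)])
  obtain f where f: "L0_sublinear M E f" "f \<in> extensional (carrier E)"
    "\<And>x. x \<in> carrier E \<Longrightarrow> L0_is_glb M (S x) (f x)"
  proof (rule sublinear_inf)
    fix x assume x: "x \<in> carrier E"
    have m: "(\<lambda>w. R w * norm_rv x w) \<in> borel_measurable M"
      using norm_rv_measurable[OF x] by measurable
    have "L0_class M (\<lambda>w. R w * norm_rv x w) \<in> S x"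
      unfolding S_iff
    proof (intro conjI ballI L0_class_carrier m)
      fix k assume "k \<in> C"
      from bdd[OF this] x have "AE w in M. \<bar>L0_rv (k x) w\<bar> \<le> R w * norm_rv x w" by (simp add: bounded_by_def)
      with L0_rv_class[OF m] show "L0_le M (k x) (L0_class M (\<lambda>w. R w * norm_rv x w))"
        unfolding L0_le_def by eventually_elim simp
    qed
    then have "S x \<noteq> {}" by blast
    moreover have "S x \<subseteq> carrier (L0 M)" by (simp add: S_def subset_iff)
    ultimately show "S x \<subseteq> carrier (L0 M) \<and> S x \<noteq> {}" by simp
    show "\<exists>b\<in>carrier (L0 M). \<forall>\<xi>\<in>S x. L0_le M b \<xi>"
    proof (rule bexI[OF _ kc[OF k0 x]], rule ballI)
      fix \<xi> assume "\<xi> \<in> S x"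
      then show "L0_le M (k0 x) \<xi>" using k0 by (simp add: S_iff)
    qed
  next
    fix x y \<xi> \<zeta> assume x: "x \<in> carrier E" and y: "y \<in> carrier E" and \<xi>: "\<xi> \<in> S x" and \<zeta>: "\<zeta> \<in> S y"
    have "L0_le M (k (x \<oplus> y)) (\<xi> \<oplus>\<^bsub>L0 M\<^esub> \<zeta>)" if k: "k \<in> C" for k
    proof -
      have "k (x \<oplus> y) = k x \<oplus>\<^bsub>L0 M\<^esub> k y" using lin[OF k] x y by (simp add: L0_linear_def)
      then show ?thesis using \<xi> \<zeta> k kc[OF k x] kc[OF k y] by (simp add: S_iff L0_add_mono)
    qed
    then have "\<xi> \<oplus>\<^bsub>L0 M\<^esub> \<zeta> \<in> S (x \<oplus> y)" using \<xi> \<zeta> by (simp add: S_iff)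
    then show "\<exists>\<theta>\<in>S (x \<oplus> y). L0_le M \<theta> (\<xi> \<oplus>\<^bsub>L0 M\<^esub> \<zeta>)" using L0_le_refl by blast
  next
    fix x \<xi> \<eta> assume x: "x \<in> carrier E" and \<eta>: "\<eta> \<in> L0_pos M" and \<xi>: "\<xi> \<in> S x"
    have "L0_le M (k (\<eta> \<odot> x)) (\<eta> \<otimes>\<^bsub>L0 M\<^esub> \<xi>)" if k: "k \<in> C" for k
    proof -
      have "k (\<eta> \<odot> x) = \<eta> \<otimes>\<^bsub>L0 M\<^esub> k x" using lin[OF k] x L0_posD[OF \<eta>] by (simp add: L0_linear_def)
      then show ?thesis using \<xi> k kc[OF k x] \<eta> by (simp add: S_iff L0_mult_left_mono)
    qed
    then have "\<eta> \<otimes>\<^bsub>L0 M\<^esub> \<xi> \<in> S (\<eta> \<odot> x)" using \<xi> L0_posD[OF \<eta>] by (simp add: S_iff)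
    then show "\<exists>\<theta>\<in>S (\<eta> \<odot> x). L0_le M \<theta> (\<eta> \<otimes>\<^bsub>L0 M\<^esub> \<xi>)" using L0_le_refl by blast
  qed (rule that)
  show thesis
  proof (rule that[OF f(1)])
    fix k x assume k: "k \<in> C" and x: "x \<in> carrier E"
    have "\<forall>\<zeta>\<in>carrier (L0 M). (\<forall>\<xi>\<in>S x. L0_le M \<zeta> \<xi>) \<longrightarrow> L0_le M \<zeta> (f x)"
      using f(3)[OF x] unfolding L0_is_glb_def by (elim conjE)
    from bspec[OF this kc[OF k x]] have "L0_le M (k x) (f x)" using k by (simp add: S_iff)
    then show "AE w in M. L0_rv (k x) w \<le> L0_rv (f x) w" by (simp add: L0_le_def)
  next
    fix x b assume x: "x \<in> carrier E" and b: "b \<in> borel_measurable M"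
      and le: "\<And>k. k \<in> C \<Longrightarrow> AE w in M. L0_rv (k x) w \<le> b w"
    have "L0_class M b \<in> S x"
      unfolding S_iff
    proof (intro conjI ballI L0_class_carrier b)
      fix k assume "k \<in> C"
      from le[OF this] L0_rv_class[OF b] show "L0_le M (k x) (L0_class M b)"
        unfolding L0_le_def by eventually_elim simp
    qed
    then have "L0_le M (f x) (L0_class M b)" using f(3)[OF x] unfolding L0_is_glb_def by blast
    with L0_rv_class[OF b] show "AE w in M. L0_rv (f x) w \<le> b w"
      unfolding L0_le_def by eventually_elim simp
  qed
qed

text \<open>Relative stability together with the existence of concatenations in the dual, in terms of
  values.\<close>

definition stable_functionals :: "('e \<Rightarrow> 'w L0) set \<Rightarrow> bool" where
  "stable_functionals K \<longleftrightarrow> K \<subseteq> carrier dual \<and>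
     (\<forall>ks N. range ks \<subseteq> K \<longrightarrow> N \<in> measurable M (count_space (UNIV :: nat set)) \<longrightarrow>
        (\<exists>k\<in>K. \<forall>x\<in>carrier E. AE w in M. L0_rv (k x) w = L0_rv (ks (N w) x) w))"

text \<open>This is what weak-star closedness of the bounded parts of a convex stable set is used for: a
  functional that satisfies every lower estimate valid on a nonempty bounded part belongs to the set.\<close>

definition bipolar_closed :: "('e \<Rightarrow> 'w L0) set \<Rightarrow> bool" where
  "bipolar_closed K \<longleftrightarrow> (\<forall>R\<in>borel_measurable M. \<forall>z\<in>carrier dual. (\<exists>k\<in>K. bounded_by R k) \<longrightarrow>
     (\<forall>u\<in>carrier E. \<forall>b\<in>borel_measurable M. (\<forall>k\<in>K. bounded_by R k \<longrightarrow> (AE w in M. b w \<le> L0_rv (k u) w)) \<longrightarrow>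
        (AE w in M. b w \<le> L0_rv (z u) w)) \<longrightarrow> z \<in> K)"

text \<open>The alternative for the support function of the part of \<open>K\<close> with bound \<open>R\<close>.  Its second
  case gives a member of \<open>K\<close>, by bipolarity; off \<open>B\<close> this member agrees with \<open>z1\<close> and so has the bound
  \<open>m\<close>.  The bound \<open>b\<close> is uniform in \<open>k\<close>, which gives a margin and not only strict
  inequalities.\<close>

lemma separation_in_ball:
  assumes K: "K \<subseteq> carrier dual" and bip: "bipolar_closed K"
    and z1: "z1 \<in> K" and m: "bounded_by m z1"
    and Rm: "R \<in> borel_measurable M" and mR: "AE w in M. m w \<le> R w"
    and c[measurable]: "c \<in> borel_measurable M" and c0: "AE w in M. 0 \<le> c w"
    and x: "x \<in> carrier E" and a: "a \<in> borel_measurable M" and A: "A \<in> sets M"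
    and no_common: "\<And>B z. B \<in> sets M \<Longrightarrow> B \<subseteq> A \<Longrightarrow> 0 < prob B \<Longrightarrow> z \<in> K \<Longrightarrow>
        bounded_by (\<lambda>w. if w \<in> B then c w else m w) z \<Longrightarrow> AE w\<in>B in M. L0_rv (z x) w \<le> a w \<Longrightarrow> False"
  obtains v s b where "v \<in> carrier E" "s \<in> borel_measurable M" "\<And>w. 0 \<le> s w" "b \<in> borel_measurable M"
    "AE w\<in>A in M. c w * norm_rv v w + s w * a w < b w"
    "\<And>k. k \<in> K \<Longrightarrow> bounded_by R k \<Longrightarrow> AE w in M. b w \<le> L0_rv (k v) w + s w * L0_rv (k x) w"
proof -
  let ?C = "{k \<in> K. bounded_by R k}"
  have z1C: "z1 \<in> ?C" using z1 bounded_by_mono[OF m mR] by simp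
  have lin: "L0_linear M E k" if "k \<in> K" for k using K that by (blast intro: dualD(1))
  obtain f where f: "L0_sublinear M E f"
    and f_upper: "\<And>k x. k \<in> ?C \<Longrightarrow> x \<in> carrier E \<Longrightarrow> AE w in M. L0_rv (k x) w \<le> L0_rv (f x) w"
    and f_least: "\<And>x b. x \<in> carrier E \<Longrightarrow> b \<in> borel_measurable M \<Longrightarrow> (\<And>k. k \<in> ?C \<Longrightarrow> AE w in M. L0_rv (k x) w \<le> b w) \<Longrightarrow>
       AE w in M. L0_rv (f x) w \<le> b w"
  proof (rule support_function_exists[where C = ?C and R = R])
    show "?C \<noteq> {}" using z1C by blast
  qed (use lin Rm in auto)
  have f_le: "AE w in M. L0_rv (f u) w \<le> R w * norm_rv u w" if u: "u \<in> carrier E" for u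
  proof (rule f_least[OF u])
    show "(\<lambda>w. R w * norm_rv u w) \<in> borel_measurable M"
      by (intro borel_measurable_times Rm norm_rv_measurable u)
    show "AE w in M. L0_rv (k u) w \<le> R w * norm_rv u w" if "k \<in> ?C" for k
    proof -
      have "AE w in M. \<bar>L0_rv (k u) w\<bar> \<le> R w * norm_rv u w" using that u by (simp add: bounded_by_def)
      then show ?thesis by eventually_elim simp
    qed
  qed
  show thesis
  proof (rule separation_alternative[OF f f_le lin[OF z1] f_upper[OF z1C] c c0 x a A])
    fix v s assume v: "v \<in> carrier E" and s[measurable]: "s \<in> borel_measurable M" and s0: "\<And>w. 0 \<le> s w"
      and sep: "AE w\<in>A in M. L0_rv (f (\<ominus> (v \<oplus> scale s x))) w + c w * norm_rv v w + s w * a w < 0"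
    let ?y = "v \<oplus> scale s x"
    have y: "?y \<in> carrier E" "\<ominus> ?y \<in> carrier E" using v scale_closed[OF s x] by simp_all
    have bm: "(\<lambda>w. - L0_rv (f (\<ominus> ?y)) w) \<in> borel_measurable M"
      by (intro borel_measurable_uminus L0_rv_measurable sublinear_closed[OF f y(2)])
    show thesis
    proof (rule that[OF v s s0 bm])
      show "AE w\<in>A in M. c w * norm_rv v w + s w * a w < - L0_rv (f (\<ominus> ?y)) w"
        using sep by eventually_elim auto
      fix k assume k: "k \<in> K" "bounded_by R k"
      then have "k \<in> ?C" by simp
      from f_upper[OF this y(2)] linear_uminus[OF lin[OF k(1)] y(1)]
        linear_add[OF lin[OF k(1)] v scale_closed[OF s x]] linear_scale[OF lin[OF k(1)] s x]
      show "AE w in M. - L0_rv (f (\<ominus> ?y)) w \<le> L0_rv (k v) w + s w * L0_rv (k x) w"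
        by eventually_elim simp
    qed
  next
    fix B z assume B: "B \<in> sets M" "B \<subseteq> A" "0 < prob B" and z: "L0_linear M E z" "z \<in> extensional (carrier E)"
      and zf: "\<And>u. u \<in> carrier E \<Longrightarrow> AE w in M. L0_rv (z u) w \<le> L0_rv (f u) w"
      and zc: "\<And>u. u \<in> carrier E \<Longrightarrow> AE w\<in>B in M. L0_rv (z u) w \<le> c w * norm_rv u w"
      and za: "AE w\<in>B in M. L0_rv (z x) w \<le> a w"
      and off: "\<And>u. u \<in> carrier E \<Longrightarrow> AE w in M. w \<notin> B \<longrightarrow> L0_rv (z u) w = L0_rv (z1 u) w"
    have norm_neg: "norm_rv (\<ominus> u) = norm_rv u" if "u \<in> carrier E" for u using nrm_minus[OF nm that] by simp
    have "bounded_by R z"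
      unfolding bounded_by_def
    proof
      fix u assume u: "u \<in> carrier E"
      note u' = M.a_inv_closed[OF u]
      show "AE w in M. \<bar>L0_rv (z u) w\<bar> \<le> R w * norm_rv u w"
        using zf[OF u] zf[OF u'] f_le[OF u] f_le[OF u'] linear_uminus[OF z(1) u] unfolding norm_neg[OF u]
        by eventually_elim simp
    qed
    then have zd: "z \<in> carrier dual" using z Rm by (auto simp: dual_carrier_iff)
    have above: "\<forall>u\<in>carrier E. \<forall>b\<in>borel_measurable M.
        (\<forall>k\<in>K. bounded_by R k \<longrightarrow> (AE w in M. b w \<le> L0_rv (k u) w)) \<longrightarrow> (AE w in M. b w \<le> L0_rv (z u) w)"
    proof (intro ballI impI)
      fix u and b :: "'w \<Rightarrow> real"
      assume u: "u \<in> carrier E" and b: "b \<in> borel_measurable M"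
        and le: "\<forall>k\<in>K. bounded_by R k \<longrightarrow> (AE w in M. b w \<le> L0_rv (k u) w)"
      note u' = M.a_inv_closed[OF u]
      have "AE w in M. L0_rv (f (\<ominus> u)) w \<le> - b w"
      proof (rule f_least[OF u'])
        show "(\<lambda>w. - b w) \<in> borel_measurable M" using b by measurable
        fix k assume "k \<in> ?C"
        then have k: "k \<in> K" "bounded_by R k" by auto
        have "AE w in M. b w \<le> L0_rv (k u) w" using le k by blast
        with linear_uminus[OF lin[OF k(1)] u] show "AE w in M. L0_rv (k (\<ominus> u)) w \<le> - b w"
          by eventually_elim simp
      qed
      with zf[OF u'] linear_uminus[OF z(1) u] show "AE w in M. b w \<le> L0_rv (z u) w" by eventually_elim simp
    qed
    have "\<exists>k\<in>K. bounded_by R k" using z1C by blast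
    then have zK: "z \<in> K"
      by (rule bip[unfolded bipolar_closed_def, THEN bspec, OF Rm, THEN bspec, OF zd, THEN mp, THEN mp, OF _ above])
    have "bounded_by (\<lambda>w. if w \<in> B then c w else m w) z"
      unfolding bounded_by_def
    proof
      fix u assume u: "u \<in> carrier E"
      note u' = M.a_inv_closed[OF u]
      have "AE w in M. \<bar>L0_rv (z1 u) w\<bar> \<le> m w * norm_rv u w" using m u by (simp add: bounded_by_def)
      then show "AE w in M. \<bar>L0_rv (z u) w\<bar> \<le> (if w \<in> B then c w else m w) * norm_rv u w"
        using zc[OF u] zc[OF u'] off[OF u] linear_uminus[OF z(1) u] unfolding norm_neg[OF u]
        by eventually_elim auto
    qed
    from no_common[OF B zK this za] show thesis ..
  qed
qed

lemma stable_functionals_concatenation: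
  assumes K: "stable_functionals K" and ks: "\<And>n. ks n \<in> K" and N: "N \<in> measurable M (count_space (UNIV :: nat set))"
  obtains k where "k \<in> K" "\<And>x. x \<in> carrier E \<Longrightarrow> AE w in M. L0_rv (k x) w = L0_rv (ks (N w) x) w"
proof -
  have "range ks \<subseteq> K" using ks by blast
  then have "\<exists>k\<in>K. \<forall>x\<in>carrier E. AE w in M. L0_rv (k x) w = L0_rv (ks (N w) x) w"
    by (rule K[unfolded stable_functionals_def, THEN conjunct2, THEN spec[of _ ks], THEN spec[of _ N],
      THEN mp, THEN mp, OF _ N])
  then obtain k where "k \<in> K" "\<forall>x\<in>carrier E. AE w in M. L0_rv (k x) w = L0_rv (ks (N w) x) w" ..
  then show ?thesis by (intro that[of k]) simp_all
qed

lemma stable_functionals_patch: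
  assumes K: "stable_functionals K" and k: "k \<in> K" and k': "k' \<in> K" and P: "{w \<in> space M. P w} \<in> sets M"
  obtains h where "h \<in> K" "\<And>x. x \<in> carrier E \<Longrightarrow> AE w in M. L0_rv (h x) w = (if P w then L0_rv (k x) w else L0_rv (k' x) w)"
proof -
  let ?ks = "\<lambda>n::nat. if n = 0 then k else k'" and ?N = "\<lambda>w. if P w then 0 else 1 :: nat"
  have N: "?N \<in> measurable M (count_space UNIV)" using P by (intro measurable_If) auto
  have ks: "?ks n \<in> K" for n using k k' by auto
  obtain h where h: "h \<in> K" "\<And>x. x \<in> carrier E \<Longrightarrow> AE w in M. L0_rv (h x) w = L0_rv (?ks (?N w) x) w"
    by (rule stable_functionals_concatenation[where ks = ?ks, OF K ks N]) (rule that)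
  show ?thesis
  proof (rule that[OF h(1)])
    fix x assume "x \<in> carrier E"
    from h(2)[OF this] show "AE w in M. L0_rv (h x) w = (if P w then L0_rv (k x) w else L0_rv (k' x) w)"
      by eventually_elim auto
  qed
qed

text \<open>Members of \<open>K\<close> that vanish on parts of the space can be concatenated, so that they cannot exhaust
  it.  That a functional vanishes at a point \<open>w\<close> has no meaning; it is expressed by a bound \<open>R\<close> with
  \<open>R w = 0\<close>.\<close>

lemma nonvanishing_event:
  assumes K: "stable_functionals K" and ne: "K \<noteq> {}"
    and nonzero: "\<And>z. z \<in> K \<Longrightarrow> \<not> bounded_by (\<lambda>_. 0) z"
  obtains A where "A \<in> sets M" "0 < prob A"
    "\<And>k R. k \<in> K \<Longrightarrow> R \<in> borel_measurable M \<Longrightarrow> bounded_by R k \<Longrightarrow> AE w\<in>A in M. R w \<noteq> 0"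
proof -
  have Kd: "K \<subseteq> carrier dual" using K by (simp add: stable_functionals_def)
  define T where "T = {(k, R :: 'w \<Rightarrow> real). k \<in> K \<and> R \<in> borel_measurable M \<and> bounded_by R k}"
  show thesis
  proof (rule stable_exhaustion[where T = T and A = "space M" and \<Phi> = "\<lambda>t w. snd t w = 0"])
    obtain k where k: "k \<in> K" using ne by blast
    then have kd: "k \<in> carrier dual" using Kd by blast
    obtain R where "R \<in> borel_measurable M" "bounded_by R k" by (rule dual_bound[OF kd]) (rule that)
    then have "(k, R) \<in> T" using k by (simp add: T_def)
    then show "T \<noteq> {}" by blast
    fix t assume "t \<in> T"
    then have "snd t \<in> borel_measurable M" by (auto simp: T_def)
    then show "{w \<in> space M. snd t w = 0} \<in> sets M" by measurable
  next
    fix ts :: "nat \<Rightarrow> ('e \<Rightarrow> 'w L0) \<times> ('w \<Rightarrow> real)" and N :: "'w \<Rightarrow> nat"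
    assume ts: "range ts \<subseteq> T" and N: "N \<in> measurable M (count_space UNIV)"
    define ks Rs where "ks n = fst (ts n)" and "Rs n = snd (ts n)" for n
    have tsT: "ts n \<in> T" for n using ts by blast
    have ks: "ks n \<in> K" and Rs: "Rs n \<in> borel_measurable M" and b: "bounded_by (Rs n) (ks n)" for n
      using tsT[of n] by (auto simp: T_def ks_def Rs_def)
    obtain k where k: "k \<in> K" "\<And>x. x \<in> carrier E \<Longrightarrow> AE w in M. L0_rv (k x) w = L0_rv (ks (N w) x) w"
      by (rule stable_functionals_concatenation[where ks = ks, OF K ks N]) (rule that)
    have "bounded_by (\<lambda>w. Rs (N w) w) k"
      by (rule bounded_by_concatenation[where ks = ks and N = N and R = Rs, OF k(2) b])
    moreover have "(\<lambda>w. Rs (N w) w) \<in> borel_measurable M" by (rule measurable_compose_countable[OF Rs N])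
    ultimately have "(k, \<lambda>w. Rs (N w) w) \<in> T" using k(1) by (simp add: T_def)
    then show "\<exists>t\<in>T. AE w in M. snd (ts (N w)) w = 0 \<longrightarrow> snd t w = 0"
      by (intro bexI[of _ "(k, \<lambda>w. Rs (N w) w)"]) (simp_all add: Rs_def)
  next
    fix t assume t: "t \<in> T" "AE w in M. w \<in> space M \<longrightarrow> snd t w = 0"
    obtain k R where kR: "t = (k, R)" by (cases t)
    have "AE w in M. R w \<le> 0" using t(2) AE_space unfolding kR by eventually_elim simp
    then have "bounded_by (\<lambda>_. 0) k" using t(1) bounded_by_mono[of R k "\<lambda>_. 0"] by (simp add: T_def kR)
    then show thesis using nonzero t(1) by (auto simp: T_def kR)
  next
    fix A assume A: "A \<in> sets M" "0 < prob A" and none: "\<And>t. t \<in> T \<Longrightarrow> AE w\<in>A in M. \<not> snd t w = 0"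
    show thesis
    proof (rule that[OF A])
      fix k R assume "k \<in> K" "R \<in> borel_measurable M" "bounded_by R k"
      then have "(k, R) \<in> T" by (simp add: T_def)
      from none[OF this] show "AE w\<in>A in M. R w \<noteq> 0" by simp
    qed
  qed simp
qed

text \<open>The new point is the normalised sum of \<open>v\<close> and \<open>s x\<close>, where \<open>v\<close> and \<open>s\<close> separate the members of
  \<open>K\<close> that are bounded by \<open>R'\<close> from the functionals that are bounded by \<open>R\<close> and have a value of at most
  \<open>a - d\<close> at \<open>x\<close>; the loss \<open>d\<close> is what leaves the two sets without a common member.  With \<open>t\<close> the
  relative weight of \<open>v\<close>, the point moves by at most \<open>2 t\<close>, while the new margin is the
  average of \<open>a - d\<close> and \<open>R\<close> with weights \<open>1 - t\<close> and \<open>t\<close>.  As \<open>R \<ge> a + 1\<close>, the gain of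
  margin, apart from the loss, is at least \<open>t\<close> and pays for the distance.\<close>

lemma margin_step:
  assumes K: "K \<subseteq> carrier dual" and bip: "bipolar_closed K" and A[measurable]: "A \<in> sets M"
    and z1: "z1 \<in> K" and m: "bounded_by m z1"
    and R[measurable]: "R \<in> borel_measurable M" and R': "R' \<in> borel_measurable M"
    and mR: "\<And>w. m w + 1 \<le> R w" and m0: "\<And>w. 0 \<le> m w" and RR': "\<And>w. R w \<le> R' w"
    and d[measurable]: "d \<in> borel_measurable M" and d0: "AE w in M. 0 \<le> d w" and dA: "AE w\<in>A in M. 0 < d w"
    and x: "x \<in> carrier E" and x1: "AE w in M. norm_rv x w \<le> 1"
    and a[measurable]: "a \<in> borel_measurable M" and am: "AE w in M. a w \<le> m w"
    and margin: "\<And>k. k \<in> K \<Longrightarrow> bounded_by R k \<Longrightarrow> AE w\<in>A in M. a w \<le> L0_rv (k x) w"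
  obtains x' a' where "x' \<in> carrier E" "AE w in M. norm_rv x' w \<le> 1"
    "a' \<in> borel_measurable M" "AE w in M. a' w \<le> m w"
    "\<And>k. k \<in> K \<Longrightarrow> bounded_by R' k \<Longrightarrow> AE w\<in>A in M. a' w \<le> L0_rv (k x') w"
    "AE w in M. norm_rv (x' \<ominus> x) w \<le> 2 * (a' w - a w + d w)"
proof -
  have lin: "L0_linear M E k" if "k \<in> K" for k using K that by (blast intro: dualD(1))
  have mR': "m w \<le> R w" "m w \<le> R' w" "0 \<le> R w" for w using mR[of w] RR'[of w] m0[of w] by linarith+
  have adm: "(\<lambda>w. a w - d w) \<in> borel_measurable M" by measurable
  have no_common: False
    if B: "B \<in> sets M" "B \<subseteq> A" "0 < prob B" and z: "z \<in> K" and bz: "bounded_by (\<lambda>w. if w \<in> B then R w else m w) z"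
      and le: "AE w\<in>B in M. L0_rv (z x) w \<le> a w - d w" for B z
  proof -
    have "bounded_by R z" using mR' by (intro bounded_by_mono[OF bz]) auto
    from margin[OF z this] le dA have "AE w in M. w \<notin> B"
      by eventually_elim (use B(2) in \<open>auto simp: subset_iff\<close>)
    then have "prob B = 0" using B(1) by (simp add: prob_eq_0)
    with B(3) show False by simp
  qed
  have mR'': "AE w in M. m w \<le> R' w" and R0: "AE w in M. 0 \<le> R w" using mR' by simp_all
  obtain v s b where v: "v \<in> carrier E" and s[measurable]: "s \<in> borel_measurable M" and s0: "\<And>w. 0 \<le> s w"
    and b: "b \<in> borel_measurable M"
    and ltb: "AE w\<in>A in M. R w * norm_rv v w + s w * (a w - d w) < b w"
    and bk: "\<And>k. k \<in> K \<Longrightarrow> bounded_by R' k \<Longrightarrow> AE w in M. b w \<le> L0_rv (k v) w + s w * L0_rv (k x) w"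
    by (rule separation_in_ball[OF K bip z1 m R' mR'' R R0 x adm A no_common]) (assumption+, rule that)
  note [measurable] = norm_rv_measurable[OF v]
  \<comment> \<open>\<open>v\<close> and \<open>s\<close> are normalised to weights with sum one; off \<open>A\<close> the point \<open>x\<close> is kept, with \<open>p = 0\<close> and \<open>r = 1\<close>\<close>
  define D where "D w = (if w \<in> A then norm_rv v w + s w else 1)" for w
  define p where "p w = (if w \<in> A then 1 / D w else 0)" for w
  define r where "r w = (if w \<in> A then s w / D w else 1)" for w
  have [measurable]: "D \<in> borel_measurable M" unfolding D_def by measurable
  have pm[measurable]: "p \<in> borel_measurable M" and rm[measurable]: "r \<in> borel_measurable M"
    unfolding p_def r_def by measurable
  have z1R': "bounded_by R' z1" using m mR'' by (rule bounded_by_mono)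
  have z1v: "AE w in M. \<bar>L0_rv (z1 v) w\<bar> \<le> m w * norm_rv v w" using m v by (simp add: bounded_by_def)
  have D_pos: "AE w in M. 0 < D w"
    using norm_rv_nonneg[OF v] ltb bk[OF z1 z1R'] z1v
  proof eventually_elim
    case (elim w)
    show ?case
    proof (rule ccontr)
      assume "\<not> 0 < D w"
      then have "w \<in> A" "norm_rv v w = 0" "s w = 0" using elim(1) s0[of w] by (auto simp: D_def split: if_splits)
      then show False using elim by simp
    qed
  qed
  let ?t = "\<lambda>w. p w * norm_rv v w"
  have pr: "AE w in M. 0 \<le> p w \<and> 0 \<le> r w \<and> ?t w + r w = 1 \<and> 0 \<le> ?t w"
    using D_pos norm_rv_nonneg[OF v]
  proof eventually_elim
    case (elim w)
    show ?case
    proof (cases "w \<in> A")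
      case True
      then have "norm_rv v w / D w + s w / D w = 1" using elim by (simp add: D_def add_divide_distrib[symmetric])
      then show ?thesis using True elim s0[of w] by (simp add: p_def r_def)
    qed (simp add: p_def r_def)
  qed
  let ?x' = "scale p v \<oplus> scale r x" and ?a' = "\<lambda>w. r w * (a w - d w) + ?t w * R w"
  have x': "?x' \<in> carrier E" using scale_closed[OF pm v] scale_closed[OF rm x] by simp
  have a'm: "?a' \<in> borel_measurable M" by measurable
  have x'1: "AE w in M. norm_rv ?x' w \<le> 1"
    using norm_rv_add[OF scale_closed[OF pm v] scale_closed[OF rm x]] norm_rv_scale[OF pm v] norm_rv_scale[OF rm x] pr x1
  proof eventually_elim
    case (elim w)
    have "r w * norm_rv x w \<le> r w" using elim by (simp add: mult_left_le)
    then show ?case using elim by simp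
  qed
  have new_margin: "AE w\<in>A in M. ?a' w \<le> L0_rv (k ?x') w" if k: "k \<in> K" "bounded_by R' k" for k
    using bk[OF k] ltb D_pos linear_add[OF lin[OF k(1)] scale_closed[OF pm v] scale_closed[OF rm x]]
      linear_scale[OF lin[OF k(1)] pm v] linear_scale[OF lin[OF k(1)] rm x]
  proof eventually_elim
    case (elim w)
    show ?case
    proof
      assume w: "w \<in> A"
      have "?a' w = (R w * norm_rv v w + s w * (a w - d w)) / D w"
        using w elim(3) by (simp add: p_def r_def add_divide_distrib)
      also have "\<dots> \<le> (L0_rv (k v) w + s w * L0_rv (k x) w) / D w"
        using elim(1-3) w by (intro divide_right_mono) auto
      also have "\<dots> = L0_rv (k ?x') w" using w elim by (simp add: p_def r_def add_divide_distrib)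
      finally show "?a' w \<le> L0_rv (k ?x') w" .
    qed
  qed
  have "AE w in M. \<bar>L0_rv (z1 ?x') w\<bar> \<le> m w * norm_rv ?x' w" using m x' by (simp add: bounded_by_def)
  with new_margin[OF z1 z1R'] x'1 am d0 have a'_m: "AE w in M. ?a' w \<le> m w"
  proof eventually_elim
    case (elim w)
    have "m w * norm_rv ?x' w \<le> m w" using elim m0[of w] by (simp add: mult_left_le)
    then show ?case using elim by (cases "w \<in> A") (auto simp: p_def r_def)
  qed
  have "?x' \<ominus> x = scale p v \<oplus> (scale r x \<ominus> scale (\<lambda>_. 1) x)"
    using scale_closed[OF pm v] scale_closed[OF rm x] x by (simp add: L0_class_one M.minus_eq M.a_assoc)
  then have diff: "?x' \<ominus> x = scale p v \<oplus> scale (\<lambda>w. r w - 1) x"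
    using scale_diff_left[OF rm _ x, of "\<lambda>_. 1"] by simp
  have r1m: "(\<lambda>w. r w - 1) \<in> borel_measurable M" by measurable
  have "AE w in M. norm_rv (?x' \<ominus> x) w \<le> 2 * (?a' w - a w + d w)"
    unfolding diff
    using norm_rv_add[OF scale_closed[OF pm v] scale_closed[OF r1m x]] norm_rv_scale[OF pm v] norm_rv_scale[OF r1m x] pr x1 am d0
  proof eventually_elim
    case (elim w)
    have r: "r w = 1 - ?t w" using elim by simp
    have "?t w * norm_rv x w \<le> ?t w" using elim by (simp add: mult_left_le)
    then have "norm_rv (scale p v \<oplus> scale (\<lambda>w. r w - 1) x) w \<le> 2 * ?t w" using elim by (simp add: r)
    also have "?t w \<le> ?t w * (R w - a w + d w)"
      using elim mR[of w] mult_left_mono[of 1 "R w - a w + d w" "?t w"] by simp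
    also have "\<dots> = ?a' w - a w + d w" unfolding r by (simp add: algebra_simps)
    finally show ?case by simp
  qed
  with x' x'1 a'm a'_m new_margin show thesis by (rule that)
qed

text \<open>The sequence of separating points for increasing radii has summable steps, since
  the margins, up to the summable losses, increase and are bounded by the norm of one functional in \<open>K\<close>.
  Its limit separates \<open>0\<close> from the whole of \<open>K\<close> on \<open>A\<close>.\<close>

theorem separation_from_zero:
  assumes compl: "L0_complete M E nrm" and K: "stable_functionals K" and bip: "bipolar_closed K"
    and ne: "K \<noteq> {}" and nonzero: "\<And>z. z \<in> K \<Longrightarrow> \<not> bounded_by (\<lambda>_. 0) z"
  obtains A x a where "A \<in> sets M" "0 < prob A" "x \<in> carrier E" "a \<in> borel_measurable M" "AE w\<in>A in M. 0 < a w"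
    "\<And>k. k \<in> K \<Longrightarrow> AE w\<in>A in M. a w \<le> L0_rv (k x) w"
proof -
  have Kd: "K \<subseteq> carrier dual" using K by (simp add: stable_functionals_def)
  have lin: "L0_linear M E k" if "k \<in> K" for k using Kd that by (blast intro: dualD(1))
  obtain z1 where z1: "z1 \<in> K" using ne by blast
  have z1d: "z1 \<in> carrier dual" using z1 Kd by blast
  obtain m where mm[measurable]: "m \<in> borel_measurable M" and m: "bounded_by m z1" and m0: "\<And>w. 0 \<le> m w"
    by (rule dual_bound[OF z1d]) (rule that)
  obtain A where A[measurable]: "A \<in> sets M" and Apos: "0 < prob A"
    and nonvanishing: "\<And>k R. k \<in> K \<Longrightarrow> R \<in> borel_measurable M \<Longrightarrow> bounded_by R k \<Longrightarrow> AE w\<in>A in M. R w \<noteq> 0"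
    by (rule nonvanishing_event[OF K ne nonzero]) (assumption, rule that)
  \<comment> \<open>the summand \<open>1\<close> makes \<open>R n - a n \<ge> 1\<close>, the gain of margin per unit of weight\<close>
  define R where "R n w = m w + 1 + real n" for n w
  have Rm[measurable]: "R n \<in> borel_measurable M" for n unfolding R_def by measurable
  have mR: "m w + 1 \<le> R n w" "R n w \<le> R (Suc n) w" for n w by (simp_all add: R_def)
  obtain x0 a0 where x0: "x0 \<in> carrier E" and x01: "AE w in M. norm_rv x0 w \<le> 1"
    and a0m[measurable]: "a0 \<in> borel_measurable M" and a0A: "AE w\<in>A in M. 0 < a0 w"
    and a00: "AE w in M. 0 \<le> a0 w" and a0_le: "AE w in M. a0 w \<le> m w"
    and margin0: "\<And>k. k \<in> K \<Longrightarrow> bounded_by (R 0) k \<Longrightarrow> AE w\<in>A in M. a0 w \<le> L0_rv (k x0) w"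
  proof -
    \<comment> \<open>the first point separates \<open>K 0\<close> from the zero functional, that is, from the ball of radius \<open>0\<close>\<close>
    have no_common: False
      if B: "B \<in> sets M" "B \<subseteq> A" "0 < prob B" and z: "z \<in> K"
        and bz: "bounded_by (\<lambda>w. if w \<in> B then 0 else m w) z" for B z
    proof -
      have "(\<lambda>w. if w \<in> B then 0 else m w) \<in> borel_measurable M" using B(1) by measurable
      from nonvanishing[OF z this bz] have "AE w in M. w \<notin> B"
        by eventually_elim (use B(2) in \<open>auto simp: subset_iff\<close>)
      then have "prob B = 0" using B(1) by (simp add: prob_eq_0)
      with B(3) show False by simp
    qed
    have mR0: "AE w in M. m w \<le> R 0 w" by (simp add: R_def)
    have c0: "AE w in M. (0::real) \<le> 0" by simp
    obtain v s b where v: "v \<in> carrier E" and "s \<in> borel_measurable M" and "\<And>w. 0 \<le> s w" and bm[measurable]: "b \<in> borel_measurable M"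
      and bpos: "AE w\<in>A in M. 0 * norm_rv v w + s w * 0 < b w"
      and bk: "\<And>k. k \<in> K \<Longrightarrow> bounded_by (R 0) k \<Longrightarrow> AE w in M. b w \<le> L0_rv (k v) w + s w * L0_rv (k \<zero>) w"
      by (rule separation_in_ball[OF Kd bip z1 m Rm mR0 borel_measurable_const c0 M.zero_closed borel_measurable_const A no_common])
        (assumption+, rule that)
    note [measurable] = norm_rv_measurable[OF v]
    define p where "p w = 1 / (\<bar>norm_rv v w\<bar> + 1)" for w
    have pm[measurable]: "p \<in> borel_measurable M" unfolding p_def by measurable
    have p: "0 < p w" for w by (simp add: p_def add_nonneg_pos)
    define a0 where "a0 w = (if w \<in> A then p w * b w else 0)" for w
    have a0m: "a0 \<in> borel_measurable M" unfolding a0_def by measurable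
    have sv: "scale p v \<in> carrier E" by (rule scale_closed[OF pm v])
    have norm1: "AE w in M. norm_rv (scale p v) w \<le> 1"
      using norm_rv_scale[OF pm v] norm_rv_nonneg[OF v]
      by eventually_elim (simp add: p_def)
    have margin: "AE w\<in>A in M. a0 w \<le> L0_rv (k (scale p v)) w" if k: "k \<in> K" "bounded_by (R 0) k" for k
      using bk[OF k] linear_zero[OF lin[OF k(1)]] linear_scale[OF lin[OF k(1)] pm v]
    proof eventually_elim
      case (elim w)
      then show ?case using p[of w] by (simp add: a0_def)
    qed
    have a0A: "AE w\<in>A in M. 0 < a0 w" using bpos by eventually_elim (simp add: a0_def p)
    then have a00: "AE w in M. 0 \<le> a0 w" by eventually_elim (auto simp: a0_def)
    have z1R: "bounded_by (R 0) z1" using m mR0 by (rule bounded_by_mono)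
    have "AE w in M. \<bar>L0_rv (z1 (scale p v)) w\<bar> \<le> m w * norm_rv (scale p v) w" using m sv by (simp add: bounded_by_def)
    with margin[OF z1 z1R] norm1 have a0_le: "AE w in M. a0 w \<le> m w"
    proof eventually_elim
      case (elim w)
      have "m w * norm_rv (scale p v) w \<le> m w" using elim m0[of w] by (simp add: mult_left_le)
      then show ?case using elim m0[of w] by (cases "w \<in> A") (auto simp: a0_def)
    qed
    show thesis using sv norm1 a0m a0A a00 a0_le margin by (rule that)
  qed
  \<comment> \<open>the losses add up to \<open>a0 / 2\<close>, so that half of the first margin survives\<close>
  define d where "d n w = a0 w / 2 ^ (n + 2)" for n w
  have dm[measurable]: "d n \<in> borel_measurable M" for n unfolding d_def by measurable
  have d0: "AE w in M. 0 \<le> d n w" for n using a00 by eventually_elim (simp add: d_def)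
  have dA: "AE w\<in>A in M. 0 < d n w" for n using a0A by eventually_elim (simp add: d_def)
  define P where "P n xa \<longleftrightarrow> fst xa \<in> carrier E \<and> (AE w in M. norm_rv (fst xa) w \<le> 1) \<and>
      snd xa \<in> borel_measurable M \<and> (AE w in M. snd xa w \<le> m w) \<and>
      (\<forall>k\<in>K. bounded_by (R n) k \<longrightarrow> (AE w\<in>A in M. snd xa w \<le> L0_rv (k (fst xa)) w)) \<and>
      (n = 0 \<longrightarrow> snd xa = a0)" for n :: nat and xa :: "'e \<times> ('w \<Rightarrow> real)"
  define Q where "Q n xa ya \<longleftrightarrow> (AE w in M. norm_rv (fst ya \<ominus> fst xa) w \<le> 2 * (snd ya w - snd xa w + d n w))"
    for n and xa ya :: "'e \<times> ('w \<Rightarrow> real)"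
  have P_D: "fst xa \<in> carrier E" "AE w in M. norm_rv (fst xa) w \<le> 1"
      "snd xa \<in> borel_measurable M" "AE w in M. snd xa w \<le> m w"
      "\<forall>k\<in>K. bounded_by (R n) k \<longrightarrow> (AE w\<in>A in M. snd xa w \<le> L0_rv (k (fst xa)) w)"
      "n = 0 \<Longrightarrow> snd xa = a0" if "P n xa" for n xa
    apply (insert that[unfolded P_def])
    apply (elim conjE, assumption)+
    apply (elim conjE, simp)
    done
  have P0: "P 0 (x0, a0)"
    unfolding P_def fst_conv snd_conv using x0 x01 a0m a0_le margin0 by blast
  have step: "\<exists>ya. P (Suc n) ya \<and> Q n xa ya" if P: "P n xa" for n xa
  proof -
    note xa = P_D(1-4)[OF P] and marg = P_D(5)[OF P]
    have marg': "AE w\<in>A in M. snd xa w \<le> L0_rv (k (fst xa)) w" if "k \<in> K" "bounded_by (R n) k" for k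
      by (rule mp[OF bspec[OF marg that(1)] that(2)])
    obtain x' a' where x': "x' \<in> carrier E" "AE w in M. norm_rv x' w \<le> 1"
      "a' \<in> borel_measurable M" "AE w in M. a' w \<le> m w"
      and marg'': "\<And>k. k \<in> K \<Longrightarrow> bounded_by (R (Suc n)) k \<Longrightarrow> AE w\<in>A in M. a' w \<le> L0_rv (k x') w"
      and dist: "AE w in M. norm_rv (x' \<ominus> fst xa) w \<le> 2 * (a' w - snd xa w + d n w)"
      by (rule margin_step[where R = "R n" and R' = "R (Suc n)" and d = "d n" and m = m and a = "snd xa" and x = "fst xa",
          OF Kd bip A z1 m Rm Rm mR(1) m0 mR(2) dm d0 dA xa]) (erule (1) marg', rule that)
    have "P (Suc n) (x', a')"
      unfolding P_def fst_conv snd_conv by (intro conjI x' ballI impI marg'') simp_all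
    moreover have "Q n xa (x', a')" unfolding Q_def fst_conv snd_conv by (rule dist)
    ultimately show ?thesis by blast
  qed
  have "\<exists>g. \<forall>n. P n (g n) \<and> Q n (g n) (g (Suc n))"
    by (rule dependent_nat_choice) (use P0 step in blast)+
  then obtain g where gP: "\<And>n. P n (g n)" and gQ: "\<And>n. Q n (g n) (g (Suc n))" by blast
  define xs as where "xs n = fst (g n)" and "as n = snd (g n)" for n
  have xs: "xs n \<in> carrier E" and asm[measurable]: "as n \<in> borel_measurable M" and as_le: "AE w in M. as n w \<le> m w"
    and marg_all: "\<forall>k\<in>K. bounded_by (R n) k \<longrightarrow> (AE w\<in>A in M. as n w \<le> L0_rv (k (xs n)) w)" for n
    unfolding xs_def as_def by (fact P_D(1)[OF gP] P_D(3)[OF gP] P_D(4)[OF gP] P_D(5)[OF gP])+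
  have as0: "as 0 = a0" using P_D(6)[OF gP[of 0]] unfolding as_def by simp
  have dist: "AE w in M. norm_rv (xs (Suc n) \<ominus> xs n) w \<le> 2 * (as (Suc n) w - as n w + d n w)" for n
    using gQ[of n] unfolding Q_def xs_def as_def .
  define c where "c n w = 2 * (as n w + (\<Sum>i<n. d i w))" for n w
  have cm: "c n \<in> borel_measurable M" for n unfolding c_def by measurable
  have sum_d: "(\<Sum>i<n. d i w) \<le> a0 w / 2" if "0 \<le> a0 w" for n w
  proof -
    have "(\<Sum>i<n. d i w) = a0 w / 2 - a0 w / 2 ^ (n + 1)"
      by (induction n) (simp_all add: d_def field_simps)
    then show ?thesis using that by simp
  qed
  have stepc: "AE w in M. norm_rv (xs (Suc n) \<ominus> xs n) w \<le> c (Suc n) w - c n w" for n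
    using dist[of n] by eventually_elim (simp add: c_def)
  have "AE w in M. \<forall>n. as n w \<le> m w" using as_le by (simp add: AE_all_countable)
  with a00 have bdd: "AE w in M. bdd_above (range (\<lambda>n. c n w))"
  proof eventually_elim
    case (elim w)
    have "c n w \<le> 2 * (m w + a0 w / 2)" for n
      using elim(2)[rule_format, of n] sum_d[OF elim(1), of n] by (simp add: c_def)
    then show ?case by (intro bdd_aboveI[of _ "2 * (m w + a0 w / 2)"]) auto
  qed
  obtain x b where x: "x \<in> carrier E" and xb: "\<And>n. AE w in M. norm_rv (x \<ominus> xs n) w \<le> b n w"
    and b0: "AE w in M. (\<lambda>n. b n w) \<longlonglongrightarrow> 0"
    by (rule almost_sure_limit_exists[where xs = xs and c = c, OF compl xs cm stepc bdd]) (rule that)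
  have "AE w in M. \<forall>n. 0 \<le> norm_rv (xs (Suc n) \<ominus> xs n) w"
    unfolding AE_all_countable using xs by (intro allI norm_rv_nonneg M.minus_closed)
  moreover have "AE w in M. \<forall>n. norm_rv (xs (Suc n) \<ominus> xs n) w \<le> c (Suc n) w - c n w"
    unfolding AE_all_countable using stepc by (intro allI)
  ultimately have as_ge: "AE w in M. \<forall>n. a0 w / 2 \<le> as n w"
    using a00
  proof eventually_elim
    case (elim w)
    have "c n w \<le> c (Suc n) w" for n using elim(1)[rule_format, of n] elim(2)[rule_format, of n] by linarith
    then have "c 0 w \<le> c n w" for n by (rule lift_Suc_mono_le[where f = "\<lambda>n. c n w"]) simp
    then have "2 * a0 w \<le> 2 * (as n w + (\<Sum>i<n. d i w))" for n by (simp add: c_def as0)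
    then show ?case using sum_d[OF elim(3)] by (smt (verit) field_sum_of_halves)
  qed
  \<comment> \<open>a bound \<open>S\<close> of \<open>k\<close> may exceed each \<open>R n\<close> on some event, so the estimate at \<open>xs n\<close> is used for
    the functional that agrees with \<open>k\<close> where \<open>S \<le> R n\<close> and with \<open>z1\<close> elsewhere\<close>
  have final: "AE w\<in>A in M. a0 w / 2 \<le> L0_rv (k x) w" if k: "k \<in> K" for k
  proof -
    have kd: "k \<in> carrier dual" using k Kd by blast
    obtain S where Sm[measurable]: "S \<in> borel_measurable M" and S: "bounded_by S k"
      by (rule dual_bound[OF kd]) (rule that)
    have near: "AE w\<in>A in M. S w \<le> R n w \<longrightarrow> as n w \<le> L0_rv (k (xs n)) w" for n
    proof -
      have "{w \<in> space M. S w \<le> R n w} \<in> sets M" by measurable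
      then obtain h where h: "h \<in> K"
        "\<And>x. x \<in> carrier E \<Longrightarrow> AE w in M. L0_rv (h x) w = (if S w \<le> R n w then L0_rv (k x) w else L0_rv (z1 x) w)"
        by (rule stable_functionals_patch[OF K k z1]) (rule that)
      have "bounded_by (R n) h"
        unfolding bounded_by_def
      proof
        fix y assume y: "y \<in> carrier E"
        have "AE w in M. \<bar>L0_rv (k y) w\<bar> \<le> S w * norm_rv y w" "AE w in M. \<bar>L0_rv (z1 y) w\<bar> \<le> m w * norm_rv y w"
          using S m y by (simp_all add: bounded_by_def)
        with h(2)[OF y] norm_rv_nonneg[OF y] show "AE w in M. \<bar>L0_rv (h y) w\<bar> \<le> R n w * norm_rv y w"
        proof eventually_elim
          case (elim w)
          have "m w * norm_rv y w \<le> R n w * norm_rv y w" using elim by (intro mult_right_mono) (simp_all add: R_def)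
          moreover have "S w * norm_rv y w \<le> R n w * norm_rv y w" if "S w \<le> R n w"
            using elim that by (intro mult_right_mono)
          ultimately show ?case using elim by (auto split: if_splits)
        qed
      qed
      from mp[OF bspec[OF marg_all h(1)] this] h(2)[OF xs[of n]] show ?thesis
        by eventually_elim auto
    qed
    then have "AE w in M. \<forall>n. w \<in> A \<longrightarrow> S w \<le> R n w \<longrightarrow> as n w \<le> L0_rv (k (xs n)) w"
      unfolding AE_all_countable by (intro allI)
    moreover have "AE w in M. \<forall>n. \<bar>L0_rv (k x) w - L0_rv (k (xs n)) w\<bar> \<le> S w * norm_rv (x \<ominus> xs n) w"
      unfolding AE_all_countable using bounded_by_Lipschitz[OF lin[OF k] S x xs] by (intro allI)
    moreover have "AE w in M. \<forall>n. norm_rv (x \<ominus> xs n) w \<le> b n w"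
      unfolding AE_all_countable using xb by (intro allI)
    moreover have "AE w in M. \<forall>n. 0 \<le> norm_rv (x \<ominus> xs n) w"
      unfolding AE_all_countable using xs x by (intro allI norm_rv_nonneg M.minus_closed)
    ultimately show ?thesis
      using as_ge b0
    proof eventually_elim
      case (elim w)
      show ?case
      proof
        assume w: "w \<in> A"
        obtain n0 where n0: "S w \<le> real n0" using real_arch_simple by blast
        have lim: "(\<lambda>n. L0_rv (k x) w + \<bar>S w\<bar> * b n w) \<longlonglongrightarrow> L0_rv (k x) w + \<bar>S w\<bar> * 0"
          by (intro tendsto_intros elim)
        have "a0 w / 2 \<le> L0_rv (k x) w + \<bar>S w\<bar> * b n w" if n: "n0 \<le> n" for n
        proof -
          have "S w \<le> R n w" using n0 n m0[of w] by (simp add: R_def)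
          then have "a0 w / 2 \<le> L0_rv (k (xs n)) w" using elim(1,5) w by (meson order_trans)
          also have "\<dots> \<le> L0_rv (k x) w + S w * norm_rv (x \<ominus> xs n) w"
            using elim(2)[rule_format, of n] by linarith
          also have "S w * norm_rv (x \<ominus> xs n) w \<le> \<bar>S w\<bar> * b n w"
            using elim(3,4) by (intro mult_mono) auto
          finally show ?thesis by simp
        qed
        then show "a0 w / 2 \<le> L0_rv (k x) w"
          using LIMSEQ_le_const[OF lim, of "a0 w / 2"] by auto
      qed
    qed
  qed
  have "(\<lambda>w. a0 w / 2) \<in> borel_measurable M" by measurable
  moreover have "AE w\<in>A in M. 0 < a0 w / 2" using a0A by eventually_elim simp
  ultimately show thesis using A Apos x final by (intro that[of A x "\<lambda>w. a0 w / 2"])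
qed

section \<open>The Krein-Smulian theorem\<close>

lemma dual_ball_eq:
  assumes "\<epsilon> \<in> L0_pos M"
  shows "{z \<in> carrier dual. L0_le M (L0_dual_norm M E nrm z) \<epsilon>} = {z \<in> carrier dual. bounded_by (L0_rv \<epsilon>) z}"
  using dual_norm_le_iff[OF _ assms] by blast

text \<open>A bounded part of the translate comes from the part of \<open>K\<close> in a ball around \<open>z0\<close>, which lies in a
  larger ball around zero; a lower estimate valid on the larger part holds on the smaller one.\<close>

lemma translate_stable_bipolar:
  assumes conv: "L0_convex M dual K" and rs: "relatively_stable M dual K"
    and balls: "\<And>\<epsilon>. \<epsilon> \<in> L0_pos M \<Longrightarrow> closedin weak_star {k \<in> K. bounded_by (L0_rv \<epsilon>) k}"
    and z0: "z0 \<in> carrier dual"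
  defines "K' \<equiv> (\<lambda>k. comb (\<lambda>_. 1) k (\<lambda>_. -1) z0) ` K"
  shows "stable_functionals K'" "bipolar_closed K'"
proof -
  let ?sh = "\<lambda>k. comb (\<lambda>_. 1) k (\<lambda>_. -1) z0" and ?z = "\<lambda>z. comb (\<lambda>_. 1) z (\<lambda>_. 1) z0"
  have K: "K \<subseteq> carrier dual" using rs by (simp add: relatively_stable_def)
  have kd: "k \<in> carrier dual" if "k \<in> K" for k using K that by blast
  have c1: "(\<lambda>_. 1 :: real) \<in> borel_measurable M" and c2: "(\<lambda>_. - 1 :: real) \<in> borel_measurable M" by simp_all
  have rv: "AE w in M. L0_rv (?sh z x) w = L0_rv (z x) w - L0_rv (z0 x) w"
    if "z \<in> carrier dual" "x \<in> carrier E" for z x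
    using comb_rv[OF dualD(1)[OF that(1)] dualD(1)[OF z0] c1 c2 that(2)] by eventually_elim simp
  have rv': "AE w in M. L0_rv (?z z x) w = L0_rv (z x) w + L0_rv (z0 x) w"
    if "z \<in> carrier dual" "x \<in> carrier E" for z x
    using comb_rv[OF dualD(1)[OF that(1)] dualD(1)[OF z0] c1 c1 that(2)] by eventually_elim simp
  have K'd: "K' \<subseteq> carrier dual" unfolding K'_def using kd by (auto intro!: comb_in_dual z0 c1 c2)
  show "stable_functionals K'"
    unfolding stable_functionals_def
  proof (intro conjI allI impI K'd)
    fix ks' :: "nat \<Rightarrow> 'e \<Rightarrow> 'w L0" and N :: "'w \<Rightarrow> nat" assume ks': "range ks' \<subseteq> K'" and N: "N \<in> measurable M (count_space UNIV)"
    have "\<exists>k. k \<in> K \<and> ks' n = ?sh k" for n :: nat using ks' unfolding K'_def by blast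
    then have "\<exists>ks. \<forall>n. ks n \<in> K \<and> ks' n = ?sh (ks n)" by (intro choice allI)
    then obtain ks where ks: "\<And>n :: nat. ks n \<in> K" "\<And>n. ks' n = ?sh (ks n)" by blast
    obtain k where k: "k \<in> K" "\<And>x. x \<in> carrier E \<Longrightarrow> AE w in M. L0_rv (k x) w = L0_rv (ks (N w) x) w"
      by (rule relatively_stable_concatenation[where ks = ks, OF rs ks(1) N]) (rule that)
    show "\<exists>k\<in>K'. \<forall>x\<in>carrier E. AE w in M. L0_rv (k x) w = L0_rv (ks' (N w) x) w"
    proof (rule bexI, rule ballI)
      show "?sh k \<in> K'" unfolding K'_def using k(1) by blast
      fix x assume x: "x \<in> carrier E"
      have "AE w in M. \<forall>n. L0_rv (ks' n x) w = L0_rv (ks n x) w - L0_rv (z0 x) w"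
        unfolding AE_all_countable ks(2) using rv[OF kd[OF ks(1)] x] by (intro allI)
      with k(2)[OF x] rv[OF kd[OF k(1)] x]
      show "AE w in M. L0_rv (?sh k x) w = L0_rv (ks' (N w) x) w"
        by eventually_elim simp
    qed
  qed
  show "bipolar_closed K'"
    unfolding bipolar_closed_def
  proof (intro ballI impI)
    fix R z assume Rm[measurable]: "R \<in> borel_measurable M" and z: "z \<in> carrier dual"
      and ex: "\<exists>k\<in>K'. bounded_by R k"
      and above: "\<forall>u\<in>carrier E. \<forall>b\<in>borel_measurable M.
        (\<forall>k\<in>K'. bounded_by R k \<longrightarrow> (AE w in M. b w \<le> L0_rv (k u) w)) \<longrightarrow> (AE w in M. b w \<le> L0_rv (z u) w)"
    obtain S where Sm[measurable]: "S \<in> borel_measurable M" and S: "bounded_by S z0" and S0: "\<And>w. 0 \<le> S w"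
      by (rule dual_bound[OF z0]) (rule that)
    define \<epsilon> where "\<epsilon> = L0_class M (\<lambda>w. \<bar>R w\<bar> + S w + 1)"
    have \<epsilon>m: "(\<lambda>w. \<bar>R w\<bar> + S w + 1) \<in> borel_measurable M" by measurable
    have \<epsilon>: "\<epsilon> \<in> L0_pos M" unfolding \<epsilon>_def using S0 by (intro L0_class_pos \<epsilon>m) (simp add: add_nonneg_pos)
    have r\<epsilon>: "AE w in M. L0_rv \<epsilon> w = \<bar>R w\<bar> + S w + 1" unfolding \<epsilon>_def by (rule L0_rv_class[OF \<epsilon>m])
    have in_ball: "bounded_by (L0_rv \<epsilon>) k" if k: "k \<in> K" "bounded_by R (?sh k)" for k
      unfolding bounded_by_def
    proof
      fix x assume x: "x \<in> carrier E"
      have "AE w in M. \<bar>L0_rv (?sh k x) w\<bar> \<le> R w * norm_rv x w"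
        "AE w in M. \<bar>L0_rv (z0 x) w\<bar> \<le> S w * norm_rv x w"
        using k(2) S x by (simp_all add: bounded_by_def)
      with rv[OF kd[OF k(1)] x] r\<epsilon> norm_rv_nonneg[OF x]
      show "AE w in M. \<bar>L0_rv (k x) w\<bar> \<le> L0_rv \<epsilon> w * norm_rv x w"
      proof eventually_elim
        case (elim w)
        have "R w * norm_rv x w \<le> \<bar>R w\<bar> * norm_rv x w" using elim by (intro mult_right_mono) auto
        then show ?case using elim by (simp add: distrib_right)
      qed
    qed
    have z': "?z z \<in> carrier dual" by (rule comb_in_dual[OF z z0 c1 c1])
    have zK: "?z z \<in> K"
    proof (rule closed_convex_bipolar[OF conv rs L0_rv_measurable[OF L0_posD[OF \<epsilon>]] balls[OF \<epsilon>] _ z'])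
      obtain k where k: "k \<in> K" "bounded_by R (?sh k)" using ex unfolding K'_def by blast
      then show "{k \<in> K. bounded_by (L0_rv \<epsilon>) k} \<noteq> {}" using in_ball[OF k] by blast
    next
      fix u b assume u: "u \<in> carrier E" and b[measurable]: "b \<in> borel_measurable M"
        and le: "\<And>k. k \<in> {k \<in> K. bounded_by (L0_rv \<epsilon>) k} \<Longrightarrow> AE w in M. b w \<le> L0_rv (k u) w"
      have bm: "(\<lambda>w. b w - L0_rv (z0 u) w) \<in> borel_measurable M"
        using linear_measurable[OF dualD(1)[OF z0] u] by measurable
      have "\<forall>k\<in>K'. bounded_by R k \<longrightarrow> (AE w in M. b w - L0_rv (z0 u) w \<le> L0_rv (k u) w)"
      proof (intro ballI impI)
        fix k' assume "k' \<in> K'" and bk': "bounded_by R k'"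
        then obtain k where k: "k \<in> K" "k' = ?sh k" unfolding K'_def by blast
        have "bounded_by (L0_rv \<epsilon>) k" using in_ball[OF k(1)] bk' unfolding k(2) .
        then have "AE w in M. b w \<le> L0_rv (k u) w" using k(1) by (intro le) simp
        with rv[OF kd[OF k(1)] u] show "AE w in M. b w - L0_rv (z0 u) w \<le> L0_rv (k' u) w"
          unfolding k(2) by eventually_elim simp
      qed
      from mp[OF bspec[OF bspec[OF above u] bm] this] rv'[OF z u]
      show "AE w in M. b w \<le> L0_rv (?z z u) w"
        by eventually_elim simp
    qed
    have "z = ?sh (?z z)"
    proof (rule dual_eqI[OF z comb_in_dual[OF z' z0 c1 c2]])
      fix x assume x: "x \<in> carrier E"
      show "AE w in M. L0_rv (z x) w = L0_rv (?sh (?z z) x) w"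
        using rv[OF z' x] rv'[OF z x] by eventually_elim simp
    qed
    then show "z \<in> K'" using zK unfolding K'_def by (rule image_eqI[where x = "?z z"])
  qed
qed

text \<open>For \<open>z0\<close> outside \<open>K\<close>, half of the margin by which a single point \<open>x\<close> separates \<open>K\<close> from \<open>z0\<close>
  on \<open>A\<close> is the tolerance of a weak-star neighbourhood of \<open>z0\<close> that misses \<open>K\<close>.\<close>

lemma closedin_if_balls_closedin:
  assumes compl: "L0_complete M E nrm"
    and conv: "L0_convex M dual K" and rs: "relatively_stable M dual K"
    and balls: "\<And>\<epsilon>. \<epsilon> \<in> L0_pos M \<Longrightarrow> closedin weak_star {k \<in> K. bounded_by (L0_rv \<epsilon>) k}"
  shows "closedin weak_star K"
proof (cases "K = {}")
  case False
  have K: "K \<subseteq> carrier dual" using rs by (simp add: relatively_stable_def)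
  have c1: "(\<lambda>_. 1 :: real) \<in> borel_measurable M" and c2: "(\<lambda>_. - 1 :: real) \<in> borel_measurable M" by simp_all
  have "openin weak_star (carrier dual - K)"
    unfolding openin_weak_star
  proof (intro conjI ballI)
    fix z0 assume "z0 \<in> carrier dual - K"
    then have z0: "z0 \<in> carrier dual" "z0 \<notin> K" by auto
    let ?sh = "\<lambda>k. comb (\<lambda>_. 1) k (\<lambda>_. -1) z0"
    let ?K = "?sh ` K"
    have rv: "AE w in M. L0_rv (?sh k x) w = L0_rv (k x) w - L0_rv (z0 x) w"
      if "k \<in> K" "x \<in> carrier E" for k x
    proof -
      have "k \<in> carrier dual" using K that(1) by blast
      from comb_rv[OF dualD(1)[OF this] dualD(1)[OF z0(1)] c1 c2 that(2)] show ?thesis by eventually_elim simp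
    qed
    have nonzero: "\<not> bounded_by (\<lambda>_. 0) z" if "z \<in> ?K" for z
    proof
      assume b: "bounded_by (\<lambda>_. 0) z"
      obtain k where k: "k \<in> K" "z = ?sh k" using \<open>z \<in> ?K\<close> by blast
      have "k = z0"
      proof (rule dual_eqI)
        show "k \<in> carrier dual" "z0 \<in> carrier dual" using K k(1) z0(1) by auto
        fix x assume x: "x \<in> carrier E"
        have "AE w in M. \<bar>L0_rv (z x) w\<bar> \<le> 0 * norm_rv x w" using b x unfolding bounded_by_def by (rule bspec)
        with rv[OF k(1) x] show "AE w in M. L0_rv (k x) w = L0_rv (z0 x) w"
          unfolding k(2) by eventually_elim simp
      qed
      with k(1) z0(2) show False by simp
    qed
    have ne: "?K \<noteq> {}" using False by simp
    note tr = translate_stable_bipolar[OF conv rs balls z0(1)]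
    obtain A x a where A: "A \<in> sets M" "0 < prob A" and x: "x \<in> carrier E" and a[measurable]: "a \<in> borel_measurable M"
      and apos: "AE w\<in>A in M. 0 < a w"
      and sep: "\<And>k. k \<in> ?K \<Longrightarrow> AE w\<in>A in M. a w \<le> L0_rv (k x) w"
      by (rule separation_from_zero[OF compl tr ne nonzero]) (assumption+, rule that)
    \<comment> \<open>a tolerance has to be positive everywhere; the value \<open>1\<close> is taken where \<open>a\<close> is not\<close>
    define e where "e w = (if 0 < a w then a w / 2 else 1)" for w
    show "\<exists>F e. finite F \<and> F \<subseteq> carrier E \<and> e \<in> borel_measurable M \<and> (AE w in M. 0 < e w) \<and>
       (\<forall>z'\<in>carrier dual. (\<forall>x\<in>F. AE w in M. \<bar>L0_rv (z' x) w - L0_rv (z0 x) w\<bar> \<le> e w) \<longrightarrow> z' \<in> carrier dual - K)"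
    proof (intro exI[of _ "{x}"] exI[of _ e] conjI ballI impI)
      show "e \<in> borel_measurable M" unfolding e_def by measurable
      show "AE w in M. 0 < e w" by (simp add: e_def)
      fix z' assume z': "z' \<in> carrier dual" and "\<forall>x\<in>{x}. AE w in M. \<bar>L0_rv (z' x) w - L0_rv (z0 x) w\<bar> \<le> e w"
      then have near: "AE w in M. \<bar>L0_rv (z' x) w - L0_rv (z0 x) w\<bar> \<le> e w" by simp
      have "z' \<notin> K"
      proof
        assume z'K: "z' \<in> K"
        have "AE w\<in>A in M. a w \<le> L0_rv (?sh z' x) w" by (rule sep[OF imageI[OF z'K]])
        with rv[OF z'K x] near apos have "AE w in M. w \<notin> A"
          by eventually_elim (auto simp: e_def)
        then have "prob A = 0" using A(1) by (simp add: prob_eq_0)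
        with A(2) show False by simp
      qed
      with z' show "z' \<in> carrier dual - K" by simp
    qed (use x in simp_all)
  qed simp
  then show ?thesis using K by (simp add: closedin_def topspace_weak_star)
qed simp

end

theorem theorem3p1:
  fixes M :: "'w measure"
    and E :: "('w L0, 'e, 'm) module_scheme"
    and nrm :: "'e \<Rightarrow> 'w L0"
    and K :: "('e \<Rightarrow> 'w L0) set"
  assumes "prob_space M"
    and "L0_normed_module M E nrm"
    and "L0_complete M E nrm"
    and "stable_with_uniqueness M E"
    and "K \<subseteq> carrier (L0_dual M E nrm)"
    and "L0_convex M (L0_dual M E nrm) K"
    and "relatively_stable M (L0_dual M E nrm) K"
  shows "closedin (L0_weak_star M E nrm) K \<longleftrightarrow>
    (\<forall>\<epsilon>\<in>L0_pos M. closedin (L0_weak_star M E nrm)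
       (K \<inter> {z \<in> carrier (L0_dual M E nrm). L0_le M (L0_dual_norm M E nrm z) \<epsilon>}))"
proof -
  have "Module.module (L0 M) E" using assms(2) by (simp add: L0_normed_module_def)
  then interpret L0_stable M E nrm
    using assms(1,2,4) by (simp add: L0_stable_def L0_stable_axioms_def L0_normed_def L0_normed_axioms_def L0_module_def)
  have ball: "K \<inter> {z \<in> carrier dual. L0_le M (L0_dual_norm M E nrm z) \<epsilon>} = {k \<in> K. bounded_by (L0_rv \<epsilon>) k}"
    if "\<epsilon> \<in> L0_pos M" for \<epsilon>
    unfolding dual_ball_eq[OF that] using assms(5) by blast
  show ?thesis
  proof
    assume K: "closedin (L0_weak_star M E nrm) K"
    show "\<forall>\<epsilon>\<in>L0_pos M. closedin (L0_weak_star M E nrm)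
       (K \<inter> {z \<in> carrier dual. L0_le M (L0_dual_norm M E nrm z) \<epsilon>})"
    proof
      fix \<epsilon> assume \<epsilon>: "\<epsilon> \<in> L0_pos M"
      show "closedin (L0_weak_star M E nrm) (K \<inter> {z \<in> carrier dual. L0_le M (L0_dual_norm M E nrm z) \<epsilon>})"
        unfolding dual_ball_eq[OF \<epsilon>]
        by (rule closedin_Int[OF K closedin_dual_ball[OF L0_rv_measurable[OF L0_posD[OF \<epsilon>]]]])
    qed
  next
    assume balls: "\<forall>\<epsilon>\<in>L0_pos M. closedin (L0_weak_star M E nrm)
       (K \<inter> {z \<in> carrier dual. L0_le M (L0_dual_norm M E nrm z) \<epsilon>})"
    show "closedin (L0_weak_star M E nrm) K"
    proof (rule closedin_if_balls_closedin[OF assms(3,6,7)])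
      fix \<epsilon> assume \<epsilon>: "\<epsilon> \<in> L0_pos M"
      show "closedin (L0_weak_star M E nrm) {k \<in> K. bounded_by (L0_rv \<epsilon>) k}"
        using bspec[OF balls \<epsilon>] unfolding ball[OF \<epsilon>] .
    qed
  qed
qed

end
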